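(* For every term $t\in\mathcal T$ and for all CE-strategies $S,S'$ in canonical form (i.e. $S,S'\in\mathcal C_{can}$), $$\Psi(S\sqcap S',t)=\Psi(S,t)\sqcap\Psi(S',t),$$ where on the left $\sqcap$ is the unification of canonical CE-strategies and on the right $\sqcap$ is the unification of position-based CE-strategies.
   Context: Terms and positions. Let $\mathcal F=\bigcup_{n\ge0}\mathcal F_n$ be a signature ($f\in\mathcal F_n$ has arity $\mathit{ar}(f)=n$; $\mathcal F_0\neq\emptyset$), $\mathcal X$ a countable set of variables and $\mathcal T$ the set of terms over $\mathcal F\cup\mathcal X$. For a term $u$, $\mathit{ar}(u)$ is the arity of its root symbol and $[n]=\{1,\dots,n\}$. A context is a term over $\mathcal F\cup\mathcal X\cup\{\square\}$ ($\square\notin\mathcal F$ a constant) with exactly one occurrence of $\square$; $\mathcal T_\square$ is the set of contexts and $\mathcal T_\square^\star=\bigcup_{k\ge1}\mathcal T_\square^k$ the set of finite nonempty tuples of contexts. Positions are finite sequences of positive integers ($\epsilon$ the empty sequence, $pq$ concatenation); $\mathbb N_\epsilon=\{\epsilon\}\cup\mathbb N$. $\mathcal Pos(t)$ is the set of positions of $t$ ($\{\epsilon\}$ for variables/constants, $\{\epsilon\}\cup\{ip:p\in\mathcal Pos(t_i)\}$ for $f(t_1,\dots,t_n)$), $t_{|p}$ the subterm at $p$, $t[s]_p$ the result of replacing $t_{|p}$ by $s$. $p\le q$ iff $q=pp'$ for some $p'$, $p<q$ iff moreover $p'\neq\epsilon$, $p\parallel q$ iff they are $\le$-incomparable, and $p\sqsubset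 q$ iff $p<q$ or $p\parallel q$. The depth $\delta(t)$ is $0$ for variables and constants and $1+\max_i\delta(t_i)$ for $f(t_1,\dots,t_n)$. A term $u$ matches $t$ if $\sigma(u)=t$ for some substitution $\sigma$; for unifiable $u,u'$ with most general unifier $\gamma$, $u\wedge u'=\gamma(u)$. $\mathbb F$ denotes failure. Contexts. For $\tau,\tau'\in\mathcal T_\square$, $\tau[\tau']$ is $\tau$ with $\square$ replaced by $\tau'$ (likewise $\tau[s]$ for a term $s$). For tuples, $\boldsymbol\tau\cdot\boldsymbol\tau'$ is concatenation. The evaluation $\mathrm{eval}(\boldsymbol\tau)\in\mathcal T_\square$ of a tuple written as a concatenation $\boldsymbol\tau_1\cdot\ldots\cdot\boldsymbol\tau_n$ of tuples is defined by: if $\boldsymbol\tau_i=\boldsymbol\tau_{i+1}$ for some $i$ then $\mathrm{eval}(\boldsymbol\tau_1\cdots\boldsymbol\tau_n)=\mathrm{eval}(\boldsymbol\tau_1\cdots\boldsymbol\tau_i\cdot\boldsymbol\tau_{i+2}\cdots\boldsymbol\tau_n)$; otherwise $\mathrm{eval}((\tau_1))=\tau_1$ and $\mathrm{eval}((\tau_1,\dots,\tau_m))=\tau_1[\mathrm{eval}((\tau_2,\dots,\tau_m))]$ for $m\ge2$. Position-based CE-strategies. Such a strategy is either the failing strategy $[\,]$ or a list $E=[@p_1.\boldsymbol\tau_1,\dots,@p_n.\boldsymbol\tau_n]$ ($n\ge1$, $p_i$ positions, $\boldsymbol\tau_i\in\mathcal T_\square^\star$). It is well-founded if $p_i\neq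 p_j$ for $i\ne j$ and $i<j$ iff $p_i\sqsubset p_j$; $[\,]$ is well-founded. $\mathcal E$ is the set of well-founded ones; $E=E'$ means equality up to permutation of entries at parallel positions. For a position $p$, $p\cdot[@p_1.\boldsymbol\tau_1,\dots,@p_n.\boldsymbol\tau_n]=[@pp_1.\boldsymbol\tau_1,\dots,@pp_n.\boldsymbol\tau_n]$; $\sqcup$ denotes list concatenation. Semantics $[\![E]\!]$ on $\mathcal T\cup\{\mathbb F\}$: $[\![\,[\,]\,]\!](t)=\mathbb F$; $[\![E]\!](\mathbb F)=\mathbb F$; $[\![@p.\boldsymbol\tau]\!](t)=t[\mathrm{eval}(\boldsymbol\tau)[t_{|p}]]_p$ if $p\in\mathcal Pos(t)$, else $\mathbb F$; $[\![[@p_1.\boldsymbol\tau_1,\dots,@p_n.\boldsymbol\tau_n]]\!]=[\![@p_n.\boldsymbol\tau_n]\!]\circ\dots\circ[\![@p_1.\boldsymbol\tau_1]\!]$. Unification: $E\sqcap E'=[\,]$ if $E=[\,]$ or $E'=[\,]$; otherwise, for $E=[@p_i.\boldsymbol\tau_i]_{i\le n}$ and $E'=[@p'_j.\boldsymbol\tau'_j]_{j\le m}$ with position sets $P,P'$, $E\sqcap E'$ is the well-founded list with position set $P\cup P'$ carrying $\boldsymbol\tau_i$ at $p_i\in P\setminus P'$, $\boldsymbol\tau'_j$ at $p'_j\in P'\setminus P$, and $\boldsymbol\tau'_j\cdot\boldsymbol\tau_i$ at $p_i=p'_j\in P\cap P'$. Boolean formulas. To each position $p$ is associated a Boolean variable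 $\hat p$; formulas $\phi$ are built from $\mathtt{True}$, $\mathtt{False}$, these variables, $\wedge$ and $\vee$; $\mathrm{Var}(\phi)$ is the set of variables of $\phi$; valuations $\nu$ and $\nu\models\phi$ are as usual. CE-strategies. With a countable set of fixed-point variables $X,Y,Z,\dots$, CE-strategies are generated by $S::=[\,]\mid X\mid (u,S)\mid S\oplus S\mid (u,\boldsymbol\tau)\mid \mu X.S\mid @p.S\mid @p.\boldsymbol\tau\mid \langle[@p_1.S_1,\dots,@p_n.S_n],\phi\rangle$, where $u\in\mathcal T$, $\boldsymbol\tau\in\mathcal T_\square^\star$, $p,p_i$ positions and $\mathrm{Var}(\phi)=\{\hat p_1,\dots,\hat p_n\}\setminus\{\hat\epsilon\}$. A strategy is closed if all its fixed-point variables are bound; $S(X)$ indicates that $X$ is free in $S$, $S(S')$ denotes substitution of $S'$ for $X$, $S^1(S')=S(S')$ and $S^{i+1}(S')=S^i(S(S'))$. Fail-as-identity: for $f:\mathcal T\cup\{\mathbb F\}\to\mathcal T\cup\{\mathbb F\}$, $\eta(f)(t)=f(t)$ if $f(t)\ne\mathbb F$ and $\eta(f)(t)=t$ otherwise. Semantics of a closed CE-strategy: $[\![\,[\,]\,]\!](t)=\mathbb F$; $[\![(u,S)]\!](t)=[\![S]\!](t)$ if $u$ matches $t$, else $\mathbb F$; $[\![(u,\boldsymbol\tau)]\!](t)=\mathrm{eval}(\boldsymbol\tau)[t]$ if $u$ matches $t$, else $\mathbb F$; $[\![@p.\boldsymbol\tau]\!](t)=t[\mathrm{eval}(\boldsymbol\tau)[t_{|p}]]_p$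 if $p\in\mathcal Pos(t)$, else $\mathbb F$; $[\![S_1\oplus S_2]\!](t)=[\![S_1]\!](t)$ if this is not $\mathbb F$, else $[\![S_2]\!](t)$; $[\![\mu X.S(X)]\!](t)=[\![\bigoplus_{i=1}^{\delta(t)}S^i([\,])]\!](t)$; $[\![@p.S]\!](t)=t[[\![S]\!](t_{|p})]_p$ if $p\in\mathcal Pos(t)$ and $[\![S]\!](t_{|p})\ne\mathbb F$, else $\mathbb F$; $[\![\langle[@p_1.S_1,\dots,@p_n.S_n],\phi\rangle]\!](t)=(\eta([\![@p_n.S_n]\!])\circ\dots\circ\eta([\![@p_1.S_1]\!]))(t)$ if $\nu_t\models\phi$, else $\mathbb F$, where $\nu_t(\hat p_i)=\mathtt{False}$ iff $[\![@p_i.S_i]\!](t)=\mathbb F$. All CE-strategies are assumed well-founded: (i) viewing $S$ as a tree in which each bound occurrence of $X$ has a back-edge to its binder $\mu X$, every cycle passes through a position constructor $@p$; (ii) in every sub-strategy $\langle[@p_1.S_1,\dots,@p_n.S_n,@q_1.\boldsymbol\tau_1,\dots,@q_m.\boldsymbol\tau_m],\phi\rangle$ one has $q_i\sqsubset q_j$ for $i<j$, $p_i\parallel p_j$ for $i\ne j$, and $q_j\sqsubset p_i$ for all $i,j$. A CE-strategy is in canonical form if every Boolean formula occurring in it is a conjunction of variables $\hat p$ with $p\in\mathbb N_\epsilon$; $\mathcal C_{can}$ is the set of these. The map $\Psi$ (closed CE-strategy, term) $\mapsto$ position-based CE-strategy: $\Psi([\,],t)=[\,]$; $\Psi(@p.\boldsymbol\tau,t)=@p.\boldsymbol\tau$;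 $\Psi((u,\boldsymbol\tau),t)=@\epsilon.\boldsymbol\tau$ if $u$ matches $t$, else $[\,]$; $\Psi((u,S),t)=\Psi(S,t)$ if $u$ matches $t$, else $[\,]$; $\Psi(\langle[@p_1.\boldsymbol\tau_1,\dots,@p_n.\boldsymbol\tau_n],\phi\rangle,t)=[@p_1.\boldsymbol\tau_1,\dots,@p_n.\boldsymbol\tau_n]$; $\Psi(@p.S,t)=p\cdot\Psi(S,t_{|p})$; $\Psi(S\oplus S',t)=\Psi(S,t)$ if this is not $[\,]$, else $\Psi(S',t)$; $\Psi(\mu X.S(X),t)=\Psi(\bigoplus_{i=1}^{\delta(t)}S^i([\,]),t)$; and for $\mathcal S=[@p_1.S_1,\dots,@p_n.S_n]$, $\Psi(\langle\mathcal S,\phi\rangle,t)=\bigsqcup_{i=1}^n p_i\cdot\eta(\Psi(S_i,t_{|p_i}))$ if $\nu_t\models\phi$ ($\nu_t$ as in the semantics), else $[\,]$, where $\eta(E)=E$ for $E\ne[\,]$ and $\eta([\,])$ contributes no insertion. Unification of canonical CE-strategies $\sqcap:\mathcal C_{can}\times\mathcal C_{can}\to\mathcal C_{can}$ (with $i,j\in\mathbb N_\epsilon$; cases symmetric to the listed ones are defined symmetrically): $[\,]\sqcap S=S\sqcap[\,]=[\,]$; $@i.\boldsymbol\tau\sqcap@i.\boldsymbol\tau'=@i.(\boldsymbol\tau\cdot\boldsymbol\tau')$; $@i.\boldsymbol\tau\sqcap@j.\boldsymbol\tau'=[@i.\boldsymbol\tau,@j.\boldsymbol\tau']$ if $j\sqsubset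 i$; $@i.\boldsymbol\tau\sqcap@i.S=@i.(@\epsilon.\boldsymbol\tau\sqcap S)$; $@i.\boldsymbol\tau\sqcap@j.S=[@i.\boldsymbol\tau,@j.S]$ if $j\sqsubset i$; $(u,\boldsymbol\tau)\sqcap@i.\boldsymbol\tau'=(u,@\epsilon.\boldsymbol\tau\sqcap@i.\boldsymbol\tau')$ if $i\in[\mathit{ar}(u)]\cup\{\epsilon\}$ and $[\,]$ otherwise; $@i.\boldsymbol\tau\sqcap(u,S)=(u,@i.\boldsymbol\tau\sqcap S)$ if $i\in[\mathit{ar}(u)]\cup\{\epsilon\}$ and $[\,]$ otherwise; $(u,\boldsymbol\tau)\sqcap(u',S')=(u\wedge u',@\epsilon.\boldsymbol\tau\sqcap S')$; $(u,S)\sqcap(u',S')=(u\wedge u',S\sqcap S')$; for $\mathcal L=\bigsqcup_{i\in I}@i.S_i$, $\mathcal L'=\bigsqcup_{j\in J}@j.S'_j$: $\langle\mathcal L,\phi\rangle\sqcap\langle\mathcal L',\phi'\rangle=\langle\mathcal L_1\sqcup\mathcal L_2\sqcup\mathcal L_3,\phi\wedge\phi'\rangle$ with $\mathcal L_1=\bigsqcup_{i\in I\cap J}@i.(S_i\sqcap S'_i)$, $\mathcal L_2=\bigsqcup_{i\in I\setminus J}@i.S_i$, $\mathcal L_3=\bigsqcup_{i\in J\setminus I}@i.S'_i$; $(u,S)\sqcap\langle\mathcal L,\phi\rangle=(u,S\sqcap\langle\mathcal L,\phi\rangle)$; $(S_1\oplus S_2)\sqcap S=(S_1\sqcap S)\oplus(S_2\sqcap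 S)$; $\mu X.S(X)\sqcap\mu X'.S'(X')=\mu Z.S''(\mu X.S(X),\mu X'.S'(X'),Z)$ where $S''(X,X',Z)$ is $S(X)\sqcap S'(X')$ (computed treating $X\sqcap X'$ as a formal symbol) with $X\sqcap X'$ replaced by a fresh fixed-point variable $Z$; and $(\mu X.S(X))\sqcap S'=S''(\mu X.S(X))$ with $S''(X)=S(X)\sqcap S'$.
   Formalization: Mended: @i.τ⊓@i.τ'=@i.(τ'·τ); Ψ(@p.τ,t)=[] if p∉Pos(t); insertion lists test φ; μ tries i=δ(t)+1 down to 1; patterns renamed apart, non-unifiable give []; variable patterns do not bound i; lists, also in Ψ, put in well-founded order; @ε is no guard; φ nonempty; unlisted ⊓ cases added. *)

theory Defs
  imports Main "HOL-Library.Sublist"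
begin

section \<open>Terms and positions\<close>

text \<open>Function symbols have type \<open>'f\<close>; a signature is an arity function \<open>ar\<close> on \<open>'f\<close>.
  The countable set of variables is \<open>nat\<close>.\<close>

datatype 'f trm = Var nat | Fun 'f "'f trm list"

fun wf_trm :: "('f \<Rightarrow> nat) \<Rightarrow> 'f trm \<Rightarrow> bool" where
  "wf_trm ar (Var x) = True"
| "wf_trm ar (Fun f ts) = (length ts = ar f \<and> (\<forall>t\<in>set ts. wf_trm ar t))"

fun vars :: "'f trm \<Rightarrow> nat set" where
  "vars (Var x) = {x}"
| "vars (Fun f ts) = (\<Union>t\<in>set ts. vars t)"

fun subst :: "(nat \<Rightarrow> 'f trm) \<Rightarrow> 'f trm \<Rightarrow> 'f trm" where
  "subst \<sigma> (Var x) = \<sigma> x"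
| "subst \<sigma> (Fun f ts) = Fun f (map (subst \<sigma>) ts)"

definition matches :: "'f trm \<Rightarrow> 'f trm \<Rightarrow> bool" where
  "matches u t \<longleftrightarrow> (\<exists>\<sigma>. subst \<sigma> u = t)"

fun depth :: "'f trm \<Rightarrow> nat" where
  "depth (Var x) = 0"
| "depth (Fun f ts) = (if ts = [] then 0 else Suc (Max (set (map depth ts))))"

type_synonym pos = "nat list"

definition is_pos :: "pos \<Rightarrow> bool" where
  "is_pos p \<longleftrightarrow> (\<forall>i\<in>set p. 0 < i)"

definition N_eps :: "pos set" where
  "N_eps = insert [] {[i] | i. 0 < i}"

lemma size_nth_less [termination_simp]: "i < length ts \<Longrightarrow> size (ts ! i) < Suc (size_list size ts)"
  by (simp add: le_imp_less_Suc size_list_estimation' [OF nth_mem])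

fun poss :: "'f trm \<Rightarrow> pos set" where
  "poss (Var x) = {[]}"
| "poss (Fun f ts) = insert [] (\<Union>i<length ts. (#) (Suc i) ` poss (ts ! i))"

text \<open>The next two functions are meaningful only at positions of the term.\<close>

fun subt_at :: "'f trm \<Rightarrow> pos \<Rightarrow> 'f trm" where
  "subt_at t [] = t"
| "subt_at (Fun f ts) (i # p) = subt_at (ts ! (i - 1)) p"
| "subt_at (Var x) (i # p) = Var x"

fun replace_at :: "'f trm \<Rightarrow> pos \<Rightarrow> 'f trm \<Rightarrow> 'f trm" where
  "replace_at t [] s = s"
| "replace_at (Fun f ts) (i # p) s = Fun f (ts[i - 1 := replace_at (ts ! (i - 1)) p s])"
| "replace_at (Var x) (i # p) s = Var x"

definition sqsub :: "pos \<Rightarrow> pos \<Rightarrow> bool"  (infix \<open>\<sqsubset>p\<close> 50) where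
  "p \<sqsubset>p q \<longleftrightarrow> strict_prefix p q \<or> parallel p q"

text \<open>\<open>arg_pos u i\<close>: \<open>i \<in> [ar(u)] \<union> {\<epsilon>}\<close>. A variable has no root symbol and imposes no bound.\<close>

fun arg_pos :: "'f trm \<Rightarrow> pos \<Rightarrow> bool" where
  "arg_pos (Var x) i \<longleftrightarrow> i \<in> N_eps"
| "arg_pos (Fun f ts) i \<longleftrightarrow> i = [] \<or> (\<exists>k. i = [k] \<and> 1 \<le> k \<and> k \<le> length ts)"


section \<open>Unification of patterns\<close>

text \<open>Patterns are only used for matching, hence their variables are local: as usual, the variables
  of one pattern are renamed apart from those of the other before unifying.\<close>

definition is_mgu :: "(nat \<Rightarrow> 'f trm) \<Rightarrow> 'f trm \<Rightarrow> 'f trm \<Rightarrow> bool" where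
  "is_mgu \<gamma> u v \<longleftrightarrow> subst \<gamma> u = subst \<gamma> v \<and>
     (\<forall>\<sigma>. subst \<sigma> u = subst \<sigma> v \<longrightarrow> (\<exists>\<theta>. \<forall>x. \<sigma> x = subst \<theta> (\<gamma> x)))"

definition renamed_apart :: "'f trm \<Rightarrow> 'f trm \<Rightarrow> 'f trm \<Rightarrow> bool" where
  "renamed_apart u u' v \<longleftrightarrow>
     (\<exists>\<pi>. inj \<pi> \<and> v = subst (\<lambda>x. Var (\<pi> x)) u' \<and> vars u \<inter> vars v = {})"

text \<open>\<open>is_meet u u' w\<close>: \<open>w\<close> is (a representative of) \<open>u \<and> u'\<close>.\<close>

definition is_meet :: "'f trm \<Rightarrow> 'f trm \<Rightarrow> 'f trm \<Rightarrow> bool" where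
  "is_meet u u' w \<longleftrightarrow> (\<exists>v \<gamma>. renamed_apart u u' v \<and> is_mgu \<gamma> u v \<and> w = subst \<gamma> u)"

definition unifiable :: "'f trm \<Rightarrow> 'f trm \<Rightarrow> bool" where
  "unifiable u u' \<longleftrightarrow> (\<exists>v \<sigma>. renamed_apart u u' v \<and> subst \<sigma> u = subst \<sigma> v)"


section \<open>Contexts and tuples of contexts\<close>

datatype 'f ctxt = Hole | More 'f "'f trm list" "'f ctxt" "'f trm list"

fun wf_ctxt :: "('f \<Rightarrow> nat) \<Rightarrow> 'f ctxt \<Rightarrow> bool" where
  "wf_ctxt ar Hole = True"
| "wf_ctxt ar (More f ss C ts) =
     (Suc (length ss + length ts) = ar f \<and> (\<forall>t\<in>set ss \<union> set ts. wf_trm ar t) \<and> wf_ctxt ar C)"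

fun ctxt_trm :: "'f ctxt \<Rightarrow> 'f trm \<Rightarrow> 'f trm" where
  "ctxt_trm Hole s = s"
| "ctxt_trm (More f ss C ts) s = Fun f (ss @ ctxt_trm C s # ts)"

fun ctxt_ctxt :: "'f ctxt \<Rightarrow> 'f ctxt \<Rightarrow> 'f ctxt" where
  "ctxt_ctxt Hole D = D"
| "ctxt_ctxt (More f ss C ts) D = More f ss (ctxt_ctxt C D) ts"

text \<open>The evaluation of a tuple depends on how the tuple is written as a concatenation
  \<open>\<tau>\<^sub>1 \<cdot> \<dots> \<cdot> \<tau>\<^sub>n\<close> of tuples. A tuple is therefore represented by the list \<open>[\<tau>\<^sub>1, \<dots>, \<tau>\<^sub>n]\<close> of its
  factors; concatenation of tuples is \<open>@\<close>.\<close>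

type_synonym 'f tuple = "'f ctxt list list"

definition wf_tuple :: "('f \<Rightarrow> nat) \<Rightarrow> 'f tuple \<Rightarrow> bool" where
  "wf_tuple ar \<tau> \<longleftrightarrow> \<tau> \<noteq> [] \<and> (\<forall>b\<in>set \<tau>. b \<noteq> [] \<and> (\<forall>C\<in>set b. wf_ctxt ar C))"

definition eval_tuple :: "'f tuple \<Rightarrow> 'f ctxt" where
  "eval_tuple \<tau> = foldr ctxt_ctxt (concat (remdups_adj \<tau>)) Hole"


section \<open>Position-based CE-strategies\<close>

text \<open>The empty list is the failing strategy.\<close>

type_synonym 'f pstrat = "(pos \<times> 'f tuple) list"

definition wf_pstrat :: "'f pstrat \<Rightarrow> bool" where
  "wf_pstrat E \<longleftrightarrow> distinct (map fst E) \<and> sorted_wrt (\<sqsubset>p) (map fst E)"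

text \<open>Equality up to permutation of entries at parallel positions.\<close>

inductive peq :: "'f pstrat \<Rightarrow> 'f pstrat \<Rightarrow> bool"  (infix \<open>\<simeq>\<close> 50) where
  peq_refl: "E \<simeq> E"
| peq_swap: "E \<simeq> A @ e # f # B \<Longrightarrow> parallel (fst e) (fst f) \<Longrightarrow> E \<simeq> A @ f # e # B"

definition prefix_pos :: "pos \<Rightarrow> 'f pstrat \<Rightarrow> 'f pstrat" where
  "prefix_pos p E = map (\<lambda>(q, \<tau>). (p @ q, \<tau>)) E"

text \<open>The order of a well-founded list is determined by its entries up to permutations at parallel
  positions; \<open>arrange\<close> picks one such order.\<close>

definition arrange :: "'f pstrat \<Rightarrow> 'f pstrat" where
  "arrange E = sort_key (\<lambda>e. length (fst e)) E"

lemma wf_pstrat_arrange: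
  assumes "distinct (map fst E)"
  shows "wf_pstrat (arrange E)"
proof -
  let ?E = "arrange E"
  have d: "distinct (map fst ?E)"
    using assms unfolding arrange_def by (simp add: distinct_map)
  have s: "sorted (map length (map fst ?E))"
    using sorted_sort_key[of "\<lambda>e. length (fst e)" E] unfolding arrange_def by (simp add: comp_def)
  have "i < j \<Longrightarrow> j < length (map fst ?E) \<Longrightarrow> map fst ?E ! i \<sqsubset>p map fst ?E ! j" for i j
  proof -
    assume ij: "i < j" "j < length (map fst ?E)"
    have "map fst ?E ! i \<noteq> map fst ?E ! j"
      using d ij nth_eq_iff_index_eq[of "map fst ?E" i j] by simp
    moreover have "length (map fst ?E ! i) \<le> length (map fst ?E ! j)"
      using sorted_nth_mono[OF s, of i j] ij by simp
    ultimately show "map fst ?E ! i \<sqsubset>p map fst ?E ! j"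
      unfolding sqsub_def strict_prefix_def parallel_def prefix_def by auto
  qed
  then show ?thesis using d unfolding wf_pstrat_def by (simp add: sorted_wrt_iff_nth_less)
qed

definition punify :: "'f pstrat \<Rightarrow> 'f pstrat \<Rightarrow> 'f pstrat"  (infixl \<open>\<sqinter>p\<close> 70) where
  "E \<sqinter>p E' = (if E = [] \<or> E' = [] then [] else arrange
     (map (\<lambda>(p, \<tau>). (p, case map_of E' p of None \<Rightarrow> \<tau> | Some \<tau>' \<Rightarrow> \<tau>' @ \<tau>)) E
      @ filter (\<lambda>(p, \<tau>'). p \<notin> fst ` set E) E'))"


section \<open>CE-strategies\<close>

datatype form = FTrue | FFalse | FPos pos | FAnd form form | FOr form form

fun fvars :: "form \<Rightarrow> pos set" where
  "fvars FTrue = {}"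
| "fvars FFalse = {}"
| "fvars (FPos p) = {p}"
| "fvars (FAnd \<phi> \<psi>) = fvars \<phi> \<union> fvars \<psi>"
| "fvars (FOr \<phi> \<psi>) = fvars \<phi> \<union> fvars \<psi>"

fun models :: "(pos \<Rightarrow> bool) \<Rightarrow> form \<Rightarrow> bool" where
  "models \<nu> FTrue = True"
| "models \<nu> FFalse = False"
| "models \<nu> (FPos p) = \<nu> p"
| "models \<nu> (FAnd \<phi> \<psi>) = (models \<nu> \<phi> \<and> models \<nu> \<psi>)"
| "models \<nu> (FOr \<phi> \<psi>) = (models \<nu> \<phi> \<or> models \<nu> \<psi>)"

text \<open>\<open>FVar\<close> are the fixed-point variables, \<open>CondI u \<tau>\<close> is \<open>(u,\<tau>)\<close>, \<open>AtI p \<tau>\<close> is \<open>@p.\<tau>\<close>, and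
  \<open>Br [(p\<^sub>1,S\<^sub>1),\<dots>] \<phi>\<close> is \<open>\<langle>[@p\<^sub>1.S\<^sub>1,\<dots>],\<phi>\<rangle>\<close>. An entry \<open>@q.\<tau>\<close> of such a list is the pair
  \<open>(q, AtI [] \<tau>)\<close>, i.e. \<open>@q.(@\<epsilon>.\<tau>)\<close>.\<close>

datatype 'f strat =
    Fail
  | FVar nat
  | Cond "'f trm" "'f strat"
  | Choice "'f strat" "'f strat"
  | CondI "'f trm" "'f tuple"
  | Mu nat "'f strat"
  | At pos "'f strat"
  | AtI pos "'f tuple"
  | Br "(pos \<times> 'f strat) list" form

fun fv :: "'f strat \<Rightarrow> nat set" where
  "fv Fail = {}"
| "fv (FVar X) = {X}"
| "fv (Cond u S) = fv S"
| "fv (Choice S T) = fv S \<union> fv T"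
| "fv (CondI u \<tau>) = {}"
| "fv (Mu X S) = fv S - {X}"
| "fv (At p S) = fv S"
| "fv (AtI p \<tau>) = {}"
| "fv (Br L \<phi>) = \<Union> (set (map (\<lambda>(p, S). fv S) L))"

text \<open>\<open>fsubst X T S\<close> is \<open>S(T)\<close>. It is only used for closed \<open>T\<close>, so that no capture can occur.\<close>

fun fsubst :: "nat \<Rightarrow> 'f strat \<Rightarrow> 'f strat \<Rightarrow> 'f strat" where
  "fsubst X T Fail = Fail"
| "fsubst X T (FVar Y) = (if Y = X then T else FVar Y)"
| "fsubst X T (Cond u S) = Cond u (fsubst X T S)"
| "fsubst X T (Choice S S') = Choice (fsubst X T S) (fsubst X T S')"
| "fsubst X T (CondI u \<tau>) = CondI u \<tau>"
| "fsubst X T (Mu Y S) = (if Y = X then Mu Y S else Mu Y (fsubst X T S))"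
| "fsubst X T (At p S) = At p (fsubst X T S)"
| "fsubst X T (AtI p \<tau>) = AtI p \<tau>"
| "fsubst X T (Br L \<phi>) = Br (map (\<lambda>(p, S). (p, fsubst X T S)) L) \<phi>"

fun subs :: "'f strat \<Rightarrow> 'f strat set" where
  "subs Fail = {Fail}"
| "subs (FVar X) = {FVar X}"
| "subs (Cond u S) = insert (Cond u S) (subs S)"
| "subs (Choice S T) = insert (Choice S T) (subs S \<union> subs T)"
| "subs (CondI u \<tau>) = {CondI u \<tau>}"
| "subs (Mu X S) = insert (Mu X S) (subs S)"
| "subs (At p S) = insert (At p S) (subs S)"
| "subs (AtI p \<tau>) = {AtI p \<tau>}"
| "subs (Br L \<phi>) = insert (Br L \<phi>) (\<Union> (set (map (\<lambda>(p, S). subs S) L)))"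

text \<open>\<open>X \<in> unguarded S\<close>: some free occurrence of \<open>X\<close> is reached without passing through a position
  constructor \<open>@p\<close> with \<open>p \<noteq> \<epsilon>\<close> (a constructor \<open>@\<epsilon>\<close> does not descend in the term). The condition
  \<open>X \<notin> unguarded T\<close> for all sub-strategies \<open>\<mu>X.T\<close> says that every cycle passes through such a
  constructor: each cycle runs from some binder to one of the occurrences that it binds.\<close>

fun unguarded :: "'f strat \<Rightarrow> nat set" where
  "unguarded Fail = {}"
| "unguarded (FVar X) = {X}"
| "unguarded (Cond u S) = unguarded S"
| "unguarded (Choice S T) = unguarded S \<union> unguarded T"
| "unguarded (CondI u \<tau>) = {}"
| "unguarded (Mu X S) = unguarded S - {X}"
| "unguarded (At p S) = (if p = [] then unguarded S else {})"
| "unguarded (AtI p \<tau>) = {}"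
| "unguarded (Br L \<phi>) = \<Union> (set (map (\<lambda>(p, S). if p = [] then unguarded S else {}) L))"

fun is_ins :: "'f strat \<Rightarrow> bool" where
  "is_ins (AtI p \<tau>) = (p = [])"
| "is_ins _ = False"

definition wf_entries :: "(pos \<times> 'f strat) list \<Rightarrow> bool" where
  "wf_entries L \<longleftrightarrow> (\<exists>A B. L = A @ B \<and>
     (\<forall>(p, S)\<in>set A. \<not> is_ins S) \<and> (\<forall>(q, S)\<in>set B. is_ins S) \<and>
     distinct (map fst B) \<and> sorted_wrt (\<sqsubset>p) (map fst B) \<and>
     sorted_wrt parallel (map fst A) \<and>
     (\<forall>q\<in>fst ` set B. \<forall>p\<in>fst ` set A. q \<sqsubset>p p))"

definition ce_strategy :: "('f \<Rightarrow> nat) \<Rightarrow> 'f strat \<Rightarrow> bool" where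
  "ce_strategy ar S \<longleftrightarrow>
     (\<forall>u T. Cond u T \<in> subs S \<longrightarrow> wf_trm ar u) \<and>
     (\<forall>u \<tau>. CondI u \<tau> \<in> subs S \<longrightarrow> wf_trm ar u \<and> wf_tuple ar \<tau>) \<and>
     (\<forall>p T. At p T \<in> subs S \<longrightarrow> is_pos p) \<and>
     (\<forall>p \<tau>. AtI p \<tau> \<in> subs S \<longrightarrow> is_pos p \<and> wf_tuple ar \<tau>) \<and>
     (\<forall>X T. Mu X T \<in> subs S \<longrightarrow> X \<notin> unguarded T) \<and>
     (\<forall>L \<phi>. Br L \<phi> \<in> subs S \<longrightarrow>
        L \<noteq> [] \<and> (\<forall>p\<in>fst ` set L. is_pos p) \<and> fvars \<phi> = fst ` set L - {[]} \<and> wf_entries L)"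

text \<open>The empty conjunction \<open>True\<close> is excluded.\<close>

fun conj_vars :: "form \<Rightarrow> bool" where
  "conj_vars (FPos p) = (p \<in> N_eps)"
| "conj_vars (FAnd \<phi> \<psi>) = (conj_vars \<phi> \<and> conj_vars \<psi>)"
| "conj_vars _ = False"

definition canonical :: "'f strat \<Rightarrow> bool" where
  "canonical S \<longleftrightarrow> (\<forall>L \<phi>. Br L \<phi> \<in> subs S \<longrightarrow> conj_vars \<phi>)"

definition C_can :: "('f \<Rightarrow> nat) \<Rightarrow> 'f strat set" where
  "C_can ar = {S. ce_strategy ar S \<and> fv S = {} \<and> canonical S}"


section \<open>Semantics and the map \<open>\<Psi>\<close>\<close>

type_synonym 'f den = "'f trm \<Rightarrow> 'f trm option"
type_synonym 'f pden = "'f trm \<Rightarrow> 'f pstrat"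

fun orelse :: "'a option \<Rightarrow> 'a option \<Rightarrow> 'a option" where
  "orelse None y = y"
| "orelse (Some x) y = Some x"

fun porelse :: "'f pstrat \<Rightarrow> 'f pstrat \<Rightarrow> 'f pstrat" where
  "porelse [] F = F"
| "porelse (e # E) F = e # E"

definition at_den :: "pos \<Rightarrow> 'f den \<Rightarrow> 'f den" where
  "at_den p d t = (if p \<in> poss t then map_option (replace_at t p) (d (subt_at t p)) else None)"

definition at_pden :: "pos \<Rightarrow> 'f pden \<Rightarrow> 'f pden" where
  "at_pden p d t = (if p \<in> poss t then prefix_pos p (d (subt_at t p)) else [])"

definition fail_as_id :: "'f den \<Rightarrow> 'f trm \<Rightarrow> 'f trm" where
  "fail_as_id d t = (case d t of None \<Rightarrow> t | Some s \<Rightarrow> s)"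

definition val_of :: "(pos \<times> 'f den) list \<Rightarrow> 'f trm \<Rightarrow> pos \<Rightarrow> bool" where
  "val_of D t p \<longleftrightarrow> (\<forall>d. (p, d) \<in> set D \<longrightarrow> at_den p d t \<noteq> None)"

text \<open>The exponents of the iterates \<open>S\<^sup>i([])\<close> used for \<open>\<mu>X.S(X)\<close> on a term \<open>t\<close>, in the order in
  which they are tried: the deepest unfolding comes first, and a term of depth \<open>d\<close> needs up to
  \<open>d + 1\<close> unfoldings. The equations \<open>sem_Mu\<close> and \<open>Psi_Mu\<close> below show the syntactic form.\<close>

definition exponents :: "'f trm \<Rightarrow> nat list" where
  "exponents t = rev [1..<depth t + 2]"

text \<open>The syntactic equations for \<open>\<mu>\<close> are not structurally recursive. Free fixed-point variables
  are therefore interpreted in an environment.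

  Strategies \<open>@p.S\<close> and \<open>@p.\<tau>\<close> fail on a term without position \<open>p\<close>, both in the semantics and under
  \<open>\<Psi>\<close>; hence \<open>\<Psi>(S, t) = []\<close> iff \<open>S\<close> fails on \<open>t\<close>, for canonical \<open>S\<close>.\<close>

fun sem_env :: "(nat \<Rightarrow> 'f den) \<Rightarrow> 'f strat \<Rightarrow> 'f den" where
  "sem_env \<rho> Fail t = None"
| "sem_env \<rho> (FVar X) t = \<rho> X t"
| "sem_env \<rho> (Cond u S) t = (if matches u t then sem_env \<rho> S t else None)"
| "sem_env \<rho> (Choice S T) t = orelse (sem_env \<rho> S t) (sem_env \<rho> T t)"
| "sem_env \<rho> (CondI u \<tau>) t = (if matches u t then Some (ctxt_trm (eval_tuple \<tau>) t) else None)"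
| "sem_env \<rho> (Mu X S) t =
     foldr (\<lambda>i. orelse (((\<lambda>d. sem_env (\<rho>(X := d)) S) ^^ i) (\<lambda>_. None) t)) (exponents t) None"
| "sem_env \<rho> (At p S) t = at_den p (sem_env \<rho> S) t"
| "sem_env \<rho> (AtI p \<tau>) t = at_den p (\<lambda>s. Some (ctxt_trm (eval_tuple \<tau>) s)) t"
| "sem_env \<rho> (Br L \<phi>) t =
     (let D = map (\<lambda>(p, S). (p, sem_env \<rho> S)) L in
      if models (val_of D t) \<phi>
      then Some (fold (\<lambda>(p, d). fail_as_id (at_den p d)) D t) else None)"

fun Psi_env :: "(nat \<Rightarrow> 'f den \<times> 'f pden) \<Rightarrow> 'f strat \<Rightarrow> 'f pden" where
  "Psi_env \<rho> Fail t = []"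
| "Psi_env \<rho> (FVar X) t = snd (\<rho> X) t"
| "Psi_env \<rho> (Cond u S) t = (if matches u t then Psi_env \<rho> S t else [])"
| "Psi_env \<rho> (Choice S T) t = porelse (Psi_env \<rho> S t) (Psi_env \<rho> T t)"
| "Psi_env \<rho> (CondI u \<tau>) t = (if matches u t then [([], \<tau>)] else [])"
| "Psi_env \<rho> (Mu X S) t =
     foldr (\<lambda>i. porelse (snd (((\<lambda>(d, e). (sem_env ((fst \<circ> \<rho>)(X := d)) S,
                                          Psi_env (\<rho>(X := (d, e))) S)) ^^ i)
                              (\<lambda>_. None, \<lambda>_. [])) t))
       (exponents t) []"
| "Psi_env \<rho> (At p S) t = at_pden p (Psi_env \<rho> S) t"
| "Psi_env \<rho> (AtI p \<tau>) t = at_pden p (\<lambda>_. [([], \<tau>)]) t"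
| "Psi_env \<rho> (Br L \<phi>) t =
     (if models (val_of (map (\<lambda>(p, S). (p, sem_env (fst \<circ> \<rho>) S)) L) t) \<phi>
      then arrange (concat (map (\<lambda>(p, S). at_pden p (Psi_env \<rho> S) t) L)) else [])"

definition sem :: "'f strat \<Rightarrow> 'f den" where
  "sem = sem_env (\<lambda>_ _. None)"

definition Psi :: "'f strat \<Rightarrow> 'f pden" where
  "Psi = Psi_env (\<lambda>_. (\<lambda>_. None, \<lambda>_. []))"

text \<open>The defining equations of both maps at \<open>\<mu>X.S(X)\<close> in terms of \<open>S\<^sup>i([])\<close>.\<close>

fun iter :: "nat \<Rightarrow> 'f strat \<Rightarrow> nat \<Rightarrow> 'f strat" where
  "iter X S 0 = Fail"
| "iter X S (Suc i) = fsubst X (iter X S i) S"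

definition big_choice :: "'f strat list \<Rightarrow> 'f strat" where
  "big_choice Ss = foldr Choice Ss Fail"

lemma sem_env_cong: "(\<And>X. X \<in> fv S \<Longrightarrow> \<rho> X = \<rho>' X) \<Longrightarrow> sem_env \<rho> S = sem_env \<rho>' S"
proof (induction S arbitrary: \<rho> \<rho>')
  case (Mu X S)
  have "sem_env (\<rho>(X := d)) S = sem_env (\<rho>'(X := d)) S" for d
    using Mu.prems by (intro Mu.IH) auto
  then show ?case by (intro ext) simp
next
  case (Br L \<phi>)
  have "map (\<lambda>(p, S). (p, sem_env \<rho> S)) L = map (\<lambda>(p, S). (p, sem_env \<rho>' S)) L"
  proof (rule map_cong[OF refl], clarsimp)
    fix p S assume "(p, S) \<in> set L"
    then show "sem_env \<rho> S = sem_env \<rho>' S"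
      using Br.prems by (intro Br.IH[of "(p, S)" S]) fastforce+
  qed
  then show ?case by (intro ext) (simp only: sem_env.simps)
next
  case (Cond u S)
  have "sem_env \<rho> S = sem_env \<rho>' S" using Cond.prems by (intro Cond.IH) simp
  then show ?case by (intro ext) simp
next
  case (Choice S T)
  have "sem_env \<rho> S = sem_env \<rho>' S" "sem_env \<rho> T = sem_env \<rho>' T"
    using Choice.prems by (intro Choice.IH, simp)+
  then show ?case by (intro ext) simp
next
  case (At p S)
  have "sem_env \<rho> S = sem_env \<rho>' S" using At.prems by (intro At.IH) simp
  then show ?case by (intro ext) simp
qed (auto intro!: ext)

lemma Psi_env_cong: "(\<And>X. X \<in> fv S \<Longrightarrow> \<rho> X = \<rho>' X) \<Longrightarrow> Psi_env \<rho> S = Psi_env \<rho>' S"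
proof (induction S arbitrary: \<rho> \<rho>')
  case (Mu X S)
  have "Psi_env (\<rho>(X := d)) S = Psi_env (\<rho>'(X := d)) S" for d
    using Mu.prems by (intro Mu.IH) auto
  moreover have "sem_env ((fst \<circ> \<rho>)(X := d)) S = sem_env ((fst \<circ> \<rho>')(X := d)) S" for d
    using Mu.prems by (intro sem_env_cong) auto
  ultimately show ?case by (intro ext) simp
next
  case (Br L \<phi>)
  have "map (\<lambda>(p, S). (p, sem_env (fst \<circ> \<rho>) S)) L = map (\<lambda>(p, S). (p, sem_env (fst \<circ> \<rho>') S)) L"
  proof (rule map_cong[OF refl], clarsimp)
    fix p S assume "(p, S) \<in> set L"
    then show "sem_env (fst \<circ> \<rho>) S = sem_env (fst \<circ> \<rho>') S"
      using Br.prems by (intro sem_env_cong) fastforce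
  qed
  moreover have "map (\<lambda>(p, S). at_pden p (Psi_env \<rho> S) t) L = map (\<lambda>(p, S). at_pden p (Psi_env \<rho>' S) t) L" for t
  proof (rule map_cong[OF refl], clarsimp)
    fix p S assume "(p, S) \<in> set L"
    then have "Psi_env \<rho> S = Psi_env \<rho>' S"
      using Br.prems by (intro Br.IH[of "(p, S)" S]) fastforce+
    then show "at_pden p (Psi_env \<rho> S) t = at_pden p (Psi_env \<rho>' S) t" by simp
  qed
  ultimately show ?case by (intro ext) (simp only: Psi_env.simps)
next
  case (Cond u S)
  have "Psi_env \<rho> S = Psi_env \<rho>' S" using Cond.prems by (intro Cond.IH) simp
  then show ?case by (intro ext) simp
next
  case (Choice S T)
  have "Psi_env \<rho> S = Psi_env \<rho>' S" "Psi_env \<rho> T = Psi_env \<rho>' T"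
    using Choice.prems by (intro Choice.IH, simp)+
  then show ?case by (intro ext) simp
next
  case (At p S)
  have "Psi_env \<rho> S = Psi_env \<rho>' S" using At.prems by (intro At.IH) simp
  then show ?case by (intro ext) simp
qed (auto intro!: ext)

lemma map_map_entries:
  "map (\<lambda>(p, S). g p S) (map (\<lambda>(p, S). (p, h S)) L) = map (\<lambda>(p, S). g p (h S)) L"
  by (induction L) auto

lemma sem_env_fsubst:
  assumes "fv T = {}"
  shows "sem_env \<rho> (fsubst X T S) = sem_env (\<rho>(X := sem_env \<rho> T)) S"
proof -
  have T: "sem_env \<rho> T = sem_env \<rho>' T" for \<rho> \<rho>' using assms by (intro sem_env_cong) simp
  show ?thesis
  proof (induction S arbitrary: \<rho>)
    case (Mu Y S)
    show ?case
    proof (cases "Y = X")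
      case False
      then have "sem_env (\<rho>(Y := d)) (fsubst X T S) = sem_env (\<rho>(X := sem_env \<rho> T, Y := d)) S" for d
        unfolding Mu.IH T[of "\<rho>(Y := d)" \<rho>] by (simp only: fun_upd_twist)
      moreover define \<rho>' where "\<rho>' = \<rho>(X := sem_env \<rho> T)"
      ultimately have "sem_env \<rho> (fsubst X T (Mu Y S)) = sem_env \<rho>' (Mu Y S)"
        using False by (intro ext) simp
      then show ?thesis unfolding \<rho>'_def .
    next
      case True
      then have "sem_env \<rho> (Mu Y S) = sem_env (\<rho>(X := sem_env \<rho> T)) (Mu Y S)"
        by (intro sem_env_cong) auto
      with True show ?thesis by (simp only: fsubst.simps if_True simp_thms)
    qed
  next
    case (Br L \<phi>)
    have "map (\<lambda>(p, S). (p, sem_env \<rho> (fsubst X T S))) L = map (\<lambda>(p, S). (p, sem_env (\<rho>(X := sem_env \<rho> T)) S)) L"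
      using Br.IH by (intro map_cong[OF refl]) force
    then show ?case by (intro ext) (simp only: fsubst.simps sem_env.simps map_map_entries)
  qed (auto intro!: ext simp: at_den_def)
qed

lemma Psi_env_fsubst:
  assumes "fv T = {}"
  shows "Psi_env \<rho> (fsubst X T S) = Psi_env (\<rho>(X := (sem_env (fst \<circ> \<rho>) T, Psi_env \<rho> T))) S"
proof -
  have T: "Psi_env \<rho> T = Psi_env \<rho>' T" for \<rho> \<rho>' using assms by (intro Psi_env_cong) simp
  have T': "sem_env \<rho> T = sem_env \<rho>' T" for \<rho> \<rho>' using assms by (intro sem_env_cong) simp
  have upd: "fst \<circ> (\<rho>(X := (d, e))) = (fst \<circ> \<rho>)(X := d)" for \<rho> :: "nat \<Rightarrow> 'a den \<times> 'a pden" and X d e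
    by auto
  show ?thesis
  proof (induction S arbitrary: \<rho>)
    case (Mu Y S)
    show ?case
    proof (cases "Y = X")
      case False
      then have "Psi_env (\<rho>(Y := d)) (fsubst X T S)
          = Psi_env (\<rho>(X := (sem_env (fst \<circ> \<rho>) T, Psi_env \<rho> T), Y := d)) S" for d
        unfolding Mu.IH T[of "\<rho>(Y := d)" \<rho>] T'[of "fst \<circ> (\<rho>(Y := d))" "fst \<circ> \<rho>"]
        by (simp only: fun_upd_twist)
      moreover have "sem_env ((fst \<circ> \<rho>)(Y := d)) (fsubst X T S)
          = sem_env ((fst \<circ> \<rho>)(X := sem_env (fst \<circ> \<rho>) T, Y := d)) S" for d
        using False unfolding sem_env_fsubst[OF assms] T'[of "(fst \<circ> \<rho>)(Y := d)" "fst \<circ> \<rho>"]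
        by (simp only: fun_upd_twist)
      moreover define \<rho>' where "\<rho>' = \<rho>(X := (sem_env (fst \<circ> \<rho>) T, Psi_env \<rho> T))"
      moreover have "fst \<circ> \<rho>' = (fst \<circ> \<rho>)(X := sem_env (fst \<circ> \<rho>) T)"
        unfolding \<rho>'_def upd ..
      ultimately have "Psi_env \<rho> (fsubst X T (Mu Y S)) = Psi_env \<rho>' (Mu Y S)"
        using False by (intro ext) simp
      then show ?thesis unfolding \<rho>'_def .
    next
      case True
      then have "Psi_env \<rho> (Mu Y S) = Psi_env (\<rho>(X := (sem_env (fst \<circ> \<rho>) T, Psi_env \<rho> T))) (Mu Y S)"
        by (intro Psi_env_cong) auto
      with True show ?thesis by (simp only: fsubst.simps if_True simp_thms)
    qed
  next
    case (Br L \<phi>)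
    have "map (\<lambda>(p, S). at_pden p (Psi_env \<rho> (fsubst X T S)) t) L
        = map (\<lambda>(p, S). at_pden p (Psi_env (\<rho>(X := (sem_env (fst \<circ> \<rho>) T, Psi_env \<rho> T))) S) t) L" for t
      using Br.IH by (intro map_cong[OF refl]) force
    then show ?case
      by (intro ext) (simp only: fsubst.simps Psi_env.simps map_map_entries upd sem_env_fsubst[OF assms])
  qed (auto intro!: ext simp: at_pden_def)
qed

lemma fv_fsubst: "fv T = {} \<Longrightarrow> fv (fsubst X T S) = fv S - {X}"
proof (induction S)
  case (Br L \<phi>)
  then show ?case by fastforce
qed auto

lemma fv_iter: "fv S \<subseteq> {X} \<Longrightarrow> fv (iter X S i) = {}"
  by (induction i) (auto simp: fv_fsubst)

theorem sem_Mu: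
  assumes "fv (Mu X S) = {}"
  shows "sem (Mu X S) t = sem (big_choice (map (iter X S) (exponents t))) t"
proof -
  have *: "fv (iter X S i) = {}" for i using assms by (intro fv_iter) auto
  have i: "((\<lambda>d. sem_env ((\<lambda>_ _. None)(X := d)) S) ^^ i) (\<lambda>_. None) = sem (iter X S i)" for i
  proof (induction i)
    case (Suc i)
    then show ?case by (simp only: iter.simps sem_def sem_env_fsubst[OF *] funpow.simps comp_def)
  qed (simp add: sem_def fun_eq_iff)
  have "foldr (\<lambda>i. orelse (sem (iter X S i) t)) is None = sem (big_choice (map (iter X S) is)) t" for "is"
    by (induction "is") (auto simp: big_choice_def sem_def)
  then show ?thesis by (simp add: sem_def i[unfolded sem_def])
qed

theorem Psi_Mu:
  assumes "fv (Mu X S) = {}"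
  shows "Psi (Mu X S) t = Psi (big_choice (map (iter X S) (exponents t))) t"
proof -
  let ?\<rho> = "\<lambda>_. (\<lambda>_. None, \<lambda>_. [])"
  have *: "fv (iter X S i) = {}" for i using assms by (intro fv_iter) auto
  have i: "((\<lambda>(d, e). (sem_env ((fst \<circ> ?\<rho>)(X := d)) S, Psi_env (?\<rho>(X := (d, e))) S)) ^^ i)
      (\<lambda>_. None, \<lambda>_. []) = (sem (iter X S i), Psi (iter X S i))" for i
    by (induction i)
      (simp_all add: fun_upd_def sem_def Psi_def sem_env_fsubst[OF *] Psi_env_fsubst[OF *] comp_def
        fun_eq_iff[of _ "sem_env _ Fail"] fun_eq_iff[of _ "Psi_env _ Fail"])
  have "foldr (\<lambda>i. porelse (Psi (iter X S i) t)) is [] = Psi (big_choice (map (iter X S) is)) t" for "is"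
    by (induction "is") (auto simp: big_choice_def Psi_def)
  then show ?thesis by (simp add: Psi_def i[unfolded Psi_def sem_def])
qed


section \<open>Unification of canonical CE-strategies\<close>

definition order_entries :: "(pos \<times> 'f strat) list \<Rightarrow> (pos \<times> 'f strat) list" where
  "order_entries L = filter (\<lambda>(p, S). \<not> is_ins S) L
     @ sort_key (\<lambda>e. length (fst e)) (filter (\<lambda>(p, S). is_ins S) L)"

text \<open>\<open>[@i.S, @j.T]\<close> for \<open>i \<noteq> j\<close>, as a list with the conjunction of the variables of its
  positions other than \<open>\<epsilon>\<close>.\<close>

definition two_entries :: "pos \<times> 'f strat \<Rightarrow> pos \<times> 'f strat \<Rightarrow> 'f strat" where
  "two_entries e f = Br (order_entries [e, f])
     (if fst e = [] then FPos (fst f) else if fst f = [] then FPos (fst e)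
      else FAnd (FPos (fst e)) (FPos (fst f)))"

fun is_Mu :: "'f strat \<Rightarrow> bool" where
  "is_Mu (Mu X S) = True"
| "is_Mu _ = False"

text \<open>\<open>unif \<Gamma> S S' R\<close>: \<open>R\<close> is a result of unifying \<open>S\<close> and \<open>S'\<close>. The relation leaves open the choice
  of most general unifiers, of fresh fixed-point variables and of the clause to be used if several
  apply; \<open>unif_total\<close> below shows that a result always exists.

  The strategies \<open>S\<close> and \<open>S'\<close> are closed. In place of computing \<open>S(X) \<sqinter> S'(X')\<close> with \<open>X \<sqinter> X'\<close> as a
  formal symbol and substituting \<open>M = \<mu>X.S(X)\<close> and \<open>M' = \<mu>X'.S'(X')\<close> afterwards, one computes
  \<open>S(M) \<sqinter> S'(M')\<close> with \<open>M \<sqinter> M'\<close> as a formal symbol. The formal symbols, together with the variables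
  \<open>Z\<close> that replace them, are recorded in \<open>\<Gamma>\<close>. The rules \<open>mu_rec_l\<close> and \<open>mu_rec_r\<close> treat \<open>M \<sqinter> S'\<close> as
  such a symbol, too; without them the unfolding may go on forever, e.g. for
  \<open>M = \<mu>X.@1.@1.X\<close> and \<open>@1.M\<close>.

  Tuples at a common position are combined in the order used by \<open>\<sqinter>p\<close>, and a list of entries is
  formed in the order that well-foundedness prescribes.

  The clauses for \<open>(u, \<tau>)\<close> are those for \<open>(u, @\<epsilon>.\<tau>)\<close>, and the clauses for \<open>@i.S\<close> and \<open>@i.\<tau>\<close> with \<open>i \<noteq> \<epsilon>\<close>
  against a list are those for the list with this single entry. Longer positions are split:
  \<open>@ip.S = @i.(@p.S)\<close>.\<close>

inductive unif :: "(('f strat \<times> 'f strat) \<times> nat) set \<Rightarrow> 'f strat \<Rightarrow> 'f strat \<Rightarrow> 'f strat \<Rightarrow> bool"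
  and unif_entries :: "(('f strat \<times> 'f strat) \<times> nat) set \<Rightarrow>
    (pos \<times> 'f strat) list \<Rightarrow> (pos \<times> 'f strat) list \<Rightarrow> (pos \<times> 'f strat) list \<Rightarrow> bool"
where
  fail_l: "unif \<Gamma> Fail S Fail"
| fail_r: "unif \<Gamma> S Fail Fail"

| ins_ins_same: "i \<in> N_eps \<Longrightarrow> unif \<Gamma> (AtI i \<tau>) (AtI i \<tau>') (AtI i (\<tau>' @ \<tau>))"
| ins_ins: "i \<in> N_eps \<Longrightarrow> j \<in> N_eps \<Longrightarrow> i \<noteq> j \<Longrightarrow>
    unif \<Gamma> (AtI i \<tau>) (AtI j \<tau>') (two_entries (i, AtI [] \<tau>) (j, AtI [] \<tau>'))"

| ins_at_same: "i \<in> N_eps \<Longrightarrow> unif \<Gamma> (AtI [] \<tau>) S R \<Longrightarrow> unif \<Gamma> (AtI i \<tau>) (At i S) (At i R)"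
| at_ins_same: "i \<in> N_eps \<Longrightarrow> unif \<Gamma> S (AtI [] \<tau>) R \<Longrightarrow> unif \<Gamma> (At i S) (AtI i \<tau>) (At i R)"
| ins_at: "i \<in> N_eps \<Longrightarrow> j \<in> N_eps \<Longrightarrow> i \<noteq> j \<Longrightarrow> j \<noteq> [] \<Longrightarrow>
    unif \<Gamma> (AtI i \<tau>) (At j S) (two_entries (i, AtI [] \<tau>) (j, S))"
| at_ins: "i \<in> N_eps \<Longrightarrow> j \<in> N_eps \<Longrightarrow> i \<noteq> j \<Longrightarrow> j \<noteq> [] \<Longrightarrow>
    unif \<Gamma> (At j S) (AtI i \<tau>) (two_entries (j, S) (i, AtI [] \<tau>))"
| at_at_same: "i \<in> N_eps \<Longrightarrow> unif \<Gamma> S S' R \<Longrightarrow> unif \<Gamma> (At i S) (At i S') (At i R)"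
| at_at: "i \<in> N_eps \<Longrightarrow> j \<in> N_eps \<Longrightarrow> i \<noteq> j \<Longrightarrow> i \<noteq> [] \<Longrightarrow> j \<noteq> [] \<Longrightarrow>
    unif \<Gamma> (At i S) (At j S') (two_entries (i, S) (j, S'))"
| eps_l: "unif \<Gamma> S T R \<Longrightarrow> unif \<Gamma> (At [] S) T (At [] R)"
| eps_r: "unif \<Gamma> T S R \<Longrightarrow> unif \<Gamma> T (At [] S) (At [] R)"
| split_at_l: "p \<noteq> [] \<Longrightarrow> unif \<Gamma> (At [i] (At p S)) T R \<Longrightarrow> unif \<Gamma> (At (i # p) S) T R"
| split_at_r: "p \<noteq> [] \<Longrightarrow> unif \<Gamma> T (At [i] (At p S)) R \<Longrightarrow> unif \<Gamma> T (At (i # p) S) R"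
| split_ins_l: "p \<noteq> [] \<Longrightarrow> unif \<Gamma> (At [i] (AtI p \<tau>)) T R \<Longrightarrow> unif \<Gamma> (AtI (i # p) \<tau>) T R"
| split_ins_r: "p \<noteq> [] \<Longrightarrow> unif \<Gamma> T (At [i] (AtI p \<tau>)) R \<Longrightarrow> unif \<Gamma> T (AtI (i # p) \<tau>) R"

| condI_l: "unif \<Gamma> (Cond u (AtI [] \<tau>)) T R \<Longrightarrow> unif \<Gamma> (CondI u \<tau>) T R"
| condI_r: "unif \<Gamma> T (Cond u (AtI [] \<tau>)) R \<Longrightarrow> unif \<Gamma> T (CondI u \<tau>) R"
| ins_cond: "arg_pos u i \<Longrightarrow> unif \<Gamma> (AtI i \<tau>) S R \<Longrightarrow> unif \<Gamma> (AtI i \<tau>) (Cond u S) (Cond u R)"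
| cond_ins: "arg_pos u i \<Longrightarrow> unif \<Gamma> S (AtI i \<tau>) R \<Longrightarrow> unif \<Gamma> (Cond u S) (AtI i \<tau>) (Cond u R)"
| ins_cond_fail: "i \<in> N_eps \<Longrightarrow> \<not> arg_pos u i \<Longrightarrow> unif \<Gamma> (AtI i \<tau>) (Cond u S) Fail"
| cond_ins_fail: "i \<in> N_eps \<Longrightarrow> \<not> arg_pos u i \<Longrightarrow> unif \<Gamma> (Cond u S) (AtI i \<tau>) Fail"
| cond_cond: "is_meet u u' w \<Longrightarrow> unif \<Gamma> S S' R \<Longrightarrow> unif \<Gamma> (Cond u S) (Cond u' S') (Cond w R)"
| cond_cond_fail: "\<not> unifiable u u' \<Longrightarrow> unif \<Gamma> (Cond u S) (Cond u' S') Fail"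
| cond_at: "unif \<Gamma> S (At i T) R \<Longrightarrow> unif \<Gamma> (Cond u S) (At i T) (Cond u R)"
| at_cond: "unif \<Gamma> (At i T) S R \<Longrightarrow> unif \<Gamma> (At i T) (Cond u S) (Cond u R)"
| cond_br: "unif \<Gamma> S (Br L \<phi>) R \<Longrightarrow> unif \<Gamma> (Cond u S) (Br L \<phi>) (Cond u R)"
| br_cond: "unif \<Gamma> (Br L \<phi>) S R \<Longrightarrow> unif \<Gamma> (Br L \<phi>) (Cond u S) (Cond u R)"

| br_br: "unif_entries \<Gamma> L L' K \<Longrightarrow> unif \<Gamma> (Br L \<phi>) (Br L' \<phi>') (Br K (FAnd \<phi> \<phi>'))"
| at_br: "i \<in> N_eps \<Longrightarrow> i \<noteq> [] \<Longrightarrow> unif_entries \<Gamma> [(i, S)] L' K \<Longrightarrow>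
    unif \<Gamma> (At i S) (Br L' \<phi>') (Br K (FAnd (FPos i) \<phi>'))"
| br_at: "i \<in> N_eps \<Longrightarrow> i \<noteq> [] \<Longrightarrow> unif_entries \<Gamma> L [(i, S)] K \<Longrightarrow>
    unif \<Gamma> (Br L \<phi>) (At i S) (Br K (FAnd \<phi> (FPos i)))"
| ins_br: "i \<in> N_eps \<Longrightarrow> unif_entries \<Gamma> [(i, AtI [] \<tau>)] L' K \<Longrightarrow>
    unif \<Gamma> (AtI i \<tau>) (Br L' \<phi>') (Br K (if i = [] then \<phi>' else FAnd (FPos i) \<phi>'))"
| br_ins: "i \<in> N_eps \<Longrightarrow> unif_entries \<Gamma> L [(i, AtI [] \<tau>)] K \<Longrightarrow>
    unif \<Gamma> (Br L \<phi>) (AtI i \<tau>) (Br K (if i = [] then \<phi> else FAnd \<phi> (FPos i)))"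

| choice_l: "unif \<Gamma> S1 T R1 \<Longrightarrow> unif \<Gamma> S2 T R2 \<Longrightarrow> unif \<Gamma> (Choice S1 S2) T (Choice R1 R2)"
| choice_r: "unif \<Gamma> T S1 R1 \<Longrightarrow> unif \<Gamma> T S2 R2 \<Longrightarrow> unif \<Gamma> T (Choice S1 S2) (Choice R1 R2)"

| mu_hyp: "((S, S'), Z) \<in> \<Gamma> \<Longrightarrow> unif \<Gamma> S S' (FVar Z)"
| mu_mu: "Z \<notin> snd ` \<Gamma> \<Longrightarrow>
    unif (insert ((Mu X S, Mu X' S'), Z) \<Gamma>) (fsubst X (Mu X S) S) (fsubst X' (Mu X' S') S') R \<Longrightarrow>
    unif \<Gamma> (Mu X S) (Mu X' S') (Mu Z R)"
| mu_l: "\<not> is_Mu T \<Longrightarrow> unif \<Gamma> (fsubst X (Mu X S) S) T R \<Longrightarrow> unif \<Gamma> (Mu X S) T R"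
| mu_r: "\<not> is_Mu T \<Longrightarrow> unif \<Gamma> T (fsubst X (Mu X S) S) R \<Longrightarrow> unif \<Gamma> T (Mu X S) R"
| mu_rec_l: "\<not> is_Mu T \<Longrightarrow> Z \<notin> snd ` \<Gamma> \<Longrightarrow>
    unif (insert ((Mu X S, T), Z) \<Gamma>) (fsubst X (Mu X S) S) T R \<Longrightarrow> unif \<Gamma> (Mu X S) T (Mu Z R)"
| mu_rec_r: "\<not> is_Mu T \<Longrightarrow> Z \<notin> snd ` \<Gamma> \<Longrightarrow>
    unif (insert ((T, Mu X S), Z) \<Gamma>) T (fsubst X (Mu X S) S) R \<Longrightarrow> unif \<Gamma> T (Mu X S) (Mu Z R)"

| entries: "map fst K = filter (\<lambda>i. i \<in> fst ` set L') (map fst L) \<Longrightarrow>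
    (\<And>i S S' R. (i, S) \<in> set L \<Longrightarrow> (i, S') \<in> set L' \<Longrightarrow> (i, R) \<in> set K \<Longrightarrow> unif \<Gamma> S S' R) \<Longrightarrow>
    unif_entries \<Gamma> L L' (order_entries (K @ filter (\<lambda>(i, S). i \<notin> fst ` set L') L
                                          @ filter (\<lambda>(i, S). i \<notin> fst ` set L) L'))"

definition unifies :: "(nat \<Rightarrow> 'f trm) \<Rightarrow> ('f trm \<times> 'f trm) list \<Rightarrow> bool" where
  "unifies \<sigma> E \<longleftrightarrow> (\<forall>(s, t)\<in>set E. subst \<sigma> s = subst \<sigma> t)"

definition eq_vars :: "('f trm \<times> 'f trm) list \<Rightarrow> nat set" where
  "eq_vars E = (\<Union>(s, t)\<in>set E. vars s \<union> vars t)"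

definition eq_size :: "('f trm \<times> 'f trm) list \<Rightarrow> nat" where
  "eq_size E = sum_list (map (\<lambda>(s, t). Suc (size s + size t)) E)"

lemma subst_subst: "subst \<sigma> (subst \<gamma> s) = subst (\<lambda>x. subst \<sigma> (\<gamma> x)) s"
  by (induction s) auto

lemma subst_cong: "(\<And>x. x \<in> vars s \<Longrightarrow> \<sigma> x = \<sigma>' x) \<Longrightarrow> subst \<sigma> s = subst \<sigma>' s"
  by (induction s) auto

lemma subst_Var: "subst Var s = s"
  by (induction s) (auto intro: map_idI)

lemma finite_vars: "finite (vars s)"
  by (induction s) auto

lemma vars_subst: "vars (subst \<sigma> s) = (\<Union>x\<in>vars s. vars (\<sigma> x))"
  by (induction s) auto

lemma size_subst_le: "x \<in> vars s \<Longrightarrow> size (\<sigma> x) \<le> size (subst \<sigma> s)"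
proof (induction s)
  case (Fun f ts)
  then obtain t where t: "t \<in> set ts" "x \<in> vars t" by auto
  have "size (\<sigma> x) \<le> size (subst \<sigma> t)" using Fun t by auto
  also have "\<dots> \<le> size_list size (map (subst \<sigma>) ts)"
    using t(1) by (intro size_list_estimation'[of "subst \<sigma> t"]) auto
  finally show ?case by simp
qed auto

lemma occurs_check:
  assumes "subst \<sigma> (Var x) = subst \<sigma> t" "t \<noteq> Var x"
  shows "x \<notin> vars t"
proof
  assume x: "x \<in> vars t"
  then obtain f ts where t: "t = Fun f ts" using assms(2) by (cases t) auto
  then obtain s where s: "s \<in> set ts" "x \<in> vars s" using x by auto
  have "size (\<sigma> x) \<le> size (subst \<sigma> s)" using s(2) by (rule size_subst_le)
  also have "\<dots> \<le> size_list size (map (subst \<sigma>) ts)"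
    using s(1) by (intro size_list_estimation'[of "subst \<sigma> s"]) auto
  also have "\<dots> < size (subst \<sigma> t)" by (simp add: t)
  finally show False using assms(1) by simp
qed

lemma mgu_exists:
  "unifies \<sigma> E \<Longrightarrow> \<exists>\<gamma>. unifies \<gamma> E \<and> (\<forall>\<sigma>. unifies \<sigma> E \<longrightarrow> (\<forall>x. \<sigma> x = subst \<sigma> (\<gamma> x)))"
proof (induction "(card (eq_vars E), eq_size E)" arbitrary: E \<sigma>
    rule: wf_induct_rule[OF wf_lex_prod[OF wf_less_than wf_less_than]])
  case (1 E \<sigma>)
  note IH = 1(1) and \<sigma> = 1(2)
  have fin: "finite (eq_vars E)" for E :: "('a trm \<times> 'a trm) list"
    by (auto simp: eq_vars_def finite_vars)
  have IHle: "\<exists>\<gamma>. unifies \<gamma> E \<and> (\<forall>\<sigma>. unifies \<sigma> E \<longrightarrow> (\<forall>x. \<sigma> x = subst \<sigma> (\<gamma> x)))"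
    if E': "\<And>\<sigma>. unifies \<sigma> E' \<longleftrightarrow> unifies \<sigma> E" "eq_vars E' \<subseteq> eq_vars E" "eq_size E' < eq_size E" for E'
  proof -
    have "card (eq_vars E') \<le> card (eq_vars E)" using card_mono[OF fin E'(2)] .
    then have "\<exists>\<gamma>. unifies \<gamma> E' \<and> (\<forall>\<sigma>. unifies \<sigma> E' \<longrightarrow> (\<forall>x. \<sigma> x = subst \<sigma> (\<gamma> x)))"
      using E' \<sigma> by (intro IH[of E' \<sigma>]) auto
    then show ?thesis using E'(1) by simp
  qed
  have elim: "\<exists>\<gamma>. unifies \<gamma> E \<and> (\<forall>\<sigma>. unifies \<sigma> E \<longrightarrow> (\<forall>x. \<sigma> x = subst \<sigma> (\<gamma> x)))"
    if E: "\<And>\<sigma>. unifies \<sigma> E \<longleftrightarrow> \<sigma> x = subst \<sigma> t \<and> unifies \<sigma> E'"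
      and v: "eq_vars E = insert x (vars t \<union> eq_vars E')" and t: "t \<noteq> Var x" for x t E'
  proof -
    let ?\<delta> = "Var(x := t)"
    let ?E = "map (\<lambda>(s, s'). (subst ?\<delta> s, subst ?\<delta> s')) E'"
    have occ: "x \<notin> vars t" using occurs_check[of \<sigma> x t] E[of \<sigma>] \<sigma> t by simp
    have abs: "(\<lambda>y. subst \<rho> (?\<delta> y)) = \<rho>" if "\<rho> x = subst \<rho> t" for \<rho>
      using that by (auto simp: fun_eq_iff)
    have E1: "unifies \<rho> ?E \<longleftrightarrow> unifies (\<lambda>y. subst \<rho> (?\<delta> y)) E'" for \<rho>
      unfolding unifies_def by (auto simp: subst_subst)
    have "vars (subst ?\<delta> s) \<subseteq> vars t \<union> (vars s - {x})" for s
      by (auto simp: vars_subst split: if_splits)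
    then have "eq_vars ?E \<subseteq> vars t \<union> (eq_vars E' - {x})"
      unfolding eq_vars_def by fastforce
    then have "eq_vars ?E \<subset> eq_vars E" using v occ by auto
    then have "card (eq_vars ?E) < card (eq_vars E)" using fin by (intro psubset_card_mono)
    moreover have "unifies \<sigma> ?E" using E1[of \<sigma>] E[of \<sigma>] \<sigma> abs[of \<sigma>] by simp
    ultimately obtain \<gamma> where \<gamma>: "unifies \<gamma> ?E" "\<And>\<rho> y. unifies \<rho> ?E \<Longrightarrow> \<rho> y = subst \<rho> (\<gamma> y)"
      using IH[of ?E \<sigma>] by auto
    let ?\<gamma> = "\<lambda>y. subst \<gamma> (?\<delta> y)"
    have "subst ?\<gamma> t = subst \<gamma> t" using occ by (intro subst_cong) auto
    then have "unifies ?\<gamma> E" using E[of ?\<gamma>] E1[of \<gamma>] \<gamma>(1) by simp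
    moreover have "\<rho> y = subst \<rho> (?\<gamma> y)" if "unifies \<rho> E" for \<rho> y
    proof -
      have \<rho>: "\<rho> x = subst \<rho> t" "unifies \<rho> ?E" using that E[of \<rho>] E1[of \<rho>] abs[of \<rho>] by auto
      have "subst \<rho> (?\<gamma> y) = subst (\<lambda>z. subst \<rho> (\<gamma> z)) (?\<delta> y)" by (simp only: subst_subst)
      also have "(\<lambda>z. subst \<rho> (\<gamma> z)) = \<rho>" using \<gamma>(2)[OF \<rho>(2)] by auto
      finally show ?thesis using abs[OF \<rho>(1)] by metis
    qed
    ultimately show ?thesis by blast
  qed
  show ?case
  proof (cases E)
    case Nil
    then show ?thesis by (intro exI[of _ Var]) (auto simp: unifies_def)
  next
    case (Cons e E')
    then obtain s t where E: "E = (s, t) # E'" by (cases e) auto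
    have \<sigma>st: "subst \<sigma> s = subst \<sigma> t" using \<sigma> by (simp add: E unifies_def)
    consider "s = t" | x where "s = Var x" "t \<noteq> Var x" | x where "t = Var x" "s \<noteq> Var x"
      | f ss g ts where "s = Fun f ss" "t = Fun g ts"
      by (metis trm.exhaust)
    then show ?thesis
    proof cases
      case 1
      then show ?thesis by (intro IHle[of E']) (auto simp: E unifies_def eq_vars_def eq_size_def)
    next
      case 2
      then show ?thesis by (intro elim[of x t E']) (auto simp: E unifies_def eq_vars_def)
    next
      case 3
      then show ?thesis by (intro elim[of x s E']) (auto simp: E unifies_def eq_vars_def)
    next
      case 4
      have fg: "f = g" "length ss = length ts"
        using \<sigma>st 4 by (auto dest: map_eq_imp_length_eq)
      have z: "eq_size (zip ss ts) \<le> size_list size ss + size_list size ts \<and>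
          eq_vars (zip ss ts) = (\<Union>u\<in>set ss \<union> set ts. vars u)"
        using fg(2) by (induction ss ts rule: list_induct2) (auto simp: eq_size_def eq_vars_def)
      have u: "unifies \<rho> (zip ss ts) \<longleftrightarrow> map (subst \<rho>) ss = map (subst \<rho>) ts" for \<rho>
        using fg(2) by (induction ss ts rule: list_induct2) (auto simp: unifies_def)
      show ?thesis
      proof (rule IHle[of "zip ss ts @ E'"])
        show "unifies \<rho> (zip ss ts @ E') \<longleftrightarrow> unifies \<rho> E" for \<rho>
          using u[of \<rho>] by (auto simp: E 4 fg unifies_def)
        show "eq_vars (zip ss ts @ E') \<subseteq> eq_vars E"
          using z by (auto simp: E 4 eq_vars_def)
        have "eq_size (zip ss ts @ E') = eq_size (zip ss ts) + eq_size E'"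
          by (simp add: eq_size_def)
        also have "\<dots> < eq_size E" using z by (auto simp: E 4 eq_size_def)
        finally show "eq_size (zip ss ts @ E') < eq_size E" .
      qed
    qed
  qed
qed

lemma is_meet_exists:
  assumes "unifiable u u'"
  shows "\<exists>w. is_meet u u' w"
proof -
  obtain v \<sigma> where v: "renamed_apart u u' v" "subst \<sigma> u = subst \<sigma> v"
    using assms unfolding unifiable_def by blast
  have "unifies \<sigma> [(u, v)]" using v(2) by (simp add: unifies_def)
  then obtain \<gamma> where "unifies \<gamma> [(u, v)]" "\<forall>\<sigma>. unifies \<sigma> [(u, v)] \<longrightarrow> (\<forall>x. \<sigma> x = subst \<sigma> (\<gamma> x))"
    using mgu_exists by blast
  then have "is_mgu \<gamma> u v" unfolding is_mgu_def unifies_def by auto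
  then show ?thesis using v(1) unfolding is_meet_def by blast
qed

text \<open>A result of unification always exists. A step leads from a strategy to a strategy that is
  unified in its place; only finitely many strategies are reachable from a closed one.\<close>

inductive step :: "'f strat \<Rightarrow> 'f strat \<Rightarrow> bool" where
  "step (Cond u S) S"
| "step (Choice S T) S"
| "step (Choice S T) T"
| "step (CondI u \<tau>) (Cond u (AtI [] \<tau>))"
| "step (Mu X S) (fsubst X (Mu X S) S)"
| "step (At p S) S"
| "p \<noteq> [] \<Longrightarrow> step (At (i # p) S) (At [i] (At p S))"
| "step (AtI p \<tau>) (AtI [] \<tau>)"
| "p \<noteq> [] \<Longrightarrow> step (AtI (i # p) \<tau>) (At [i] (AtI p \<tau>))"
| "(p, S) \<in> set L \<Longrightarrow> step (Br L \<phi>) S"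

fun inst :: "(nat \<Rightarrow> 'f strat) \<Rightarrow> 'f strat \<Rightarrow> 'f strat" where
  "inst \<sigma> Fail = Fail"
| "inst \<sigma> (FVar X) = \<sigma> X"
| "inst \<sigma> (Cond u S) = Cond u (inst \<sigma> S)"
| "inst \<sigma> (Choice S T) = Choice (inst \<sigma> S) (inst \<sigma> T)"
| "inst \<sigma> (CondI u \<tau>) = CondI u \<tau>"
| "inst \<sigma> (Mu X S) = Mu X (inst (\<sigma>(X := FVar X)) S)"
| "inst \<sigma> (At p S) = At p (inst \<sigma> S)"
| "inst \<sigma> (AtI p \<tau>) = AtI p \<tau>"
| "inst \<sigma> (Br L \<phi>) = Br (map (\<lambda>(p, S). (p, inst \<sigma> S)) L) \<phi>"

fun reach :: "(nat \<Rightarrow> 'f strat) \<Rightarrow> 'f strat \<Rightarrow> 'f strat set" where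
  "reach \<sigma> Fail = {Fail}"
| "reach \<sigma> (FVar X) = {}"
| "reach \<sigma> (Cond u S) = insert (inst \<sigma> (Cond u S)) (reach \<sigma> S)"
| "reach \<sigma> (Choice S T) = insert (inst \<sigma> (Choice S T)) (reach \<sigma> S \<union> reach \<sigma> T)"
| "reach \<sigma> (CondI u \<tau>) = {CondI u \<tau>, Cond u (AtI [] \<tau>), AtI [] \<tau>}"
| "reach \<sigma> (Mu X S) = insert (inst \<sigma> (Mu X S)) (reach (\<sigma>(X := inst \<sigma> (Mu X S))) S)"
| "reach \<sigma> (At p S) = (\<lambda>q. At q (inst \<sigma> S)) ` set (suffixes p)
     \<union> (\<lambda>(i, q). At [i] (At q (inst \<sigma> S))) ` (set p \<times> set (suffixes p)) \<union> reach \<sigma> S"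
| "reach \<sigma> (AtI p \<tau>) = (\<lambda>q. AtI q \<tau>) ` set (suffixes p)
     \<union> (\<lambda>(i, q). At [i] (AtI q \<tau>)) ` (set p \<times> set (suffixes p))"
| "reach \<sigma> (Br L \<phi>) = insert (inst \<sigma> (Br L \<phi>)) (\<Union> (set (map (\<lambda>(p, S). reach \<sigma> S) L)))"

lemma finite_reach: "finite (reach \<sigma> S)"
  by (induction S arbitrary: \<sigma>) auto

lemma inst_in_reach: "inst \<sigma> S \<in> reach \<sigma> S \<union> \<sigma> ` fv S"
  by (cases S) auto

lemma inst_FVar: "inst FVar S = S"
proof (induction S)
  case (Br L \<phi>)
  have "map (\<lambda>(p, S). (p, inst FVar S)) L = map id L"
    using Br.IH by (intro map_cong[OF refl]) force
  then show ?case by simp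
qed (auto simp: fun_upd_idem)

lemma fsubst_fresh: "X \<notin> fv S \<Longrightarrow> fsubst X T S = S"
proof (induction S)
  case (Br L \<phi>)
  have "map (\<lambda>(p, S). (p, fsubst X T S)) L = map id L"
    using Br by (intro map_cong[OF refl]) force
  then show ?case by simp
qed auto

lemma fsubst_inst:
  assumes "\<sigma> X = FVar X" "\<And>Y. \<sigma> Y = FVar Y \<or> fv (\<sigma> Y) = {}"
  shows "fsubst X M (inst \<sigma> S) = inst (\<sigma>(X := M)) S"
  using assms
proof (induction S arbitrary: \<sigma>)
  case (FVar Y)
  show ?case
  proof (cases "\<sigma> Y = FVar Y")
    case False
    then have "fv (\<sigma> Y) = {}" "Y \<noteq> X" using FVar by metis+
    then show ?thesis by (simp add: fsubst_fresh)
  qed (use FVar in auto)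
next
  case (Mu Z S)
  show ?case
  proof (cases "Z = X")
    case True
    have "\<sigma>(X := M, X := FVar X) = \<sigma>" "\<sigma>(X := FVar X) = \<sigma>" using Mu.prems(1) by auto
    then show ?thesis unfolding True by (simp only: inst.simps fsubst.simps simp_thms if_True)
  next
    case False
    have "fsubst X M (inst (\<sigma>(Z := FVar Z)) S) = inst (\<sigma>(Z := FVar Z, X := M)) S"
      using Mu.prems False by (intro Mu.IH) auto
    also have "\<sigma>(Z := FVar Z, X := M) = \<sigma>(X := M, Z := FVar Z)" using False by auto
    finally show ?thesis using False by (simp only: inst.simps fsubst.simps if_False)
  qed
next
  case (Br L \<phi>)
  have "map (\<lambda>(p, S). (p, fsubst X M (inst \<sigma> S))) L = map (\<lambda>(p, S). (p, inst (\<sigma>(X := M)) S)) L"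
    using Br.IH[OF _ _ Br.prems] by (intro map_cong[OF refl]) force
  then show ?case by (simp only: inst.simps fsubst.simps map_map_entries)
qed auto

lemma fv_inst:
  assumes "\<And>Y. Y \<in> fv S \<Longrightarrow> fv (\<sigma> Y) \<subseteq> B"
  shows "fv (inst \<sigma> S) \<subseteq> B"
  using assms
proof (induction S arbitrary: \<sigma> B)
  case (Mu X S)
  have "fv (inst (\<sigma>(X := FVar X)) S) \<subseteq> insert X B"
    using Mu.prems by (intro Mu.IH) auto
  then show ?case by auto
next
  case (Br L \<phi>)
  have "fv (inst \<sigma> S) \<subseteq> B" if "(p, S) \<in> set L" for p S
    using that Br.prems by (intro Br.IH[of "(p, S)" S]) fastforce+
  then show ?case by fastforce
qed auto

lemma suffixes_Cons_mem: "i # p \<in> set (suffixes q) \<Longrightarrow> p \<in> set (suffixes q) \<and> i \<in> set q"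
  by (auto simp: suffix_def)

lemma step_reach:
  assumes "A \<in> reach \<sigma> S" "step A B"
    and "\<And>Y. Y \<in> fv S \<Longrightarrow> fv (\<sigma> Y) = {}" "\<And>Y. \<sigma> Y = FVar Y \<or> fv (\<sigma> Y) = {}"
  shows "B \<in> reach \<sigma> S \<union> \<sigma> ` fv S"
  using assms
proof (induction S arbitrary: \<sigma>)
  case (Cond u S)
  show ?case
  proof (cases "A = inst \<sigma> (Cond u S)")
    case True
    then have "B = inst \<sigma> S" using Cond.prems(2) by (auto elim: step.cases)
    then show ?thesis using inst_in_reach[of \<sigma> S] by auto
  next
    case False
    then show ?thesis using Cond by auto
  qed
next
  case (Choice S T)
  consider "A = inst \<sigma> (Choice S T)" | "A \<in> reach \<sigma> S" | "A \<in> reach \<sigma> T"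
    using Choice.prems(1) by auto
  then show ?case
  proof cases
    case 1
    then have "B = inst \<sigma> S \<or> B = inst \<sigma> T" using Choice.prems(2) by (auto elim: step.cases)
    then show ?thesis using inst_in_reach[of \<sigma> S] inst_in_reach[of \<sigma> T] by auto
  next
    case 2
    then have "B \<in> reach \<sigma> S \<union> \<sigma> ` fv S" using Choice.prems by (intro Choice.IH(1)) auto
    then show ?thesis by auto
  next
    case 3
    then have "B \<in> reach \<sigma> T \<union> \<sigma> ` fv T" using Choice.prems by (intro Choice.IH(2)) auto
    then show ?thesis by auto
  qed
next
  case (Mu X S)
  let ?M = "inst \<sigma> (Mu X S)"
  let ?\<sigma> = "\<sigma>(X := ?M)"
  have M: "fv ?M = {}" using fv_inst[of "Mu X S" \<sigma> "{}"] Mu.prems(3) by blast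
  have sub: "reach ?\<sigma> S \<union> ?\<sigma> ` fv S \<subseteq> reach \<sigma> (Mu X S) \<union> \<sigma> ` fv (Mu X S)"
    by auto
  show ?case
  proof (cases "A = ?M")
    case True
    then have "B = fsubst X ?M (inst (\<sigma>(X := FVar X)) S)"
      using Mu.prems(2) by (auto elim: step.cases)
    also have "\<dots> = inst ?\<sigma> S"
      using fsubst_inst[of "\<sigma>(X := FVar X)" X ?M S] Mu.prems(4) by simp
    finally show ?thesis using inst_in_reach[of ?\<sigma> S] sub by blast
  next
    case False
    then have "A \<in> reach ?\<sigma> S" using Mu.prems(1) by simp
    moreover have "fv (?\<sigma> Y) = {}" if "Y \<in> fv S" for Y using M that Mu.prems(3) by auto
    moreover have "?\<sigma> Y = FVar Y \<or> fv (?\<sigma> Y) = {}" for Y using M Mu.prems(4) by auto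
    ultimately have "B \<in> reach ?\<sigma> S \<union> ?\<sigma> ` fv S" using Mu.prems(2) by (intro Mu.IH)
    then show ?thesis using sub by blast
  qed
next
  case (At p S)
  consider q where "A = At q (inst \<sigma> S)" "q \<in> set (suffixes p)"
    | i q where "A = At [i] (At q (inst \<sigma> S))" "q \<in> set (suffixes p)"
    | "A \<in> reach \<sigma> S"
    using At.prems(1) by auto
  then show ?case
  proof cases
    case 1
    from At.prems(2) show ?thesis unfolding 1(1)
    proof cases
      case 6
      then show ?thesis using inst_in_reach[of \<sigma> S] by auto
    next
      case (7 r i)
      then show ?thesis using 1(2) suffixes_Cons_mem[of i r p] by (auto simp: image_iff)
    qed
  next
    case 2
    from At.prems(2) show ?thesis unfolding 2(1) by cases (use 2(2) in auto)
  next
    case 3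
    then show ?thesis using At by auto
  qed
next
  case (AtI p \<tau>)
  consider q where "A = AtI q \<tau>" "q \<in> set (suffixes p)"
    | i q where "A = At [i] (AtI q \<tau>)" "q \<in> set (suffixes p)"
    using AtI.prems(1) by auto
  then show ?case
  proof cases
    case 1
    from AtI.prems(2) show ?thesis unfolding 1(1)
    proof cases
      case (9 r i)
      then show ?thesis using 1(2) suffixes_Cons_mem[of i r p] by (auto simp: image_iff)
    qed auto
  next
    case 2
    from AtI.prems(2) show ?thesis unfolding 2(1) by cases (use 2(2) in auto)
  qed
next
  case (Br L \<phi>)
  have sub: "reach \<sigma> S \<union> \<sigma> ` fv S \<subseteq> reach \<sigma> (Br L \<phi>) \<union> \<sigma> ` fv (Br L \<phi>)" if "(p, S) \<in> set L" for p S
    using that by fastforce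
  show ?case
  proof (cases "A = inst \<sigma> (Br L \<phi>)")
    case True
    then obtain p S where "(p, S) \<in> set L" "B = inst \<sigma> S"
      using Br.prems(2) by (auto elim!: step.cases)
    then show ?thesis using inst_in_reach[of \<sigma> S] sub by blast
  next
    case False
    then obtain p S where S: "(p, S) \<in> set L" "A \<in> reach \<sigma> S" using Br.prems(1) by auto
    have "B \<in> reach \<sigma> S \<union> \<sigma> ` fv S"
      using S Br.prems by (intro Br.IH[of "(p, S)" S]) fastforce+
    then show ?thesis using sub S(1) by blast
  qed
qed (auto elim: step.cases)

fun good :: "'f strat \<Rightarrow> bool" where
  "good Fail = True"
| "good (FVar X) = True"
| "good (Cond u S) = good S"
| "good (Choice S T) = (good S \<and> good T)"
| "good (CondI u \<tau>) = True"
| "good (Mu X S) = good S"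
| "good (At p S) = (is_pos p \<and> good S)"
| "good (AtI p \<tau>) = is_pos p"
| "good (Br L \<phi>) = (distinct (map fst L) \<and> fst ` set L \<subseteq> N_eps \<and> list_all id (map (\<lambda>(p, S). good S) L))"

lemma good_Br:
  "good (Br L \<phi>) \<longleftrightarrow>
     distinct (map fst L) \<and> set (map fst L) \<subseteq> N_eps \<and> (\<forall>(p, S)\<in>set L. good S)"
  by (simp add: list_all_iff case_prod_beta)

lemma good_fsubst: "good T \<Longrightarrow> good S \<Longrightarrow> good (fsubst X T S)"
proof (induction S)
  case (Br L \<phi>)
  have "map fst (map (\<lambda>(p, S). (p, fsubst X T S)) L) = map fst L"
    by (induction L) auto
  moreover have "good (fsubst X T S)" if "(p, S) \<in> set L" for p S
    using that Br.prems unfolding good_Br by (intro Br.IH[of "(p, S)" S]) auto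
  ultimately show ?case
    using Br.prems(2) unfolding fsubst.simps good_Br by (simp only:) auto
qed auto

lemma step_inv:
  assumes "step A B" "fv A = {} \<and> good A"
  shows "fv B = {} \<and> good B"
  using assms
proof cases
  case (5 X S)
  then have M: "fv (Mu X S) = {}" "good (Mu X S)" using assms(2) by blast+
  have "fv (fsubst X (Mu X S) S) = {}" using fv_fsubst[OF M(1), of X S] M(1) by simp
  moreover have "good (fsubst X (Mu X S) S)" using good_fsubst[OF M(2), of S X] M(2) by simp
  ultimately show ?thesis unfolding 5 ..
next
  case (10 p L \<phi>)
  then show ?thesis using assms(2) by (fastforce simp: list_all_iff)
qed (use assms(2) in \<open>simp_all add: is_pos_def\<close>)

fun weight :: "'f strat \<Rightarrow> nat" where
  "weight Fail = 1"
| "weight (FVar X) = 1"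
| "weight (Cond u S) = Suc (weight S)"
| "weight (Choice S T) = Suc (weight S + weight T)"
| "weight (CondI u \<tau>) = 3"
| "weight (Mu X S) = 1"
| "weight (At p S) = Suc (3 * (length p - 1) + weight S)"
| "weight (AtI p \<tau>) = (if p = [] then 1 else 3 * length p - 1)"
| "weight (Br L \<phi>) = Suc (sum_list (map (\<lambda>(p, S). weight S) L))"

lemma weight_entry: "(p, S) \<in> set L \<Longrightarrow> weight S < weight (Br L \<phi>)"
  by (induction L) auto

lemma conj_vars_N_eps: "conj_vars \<phi> \<Longrightarrow> fvars \<phi> \<subseteq> N_eps"
  by (induction \<phi>) auto

lemma wf_entries_distinct: "wf_entries L \<Longrightarrow> distinct (map fst L)"
proof -
  assume "wf_entries L"
  then obtain A B where *: "L = A @ B" "distinct (map fst B)" "sorted_wrt parallel (map fst A)"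
    "\<forall>q\<in>fst ` set B. \<forall>p\<in>fst ` set A. q \<sqsubset>p p"
    unfolding wf_entries_def by blast
  have "sorted_wrt parallel ps \<Longrightarrow> distinct ps" for ps :: "pos list"
    by (induction ps) auto
  with * show ?thesis by (fastforce simp: sqsub_def)
qed

lemma good_C_can:
  assumes "S \<in> C_can ar"
  shows "good S"
proof -
  have *: "(\<forall>p T. At p T \<in> subs S \<longrightarrow> is_pos p) \<Longrightarrow> (\<forall>p \<tau>. AtI p \<tau> \<in> subs S \<longrightarrow> is_pos p) \<Longrightarrow>
    (\<forall>L \<phi>. Br L \<phi> \<in> subs S \<longrightarrow> distinct (map fst L) \<and> fst ` set L \<subseteq> N_eps) \<Longrightarrow> good S" for S :: "'a strat"
  proof (induction S)
    case (Br L \<phi>)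
    have "good S" if "(p, S) \<in> set L" for p S
    proof (rule Br.IH[of "(p, S)" S])
      have sub: "subs S \<subseteq> subs (Br L \<phi>)" using that by fastforce
      show "\<forall>p T. At p T \<in> subs S \<longrightarrow> is_pos p" using Br.prems(1) sub by blast
      show "\<forall>p \<tau>. AtI p \<tau> \<in> subs S \<longrightarrow> is_pos p" using Br.prems(2) sub by blast
      show "\<forall>L \<phi>. Br L \<phi> \<in> subs S \<longrightarrow> distinct (map fst L) \<and> fst ` set L \<subseteq> N_eps"
        using Br.prems(3) sub by blast
    qed (use that in auto)
    then show ?case using Br.prems(3) by (auto simp: list_all_iff)
  next
    case (Choice S T)
    have sub: "subs S \<subseteq> subs (Choice S T)" "subs T \<subseteq> subs (Choice S T)" by auto
    have "good S" by (rule Choice.IH(1)) (use Choice.prems sub(1) in blast)+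
    moreover have "good T" by (rule Choice.IH(2)) (use Choice.prems sub(2) in blast)+
    ultimately show ?case by simp
  qed auto
  have **: "distinct (map fst L) \<and> fst ` set L \<subseteq> N_eps" if "Br L \<phi> \<in> subs S" for L \<phi>
  proof -
    have "wf_entries L" "fvars \<phi> = fst ` set L - {[]}" "conj_vars \<phi>"
      using that assms unfolding C_can_def ce_strategy_def canonical_def by auto
    then show ?thesis using wf_entries_distinct[of L] conj_vars_N_eps[of \<phi>]
      by (auto simp: N_eps_def)
  qed
  have ce: "ce_strategy ar S" using assms by (simp add: C_can_def)
  show ?thesis
  proof (rule *)
    show "\<forall>p T. At p T \<in> subs S \<longrightarrow> is_pos p" using ce unfolding ce_strategy_def by blast
    show "\<forall>p \<tau>. AtI p \<tau> \<in> subs S \<longrightarrow> is_pos p" using ce unfolding ce_strategy_def by blast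
  qed (use ** in blast)
qed

lemma unif_entries_total:
  assumes "distinct (map fst L)" "distinct (map fst L')"
    and "\<And>i S S'. (i, S) \<in> set L \<Longrightarrow> (i, S') \<in> set L' \<Longrightarrow> \<exists>R. unif \<Gamma> S S' R"
  shows "\<exists>K. unif_entries \<Gamma> L L' K"
proof -
  define f where "f i = (SOME R. unif \<Gamma> (the (map_of L i)) (the (map_of L' i)) R)" for i
  define K where "K = map (\<lambda>i. (i, f i)) (filter (\<lambda>i. i \<in> fst ` set L') (map fst L))"
  have "map fst K = filter (\<lambda>i. i \<in> fst ` set L') (map fst L)"
    unfolding K_def by (simp add: comp_def)
  moreover have "unif \<Gamma> S S' R"
    if "(i, S) \<in> set L" "(i, S') \<in> set L'" "(i, R) \<in> set K" for i S S' R
  proof -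
    have "R = f i" using that(3) unfolding K_def by auto
    moreover have "map_of L i = Some S" "map_of L' i = Some S'" using assms that by auto
    ultimately show ?thesis using someI_ex[OF assms(3)[OF that(1,2)]] unfolding f_def by simp
  qed
  ultimately show ?thesis using entries by blast
qed

lemma unif_total_aux:
  assumes "finite K1" "finite K2"
    and "\<And>A B. A \<in> K1 \<Longrightarrow> step A B \<Longrightarrow> B \<in> K1" "\<And>A B. A \<in> K2 \<Longrightarrow> step A B \<Longrightarrow> B \<in> K2"
  shows "finite \<Gamma> \<Longrightarrow> A \<in> K1 \<Longrightarrow> B \<in> K2 \<Longrightarrow> fv A = {} \<and> good A \<Longrightarrow> fv B = {} \<and> good B \<Longrightarrow>
    \<exists>R. unif \<Gamma> A B R"
proof (induction "(card (K1 \<times> K2 - fst ` \<Gamma>), weight A + weight B)" arbitrary: \<Gamma> A B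
    rule: wf_induct_rule[OF wf_lex_prod[OF wf_less_than wf_less_than]])
  case (1 \<Gamma> A B)
  note prems = 1(2-6)
  have IH: "\<exists>R. unif \<Gamma> A' B' R"
    if "A' = A \<or> step A A'" "B' = B \<or> step B B'" "weight A' + weight B' < weight A + weight B" for A' B'
  proof -
    have "A' \<in> K1" "B' \<in> K2" "fv A' = {} \<and> good A'" "fv B' = {} \<and> good B'"
      using that(1,2) prems assms(3,4) step_inv by blast+
    then show ?thesis using that(3) prems(1) by (intro 1(1)) auto
  qed
  have IHl: "\<exists>R. unif \<Gamma> A' B R" if "step A A'" "weight A' < weight A" for A'
    using that by (intro IH) auto
  have IHr: "\<exists>R. unif \<Gamma> A B' R" if "step B B'" "weight B' < weight B" for B'
    using that by (intro IH) auto
  obtain Z where Z: "Z \<notin> snd ` \<Gamma>" using prems(1) ex_new_if_finite infinite_UNIV_nat by blast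
  have IHm: "\<exists>R. unif (insert ((A, B), Z) \<Gamma>) A' B' R"
    if "A' = A \<or> step A A'" "B' = B \<or> step B B'" "(A, B) \<notin> fst ` \<Gamma>" for A' B'
  proof -
    have "card (K1 \<times> K2 - fst ` insert ((A, B), Z) \<Gamma>) < card (K1 \<times> K2 - fst ` \<Gamma>)"
      using that(3) prems assms(1,2) by (intro psubset_card_mono) auto
    moreover have "A' \<in> K1" "B' \<in> K2" "fv A' = {} \<and> good A'" "fv B' = {} \<and> good B'"
      using that(1,2) prems assms(3,4) step_inv by blast+
    ultimately show ?thesis using prems(1) by (intro 1(1)) auto
  qed
  have pos: "[i] \<in> N_eps" if "is_pos [i]" for i using that by (auto simp: N_eps_def is_pos_def)
  have posE: "[] \<in> N_eps" by (simp add: N_eps_def)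
  have split: "(\<exists>R. unif \<Gamma> A B R)" if "A = At p S" "length p \<noteq> 1" for p S
  proof (cases p)
    case Nil
    then show ?thesis using that IHl[of S] by (auto intro: step.intros eps_l)
  next
    case (Cons i q)
    then show ?thesis using that IHl[of "At [i] (At q S)"]
      by (cases q) (auto intro: step.intros split_at_l)
  qed
  have split': "(\<exists>R. unif \<Gamma> A B R)" if "B = At p S" "length p \<noteq> 1" for p S
  proof (cases p)
    case Nil
    then show ?thesis using that IHr[of S] by (auto intro: step.intros eps_r)
  next
    case (Cons i q)
    then show ?thesis using that IHr[of "At [i] (At q S)"]
      by (cases q) (auto intro: step.intros split_at_r)
  qed
  have isplit: "(\<exists>R. unif \<Gamma> A B R)" if "A = AtI p \<tau>" "1 < length p" for p \<tau>
    using that IHl[of "At [hd p] (AtI (tl p) \<tau>)"]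
    by (cases p) (auto intro!: step.intros split_ins_l)
  have isplit': "(\<exists>R. unif \<Gamma> A B R)" if "B = AtI p \<tau>" "1 < length p" for p \<tau>
    using that IHr[of "At [hd p] (AtI (tl p) \<tau>)"]
    by (cases p) (auto intro!: step.intros split_ins_r)
  show ?case
  proof (cases "is_Mu A \<or> is_Mu B")
    case True
    show ?thesis
    proof (cases "(A, B) \<in> fst ` \<Gamma>")
      case True
      then show ?thesis using mu_hyp by fastforce
    next
      case new: False
      show ?thesis
      proof (cases "is_Mu A")
        case A: True
        then obtain X S where A: "A = Mu X S" by (cases A) auto
        show ?thesis
        proof (cases "is_Mu B")
          case True
          then obtain X' S' where B: "B = Mu X' S'" by (cases B) auto
          have "\<exists>R. unif (insert ((A, B), Z) \<Gamma>) (fsubst X (Mu X S) S) (fsubst X' (Mu X' S') S') R"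
            using new by (intro IHm) (auto simp: A B intro: step.intros)
          then show ?thesis using mu_mu[OF Z] unfolding A B by blast
        next
          case False
          have "\<exists>R. unif (insert ((A, B), Z) \<Gamma>) (fsubst X (Mu X S) S) B R"
            using new by (intro IHm) (auto simp: A intro: step.intros)
          then show ?thesis using mu_rec_l[OF False Z] unfolding A by blast
        qed
      next
        case False
        then obtain X' S' where B: "B = Mu X' S'" using True by (cases B) auto
        have "\<exists>R. unif (insert ((A, B), Z) \<Gamma>) A (fsubst X' (Mu X' S') S') R"
          using new by (intro IHm) (auto simp: B intro: step.intros)
        then show ?thesis using mu_rec_r[OF False Z] unfolding B by blast
      qed
    qed
  next
    case False
    define mn :: "'a strat \<Rightarrow> bool" where "mn C \<longleftrightarrow> (\<exists>u S. C = Cond u S)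
        \<or> (\<exists>i S. C = At [i] S \<and> [i] \<in> N_eps)
        \<or> (\<exists>i \<tau>. C = AtI i \<tau> \<and> i \<in> N_eps)
        \<or> (\<exists>L \<phi>. C = Br L \<phi>)" for C
    consider (fail) "A = Fail \<or> B = Fail"
      | (choiceA) S T where "A = Choice S T" | (choiceB) S T where "B = Choice S T"
      | (condIA) u \<tau> where "A = CondI u \<tau>" | (condIB) u \<tau> where "B = CondI u \<tau>"
      | (atA) p S where "A = At p S" "length p \<noteq> 1" | (atB) p S where "B = At p S" "length p \<noteq> 1"
      | (atIA) p \<tau> where "A = AtI p \<tau>" "1 < length p" | (atIB) p \<tau> where "B = AtI p \<tau>" "1 < length p"
      | (main) "mn A" "mn B"
    proof -
      have single: "\<exists>i. p = [i]" if "length p = 1" for p :: pos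
        using that by (cases p) auto
      have short: "p = [] \<or> (\<exists>i. p = [i])" if "\<not> 1 < length p" for p :: pos
        using that by (cases p) auto
      have AA: "C = Fail \<or> (\<exists>S T. C = Choice S T) \<or> (\<exists>u \<tau>. C = CondI u \<tau>) \<or> (\<exists>p S. C = At p S \<and> length p \<noteq> 1)
          \<or> (\<exists>p \<tau>. C = AtI p \<tau> \<and> 1 < length p) \<or>
          mn C"
        if "\<not> is_Mu C" "fv C = {} \<and> good C" for C :: "'a strat"
        using that
      proof (cases C)
        case (At p S)
        then show ?thesis using that pos single[of p] by (cases "length p = 1") (auto simp: mn_def)
      next
        case (AtI p \<tau>)
        then show ?thesis using that pos posE short[of p] by (cases "1 < length p") (auto simp: mn_def)
      qed (auto simp: mn_def)
      show ?thesis
        using AA[of A] AA[of B] False prems(4,5) that by blast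
    qed
    then show ?thesis
    proof cases
      case fail
      then show ?thesis by (auto intro: fail_l fail_r)
    next
      case choiceA
      then show ?thesis using IHl[of S] IHl[of T] by (auto intro: step.intros choice_l)
    next
      case choiceB
      then show ?thesis using IHr[of S] IHr[of T] by (auto intro: step.intros choice_r)
    next
      case condIA
      then show ?thesis using IHl[of "Cond u (AtI [] \<tau>)"] by (auto intro: step.intros condI_l)
    next
      case condIB
      then show ?thesis using IHr[of "Cond u (AtI [] \<tau>)"] by (auto intro: step.intros condI_r)
    next
      case atA then show ?thesis by (rule split)
    next
      case atB then show ?thesis by (rule split')
    next
      case atIA then show ?thesis by (rule isplit)
    next
      case atIB then show ?thesis by (rule isplit')
    next
      case main
      have ent: "\<exists>K. unif_entries \<Gamma> L L' K"
        if "distinct (map fst L)" "distinct (map fst L')"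
          "\<And>i S S'. (i, S) \<in> set L \<Longrightarrow> (i, S') \<in> set L' \<Longrightarrow> (S = A \<or> step A S) \<and> (S' = B \<or> step B S')
             \<and> weight S + weight S' < weight A + weight B" for L L'
        using that by (intro unif_entries_total IH) blast+
      have brA: "step A S \<and> weight S < weight A" if "A = Br L \<phi>" "(i, S) \<in> set L" for L \<phi> i S
        using that weight_entry[OF that(2), of \<phi>] by (simp add: step.intros(10)[OF that(2)])
      have brB: "step B S \<and> weight S < weight B" if "B = Br L \<phi>" "(i, S) \<in> set L" for L \<phi> i S
        using that weight_entry[OF that(2), of \<phi>] by (simp add: step.intros(10)[OF that(2)])
      have atA: "step A S \<and> weight S < weight A" if "A = At p S" for p S
        using that by (simp add: step.intros)
      have atB: "step B S \<and> weight S < weight B" if "B = At p S" for p S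
        using that by (simp add: step.intros)
      have insA: "step A (AtI [] \<tau>) \<and> weight (AtI [] \<tau>) \<le> weight A" if "A = AtI p \<tau>" for p \<tau>
        using that by (cases p) (auto simp: step.intros)
      have insB: "step B (AtI [] \<tau>) \<and> weight (AtI [] \<tau>) \<le> weight B" if "B = AtI p \<tau>" for p \<tau>
        using that by (cases p) (auto simp: step.intros)
      from main show ?thesis unfolding mn_def
      proof (elim disjE exE conjE)
        fix u S u' S' assume AB: "A = Cond u S" "B = Cond u' S'"
        show ?thesis
        proof (cases "unifiable u u'")
          case True
          then show ?thesis using AB IH[of S S'] is_meet_exists[OF True]
            by (auto intro: step.intros cond_cond)
        next
          case False
          then show ?thesis using AB by (auto intro: cond_cond_fail)
        qed
      next
        fix u S i T assume AB: "A = Cond u S" "B = At [i] T"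
        then show ?thesis using IHl[of S] by (auto intro: step.intros cond_at)
      next
        fix u S i \<tau> assume AB: "A = Cond u S" "B = AtI i \<tau>" "i \<in> N_eps"
        then show ?thesis using IHl[of S]
          by (cases "arg_pos u i") (auto intro: step.intros cond_ins cond_ins_fail)
      next
        fix u S L \<phi> assume AB: "A = Cond u S" "B = Br L \<phi>"
        then show ?thesis using IHl[of S] by (auto intro: step.intros cond_br)
      next
        fix u S i T assume AB: "B = Cond u S" "A = At [i] T"
        then show ?thesis using IHr[of S] by (auto intro: step.intros at_cond)
      next
        fix i S j T assume AB: "A = At [i] S" "B = At [j] T" "[i] \<in> N_eps" "[j] \<in> N_eps"
        then show ?thesis using IH[of S T]
          by (cases "i = j") (auto intro: step.intros at_at_same at_at)
      next
        fix i S j \<tau> assume AB: "A = At [i] S" "B = AtI j \<tau>" "[i] \<in> N_eps" "j \<in> N_eps"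
        then have "\<exists>R. unif \<Gamma> S (AtI [] \<tau>) R" if "[i] = j"
          using that by (intro IH) (auto intro: step.intros)
        then show ?thesis using AB at_ins_same[OF AB(3)] at_ins[OF AB(4,3)] by (cases "[i] = j") blast+
      next
        fix i S L \<phi> assume AB: "A = At [i] S" "B = Br L \<phi>" "[i] \<in> N_eps"
        have "\<exists>K. unif_entries \<Gamma> [([i], S)] L K"
        proof (rule ent)
          show "distinct (map fst L)" using prems(5) AB by simp
        qed (use atA[OF AB(1)] brB[OF AB(2)] in \<open>auto intro: add_less_mono\<close>)
        then show ?thesis using AB at_br[OF AB(3)] by blast
      next
        fix u S i \<tau> assume AB: "B = Cond u S" "A = AtI i \<tau>" "i \<in> N_eps"
        then show ?thesis using IHr[of S]
          by (cases "arg_pos u i") (auto intro: step.intros ins_cond ins_cond_fail)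
      next
        fix i S j \<tau> assume AB: "B = At [i] S" "A = AtI j \<tau>" "[i] \<in> N_eps" "j \<in> N_eps"
        then have "\<exists>R. unif \<Gamma> (AtI [] \<tau>) S R" if "[i] = j"
          using that by (intro IH) (auto intro: step.intros)
        then show ?thesis using AB ins_at_same[OF AB(3)] ins_at[OF AB(4,3)] by (cases "[i] = j") blast+
      next
        fix i \<tau> j \<tau>' assume AB: "A = AtI i \<tau>" "B = AtI j \<tau>'" "i \<in> N_eps" "j \<in> N_eps"
        then show ?thesis by (cases "i = j") (auto intro: ins_ins_same ins_ins)
      next
        fix i \<tau> L \<phi> assume AB: "A = AtI i \<tau>" "B = Br L \<phi>" "i \<in> N_eps"
        have "\<exists>K. unif_entries \<Gamma> [(i, AtI [] \<tau>)] L K"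
        proof (rule ent)
          show "distinct (map fst L)" using prems(5) AB by simp
        qed (use insA[OF AB(1)] brB[OF AB(2)]  in \<open>auto simp del: weight.simps intro!: add_le_less_mono\<close>)
        then show ?thesis using AB ins_br[OF AB(3)] by metis
      next
        fix u S L \<phi> assume AB: "B = Cond u S" "A = Br L \<phi>"
        then show ?thesis using IHr[of S] by (auto intro: step.intros br_cond)
      next
        fix i S L \<phi> assume AB: "B = At [i] S" "A = Br L \<phi>" "[i] \<in> N_eps"
        have "\<exists>K. unif_entries \<Gamma> L [([i], S)] K"
        proof (rule ent)
          show "distinct (map fst L)" using prems(4) AB by simp
        qed (use atB[OF AB(1)] brA[OF AB(2)] in \<open>auto intro: add_less_mono\<close>)
        then show ?thesis using AB br_at[OF AB(3)] by blast
      next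
        fix i \<tau> L \<phi> assume AB: "B = AtI i \<tau>" "A = Br L \<phi>" "i \<in> N_eps"
        have "\<exists>K. unif_entries \<Gamma> L [(i, AtI [] \<tau>)] K"
        proof (rule ent)
          show "distinct (map fst L)" using prems(4) AB by simp
        qed (use insB[OF AB(1)] brA[OF AB(2)]  in \<open>auto simp del: weight.simps intro!: add_less_le_mono\<close>)
        then show ?thesis using AB br_ins[OF AB(3)] by metis
      next
        fix L \<phi> L' \<phi>' assume AB: "A = Br L \<phi>" "B = Br L' \<phi>'"
        have "\<exists>K. unif_entries \<Gamma> L L' K"
        proof (rule ent)
          show "distinct (map fst L)" "distinct (map fst L')" using prems(4,5) AB by simp_all
          fix i S S' assume "(i, S) \<in> set L" "(i, S') \<in> set L'"
          then show "(S = A \<or> step A S) \<and> (S' = B \<or> step B S') \<and> weight S + weight S' < weight A + weight B"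
            using brA[OF AB(1)] brB[OF AB(2)] by (simp add: add_less_mono)
        qed
        then show ?thesis using AB br_br by metis
      qed
    qed
  qed
qed

theorem unif_total:
  assumes "S \<in> C_can ar" "S' \<in> C_can ar"
  shows "\<exists>R. unif {} S S' R"
proof -
  have *: "T \<in> reach FVar T \<and> (\<forall>A B. A \<in> reach FVar T \<longrightarrow> step A B \<longrightarrow> B \<in> reach FVar T)"
    if T: "fv T = {}" for T :: "'a strat"
  proof (intro conjI allI impI)
    show "T \<in> reach FVar T" using inst_in_reach[of FVar T] T by (simp add: inst_FVar)
    show "B \<in> reach FVar T" if "A \<in> reach FVar T" "step A B" for A B
      using step_reach[OF that] T by simp
  qed
  have fv: "fv S = {}" "fv S' = {}" using assms by (auto simp: C_can_def)
  show ?thesis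
  proof (rule unif_total_aux[OF finite_reach finite_reach])
    show "S \<in> reach FVar S" "S' \<in> reach FVar S'" using *[OF fv(1)] *[OF fv(2)] by simp_all
    show "B \<in> reach FVar S" if "A \<in> reach FVar S" "step A B" for A B using *[OF fv(1)] that by blast
    show "B \<in> reach FVar S'" if "A \<in> reach FVar S'" "step A B" for A B using *[OF fv(2)] that by blast
  qed (use fv good_C_can[OF assms(1)] good_C_can[OF assms(2)] in simp_all)
qed

end

theory Submission
  imports Defs
begin

text \<open>On a fixed term a position-based strategy is a finite partial map from positions to tuples.
  Strategies have at most one entry per position and \<open>\<Psi>\<close> sorts by length, so equality up to \<open>\<simeq>\<close> is
  equality of these maps, and \<open>\<sqinter>p\<close> becomes an operation \<open>mjoin\<close> on maps which is strict in the empty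
  map. In a canonical list all entries have to succeed, hence failure of a list is failure of some
  entry and \<open>mjoin\<close> can be computed entrywise.

  For fixed points, the deepest of the iterates in \<open>\<Psi>(\<mu>X.S, t)\<close> decides: success is monotone in the
  iterates. Guardedness makes \<open>\<Psi>(S, t)\<close> depend on \<open>X\<close> only at proper subterms of \<open>t\<close>, so that \<open>\<mu>X.S\<close>
  may be unfolded, and the claim follows by induction on the derivation of \<open>R\<close>, where a formal symbol
  \<open>Z\<close> for \<open>S \<sqinter> S'\<close> is interpreted by any map that is correct on the smaller terms. This requires \<open>Z\<close> to
  be guarded in \<open>R\<close>: the number of unguarded binders decreases with every unguarded unfolding, so no
  pair recurs without passing through a position constructor.\<close>

section \<open>Failure and the iterates of a fixed point\<close>

text \<open>Strategies for which \<open>\<Psi>\<close> is empty exactly where the semantics fails. Unification preserves this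
  although its results contain free fixed-point variables.\<close>

fun conj_lists :: "'f strat \<Rightarrow> bool" where
  "conj_lists (Cond u S) = conj_lists S"
| "conj_lists (Choice S T) = (conj_lists S \<and> conj_lists T)"
| "conj_lists (Mu X S) = conj_lists S"
| "conj_lists (At p S) = conj_lists S"
| "conj_lists (Br L \<phi>) = (conj_vars \<phi> \<and> fvars \<phi> = fst ` set L - {[]} \<and>
     list_all id (map (\<lambda>(p, S). conj_lists S) L))"
| "conj_lists _ = True"

lemma conj_lists_Br:
  "conj_lists (Br L \<phi>) \<longleftrightarrow> conj_vars \<phi> \<and> fvars \<phi> = fst ` set L - {[]} \<and> (\<forall>(p, S)\<in>set L. conj_lists S)"
  by (simp add: list_all_iff case_prod_beta)

type_synonym 'f env = "nat \<Rightarrow> 'f den \<times> 'f pden"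

text \<open>These are the iterates that occur inside \<open>Psi_env\<close> at \<open>Mu\<close>.
  Both components run in lockstep because \<Psi> consults the semantics when it evaluates the
  formula of a list.\<close>

definition mu_approx :: "'f env \<Rightarrow> nat \<Rightarrow> 'f strat \<Rightarrow> nat \<Rightarrow> 'f den \<times> 'f pden" where
  "mu_approx \<rho> X S i =
     ((\<lambda>(d, e). (sem_env ((fst \<circ> \<rho>)(X := d)) S, Psi_env (\<rho>(X := (d, e))) S)) ^^ i) (\<lambda>_. None, \<lambda>_. [])"

lemma mu_approx_0 [simp]: "mu_approx \<rho> X S 0 = (\<lambda>_. None, \<lambda>_. [])"
  by (simp add: mu_approx_def)

lemma fst_upd: "fst \<circ> (\<rho>(X := m)) = (fst \<circ> \<rho>)(X := fst m)"
  by auto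

lemma mu_approx_Suc:
  "mu_approx \<rho> X S (Suc i) = (sem_env (fst \<circ> \<rho>(X := mu_approx \<rho> X S i)) S,
                              Psi_env (\<rho>(X := mu_approx \<rho> X S i)) S)"
  unfolding mu_approx_def fst_upd by (simp add: case_prod_beta)

text \<open>The semantic component never looks at the position-based one, so it coincides with the
  iterate used by \<open>sem_env\<close>.\<close>

lemma fst_mu_approx: "fst (mu_approx \<rho> X S i) = ((\<lambda>d. sem_env ((fst \<circ> \<rho>)(X := d)) S) ^^ i) (\<lambda>_. None)"
proof -
  define F where "F = (\<lambda>d. sem_env ((fst \<circ> \<rho>)(X := d)) S)"
  have "fst (mu_approx \<rho> X S i) = (F ^^ i) (\<lambda>_. None)"
  proof (induction i)
    case (Suc i)
    have "fst (mu_approx \<rho> X S (Suc i)) = F (fst (mu_approx \<rho> X S i))"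
      unfolding F_def mu_approx_Suc fst_conv fst_upd ..
    then show ?case by (simp only: Suc funpow.simps comp_apply)
  qed simp
  then show ?thesis unfolding F_def .
qed

lemma sem_env_Mu:
  "sem_env (fst \<circ> \<rho>) (Mu X S) t = foldr (\<lambda>i. orelse (fst (mu_approx \<rho> X S i) t)) (exponents t) None"
  by (simp add: fst_mu_approx)

lemma Psi_env_Mu:
  "Psi_env \<rho> (Mu X S) t = foldr (\<lambda>i. porelse (snd (mu_approx \<rho> X S i) t)) (exponents t) []"
  by (simp add: mu_approx_def)

declare sem_env.simps(6) [simp del] Psi_env.simps(6) [simp del]

lemma orelse_None_iff [simp]: "orelse x y = None \<longleftrightarrow> x = None \<and> y = None"
  by (cases x) auto

lemma porelse_Nil_iff [simp]: "porelse x y = [] \<longleftrightarrow> x = [] \<and> y = []"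
  by (cases x) auto

lemma foldr_orelse_None_iff: "foldr (\<lambda>i. orelse (f i)) is None = None \<longleftrightarrow> (\<forall>i\<in>set is. f i = None)"
  by (induction "is") auto

lemma foldr_porelse_Nil_iff: "foldr (\<lambda>i. porelse (f i)) is [] = [] \<longleftrightarrow> (\<forall>i\<in>set is. f i = [])"
  by (induction "is") auto

lemma set_exponents: "set (exponents t) = {1..Suc (depth t)}"
  by (auto simp: exponents_def)

lemma exponents_Cons: "\<exists>is. exponents t = Suc (depth t) # is"
  by (simp add: exponents_def)

lemma models_mono: "models \<nu> \<phi> \<Longrightarrow> (\<And>p. \<nu> p \<Longrightarrow> \<nu>' p) \<Longrightarrow> models \<nu>' \<phi>"
  by (induction \<phi>) auto

lemma models_conj_vars: "conj_vars \<phi> \<Longrightarrow> models \<nu> \<phi> \<longleftrightarrow> (\<forall>p\<in>fvars \<phi>. \<nu> p)"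
  by (induction \<phi>) auto

lemma conj_vars_nonempty: "conj_vars \<phi> \<Longrightarrow> fvars \<phi> \<noteq> {}"
  by (induction \<phi>) auto

lemma arrange_Nil_iff [simp]: "arrange E = [] \<longleftrightarrow> E = []"
  unfolding arrange_def by (metis set_empty set_sort)

lemma set_arrange [simp]: "set (arrange E) = set E"
  by (simp add: arrange_def)

lemma prefix_pos_Nil_iff [simp]: "prefix_pos p E = [] \<longleftrightarrow> E = []"
  by (simp add: prefix_pos_def)

lemma val_of_map:
  "val_of (map (\<lambda>(p, S). (p, f S)) L) t p \<longleftrightarrow> (\<forall>S. (p, S) \<in> set L \<longrightarrow> at_den p (f S) t \<noteq> None)"
  unfolding val_of_def by fastforce

text \<open>Formulas contain no negation and a list cannot fail once its formula holds, so success
  is monotone in the success of the environment. The resulting terms may change, for instance when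
  an earlier alternative of a choice begins to succeed.\<close>

lemma sem_env_mono:
  assumes "\<And>X t. \<rho> X t \<noteq> None \<Longrightarrow> \<rho>' X t \<noteq> None" "sem_env \<rho> S t \<noteq> None"
  shows "sem_env \<rho>' S t \<noteq> None"
  using assms
proof (induction S arbitrary: \<rho> \<rho>' t)
  case (Mu X S)
  define F where "F \<rho> = (\<lambda>d. sem_env (\<rho>(X := d)) S)" for \<rho>
  \<comment> \<open>Both chains of iterates start from failure everywhere; the hypothesis on
    \<open>S\<close> carries the comparison from one iterate to the next.\<close>
  have le: "(F \<rho> ^^ i) (\<lambda>_. None) t \<noteq> None \<Longrightarrow> (F \<rho>' ^^ i) (\<lambda>_. None) t \<noteq> None" for i t
  proof (induction i arbitrary: t)
    case (Suc i)
    have "sem_env (\<rho>(X := (F \<rho> ^^ i) (\<lambda>_. None))) S t \<noteq> None"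
      using Suc.prems unfolding funpow.simps comp_apply F_def[of \<rho>] .
    moreover have "(\<rho>'(X := (F \<rho>' ^^ i) (\<lambda>_. None))) Y s \<noteq> None"
      if "(\<rho>(X := (F \<rho> ^^ i) (\<lambda>_. None))) Y s \<noteq> None" for Y s
      using that Suc.IH[of s] Mu.prems(1)[of Y s] by (cases "Y = X") simp_all
    ultimately have "sem_env (\<rho>'(X := (F \<rho>' ^^ i) (\<lambda>_. None))) S t \<noteq> None"
      by (rule Mu.IH[rotated])
    then show ?case unfolding funpow.simps comp_apply F_def[of \<rho>'] .
  qed simp
  show ?case
    using Mu.prems(2) le unfolding sem_env.simps foldr_orelse_None_iff F_def by blast
next
  case (Br L \<phi>)
  have "models (val_of (map (\<lambda>(p, S). (p, sem_env \<rho>' S)) L) t) \<phi>"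
    if "models (val_of (map (\<lambda>(p, S). (p, sem_env \<rho> S)) L) t) \<phi>"
    using that
  proof (rule models_mono)
    fix p assume "val_of (map (\<lambda>(p, S). (p, sem_env \<rho> S)) L) t p"
    then show "val_of (map (\<lambda>(p, S). (p, sem_env \<rho>' S)) L) t p"
      unfolding val_of_map
      using Br.IH[of _ _ \<rho> \<rho>'] Br.prems(1) by (fastforce simp: at_den_def split: if_splits)
  qed
  then show ?case using Br.prems(2) by (auto simp: Let_def split: if_splits)
next
  case (Choice S T)
  then show ?case using Choice.IH[of \<rho> \<rho>'] by auto
qed (fastforce simp: at_den_def split: if_splits)+

definition fail_agree :: "'f env \<Rightarrow> bool" where
  "fail_agree \<rho> \<longleftrightarrow> (\<forall>X t. fst (\<rho> X) t = None \<longleftrightarrow> snd (\<rho> X) t = [])"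

lemma fail_agree_upd:
  "fail_agree \<rho> \<Longrightarrow> (\<And>t. fst m t = None \<longleftrightarrow> snd m t = []) \<Longrightarrow> fail_agree (\<rho>(X := m))"
  by (simp add: fail_agree_def)

lemma at_fail_agree:
  "(\<And>t. d t = None \<longleftrightarrow> e t = []) \<Longrightarrow> at_den p d t = None \<longleftrightarrow> at_pden p e t = []"
  by (simp add: at_den_def at_pden_def)

text \<open>The critical case is a list: once its formula holds the semantics succeeds, so \<Psi>
  must produce an entry. This is where the empty conjunction has to be excluded.\<close>

lemma sem_None_iff_Psi_Nil:
  "conj_lists S \<Longrightarrow> fail_agree \<rho> \<Longrightarrow> sem_env (fst \<circ> \<rho>) S t = None \<longleftrightarrow> Psi_env \<rho> S t = []"
proof (induction S arbitrary: \<rho> t)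
  case (Mu X S)
  have "fst (mu_approx \<rho> X S i) t = None \<longleftrightarrow> snd (mu_approx \<rho> X S i) t = []" for i t
  proof (induction i arbitrary: t)
    case (Suc i)
    have "fail_agree (\<rho>(X := mu_approx \<rho> X S i))"
      using Suc Mu.prems(2) by (intro fail_agree_upd)
    then show ?case using Mu.IH Mu.prems(1) by (simp only: mu_approx_Suc fst_conv snd_conv conj_lists.simps)
  qed simp
  then show ?case unfolding sem_env_Mu Psi_env_Mu foldr_orelse_None_iff foldr_porelse_Nil_iff by simp
next
  case (Br L \<phi>)
  have c: "conj_vars \<phi>" "fvars \<phi> = fst ` set L - {[]}" "\<And>p S. (p, S) \<in> set L \<Longrightarrow> conj_lists S"
    using Br.prems(1) unfolding conj_lists_Br by auto
  have "at_den p (sem_env (fst \<circ> \<rho>) S) t = None \<longleftrightarrow> at_pden p (Psi_env \<rho> S) t = []"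
    if S: "(p, S) \<in> set L" for p S
  proof (rule at_fail_agree)
    show "sem_env (fst \<circ> \<rho>) S t = None \<longleftrightarrow> Psi_env \<rho> S t = []" for t
      by (rule Br.IH[of "(p, S)" S]) (use S Br.prems(2) c(3) in auto)
  qed
  then have v: "val_of (map (\<lambda>(p, S). (p, sem_env (fst \<circ> \<rho>) S)) L) t p
      \<longleftrightarrow> (\<forall>S. (p, S) \<in> set L \<longrightarrow> at_pden p (Psi_env \<rho> S) t \<noteq> [])" for p
    unfolding val_of_map by blast
  show ?case
  proof (cases "models (val_of (map (\<lambda>(p, S). (p, sem_env (fst \<circ> \<rho>) S)) L) t) \<phi>")
    case True
    \<comment> \<open>A conjunction contains at least one variable; the entry at that position
      succeeds and makes the concatenation nonempty.\<close>
    obtain p where p: "p \<in> fvars \<phi>" using conj_vars_nonempty[OF c(1)] by blast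
    then obtain S where S: "(p, S) \<in> set L" using c(2) by force
    then have "at_pden p (Psi_env \<rho> S) t \<noteq> []"
      using True p unfolding models_conj_vars[OF c(1)] v by blast
    then show ?thesis using True S by (auto simp: Let_def simp del: o_apply intro!: bexI[of _ "(p, S)"])
  qed (simp add: Let_def del: o_apply)
next
  case (FVar X)
  then show ?case by (simp add: fail_agree_def)
qed (auto simp: at_den_def at_pden_def)

lemma fail_agree_mu_approx:
  assumes "conj_lists S" "fail_agree \<rho>"
  shows "fail_agree (\<rho>(X := mu_approx \<rho> X S i))"
proof (induction i)
  case 0
  then show ?case using assms(2) by (simp add: fail_agree_def)
next
  case (Suc i)
  show ?case
    using sem_None_iff_Psi_Nil[OF assms(1) Suc]
    by (intro fail_agree_upd assms(2)) (simp only: mu_approx_Suc fst_conv snd_conv)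
qed

text \<open>The usual argument for a chain of iterates: it starts from failure everywhere, and
  \<open>sem_env_mono\<close> lifts each comparison to the next pair.\<close>

lemma fst_mu_approx_mono:
  "fst (mu_approx \<rho> X S i) t \<noteq> None \<Longrightarrow> fst (mu_approx \<rho> X S (Suc i)) t \<noteq> None"
proof (induction i arbitrary: t)
  case (Suc i)
  have "sem_env (fst \<circ> \<rho>(X := mu_approx \<rho> X S i)) S t \<noteq> None"
    using Suc.prems unfolding mu_approx_Suc by simp
  then have "sem_env (fst \<circ> \<rho>(X := mu_approx \<rho> X S (Suc i))) S t \<noteq> None"
    by (rule sem_env_mono[rotated]) (use Suc.IH in \<open>auto simp: fst_upd\<close>)
  then show ?case unfolding mu_approx_Suc[of \<rho> X S "Suc i"] by simp
qed simp

text \<open>The exponent \<open>depth t + 1\<close> is tried first. If it succeeds, it gives the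
  result; if it fails, all smaller exponents fail too, by monotonicity.\<close>

lemma Mu_eq_mu_approx:
  assumes "conj_lists S" "fail_agree \<rho>"
  shows "Psi_env \<rho> (Mu X S) t = snd (mu_approx \<rho> X S (Suc (depth t))) t"
proof -
  let ?m = "mu_approx \<rho> X S"
  have iff: "fst (?m i) t = None \<longleftrightarrow> snd (?m i) t = []" for i
    using fail_agree_mu_approx[OF assms, of X i] by (simp add: fail_agree_def split: if_splits)
  obtain "is" where e: "exponents t = Suc (depth t) # is" using exponents_Cons by blast
  show ?thesis
  proof (cases "snd (?m (Suc (depth t))) t")
    case Nil
    \<comment> \<open>Downward induction from \<open>Suc (depth t)\<close>: failure of an iterate is
      inherited by its predecessor.\<close>
    have "fst (?m i) t = None" if "i \<le> Suc (depth t)" for i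
      using that
    proof (induction rule: inc_induct)
      case base
      then show ?case using iff Nil by simp
    next
      case (step n)
      then show ?case using fst_mu_approx_mono by metis
    qed
    then show ?thesis
      using iff foldr_porelse_Nil_iff[of "\<lambda>i. snd (?m i) t" "exponents t"] Nil
      unfolding Psi_env_Mu by (simp add: set_exponents)
  next
    case (Cons x xs)
    then show ?thesis unfolding Psi_env_Mu e by simp
  qed
qed

section \<open>Locality in the term and unfolding of fixed points\<close>

lemma depth_subt_at: "p \<in> poss t \<Longrightarrow> p \<noteq> [] \<Longrightarrow> depth (subt_at t p) < depth t"
proof (induction t p rule: subt_at.induct)
  case (2 f ts i p)
  then have i: "0 < i" "i - 1 < length ts" "p \<in> poss (ts ! (i - 1))" by auto
  have "depth (ts ! (i - 1)) < depth (Fun f ts)"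
    using i(2) by (auto simp: less_Suc_eq_le intro!: Max_ge)
  then show ?case using 2(1) i(3) by (cases "p = []") fastforce+
qed auto

definition agree_at :: "'f trm \<Rightarrow> 'f den \<times> 'f pden \<Rightarrow> 'f den \<times> 'f pden \<Rightarrow> bool" where
  "agree_at t m m' \<longleftrightarrow> (fst m t = None \<longleftrightarrow> fst m' t = None) \<and> snd m t = snd m' t"

text \<open>Only failure is compared on the semantic side: the entries of a list act on a term that earlier
  entries have modified, so the resulting terms need not agree.\<close>

lemma Psi_env_local:
  assumes "\<And>Y s. Y \<in> fv S \<Longrightarrow> depth s < depth t \<or> s = t \<and> Y \<in> unguarded S \<Longrightarrow> agree_at s (\<rho> Y) (\<rho>' Y)"
  shows "agree_at t (sem_env (fst \<circ> \<rho>) S, Psi_env \<rho> S) (sem_env (fst \<circ> \<rho>') S, Psi_env \<rho>' S)"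
  using assms
proof (induction S arbitrary: \<rho> \<rho>' t)
  case (FVar X)
  then show ?case by (simp add: agree_at_def)
next
  case (Mu X S)
  let ?m = "mu_approx \<rho> X S" and ?m' = "mu_approx \<rho>' X S"
  \<comment> \<open>The iterates are compared on shallower terms as well, since evaluating
    \<open>S\<close> at \<open>t\<close> may query the previous iterate there.\<close>
  have "agree_at s (?m i) (?m' i)" if "depth s < depth t \<or> s = t" for i s
    using that
  proof (induction i arbitrary: s)
    case (Suc i)
    show ?case unfolding mu_approx_Suc
    proof (rule Mu.IH)
      fix Y r assume Y: "Y \<in> fv S" and r: "depth r < depth s \<or> r = s \<and> Y \<in> unguarded S"
      then have *: "depth r < depth t \<or> r = t \<and> Y \<in> unguarded S" using Suc.prems by auto
      show "agree_at r ((\<rho>(X := ?m i)) Y) ((\<rho>'(X := ?m' i)) Y)"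
        using Suc.IH[of r] Mu.prems[of Y r] * Y by (cases "Y = X") auto
    qed
  qed (simp add: agree_at_def)
  then show ?case
    unfolding agree_at_def fst_conv snd_conv sem_env_Mu Psi_env_Mu foldr_orelse_None_iff by simp
next
  case (Br L \<phi>)
  have *: "(at_den p (sem_env (fst \<circ> \<rho>) S) t = None \<longleftrightarrow> at_den p (sem_env (fst \<circ> \<rho>') S) t = None)
      \<and> at_pden p (Psi_env \<rho> S) t = at_pden p (Psi_env \<rho>' S) t" if S: "(p, S) \<in> set L" for p S
  proof (cases "p \<in> poss t")
    case True
    \<comment> \<open>An entry at \<open>[]\<close> stays at \<open>t\<close> and keeps its
      unguarded variables; any other position leads to a shallower term, where agreement is assumed
      for all free variables.\<close>
    have "agree_at (subt_at t p) (sem_env (fst \<circ> \<rho>) S, Psi_env \<rho> S) (sem_env (fst \<circ> \<rho>') S, Psi_env \<rho>' S)"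
    proof (rule Br.IH[of "(p, S)" S])
      fix Y s assume "Y \<in> fv S" "depth s < depth (subt_at t p) \<or> s = subt_at t p \<and> Y \<in> unguarded S"
      then show "agree_at s (\<rho> Y) (\<rho>' Y)"
        using depth_subt_at[OF True] S by (intro Br.prems) (cases "p = []"; fastforce)+
    qed (use S in auto)
    then show ?thesis by (simp add: agree_at_def at_den_def at_pden_def)
  qed (simp add: at_den_def at_pden_def)
  have "map (\<lambda>(p, S). at_pden p (Psi_env \<rho> S) t) L = map (\<lambda>(p, S). at_pden p (Psi_env \<rho>' S) t) L"
    using * by (intro map_cong) auto
  moreover have "val_of (map (\<lambda>(p, S). (p, sem_env (fst \<circ> \<rho>) S)) L) t
     = val_of (map (\<lambda>(p, S). (p, sem_env (fst \<circ> \<rho>') S)) L) t"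
    unfolding fun_eq_iff val_of_map using * by auto
  ultimately show ?case by (simp only: agree_at_def fst_conv snd_conv sem_env.simps Psi_env.simps Let_def) simp
next
  case (At p S)
  show ?case
  proof (cases "p \<in> poss t")
    case True
    have "agree_at (subt_at t p) (sem_env (fst \<circ> \<rho>) S, Psi_env \<rho> S) (sem_env (fst \<circ> \<rho>') S, Psi_env \<rho>' S)"
    proof (rule At.IH)
      fix Y s assume "Y \<in> fv S" "depth s < depth (subt_at t p) \<or> s = subt_at t p \<and> Y \<in> unguarded S"
      then show "agree_at s (\<rho> Y) (\<rho>' Y)"
        using depth_subt_at[OF True] by (intro At.prems) (cases "p = []"; fastforce)+
    qed
    then show ?thesis
      unfolding agree_at_def fst_conv snd_conv sem_env.simps Psi_env.simps at_den_def at_pden_def by simp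
  qed (simp add: agree_at_def at_den_def at_pden_def)
next
  case (Choice S T)
  have "agree_at t (sem_env (fst \<circ> \<rho>) S, Psi_env \<rho> S) (sem_env (fst \<circ> \<rho>') S, Psi_env \<rho>' S)"
    "agree_at t (sem_env (fst \<circ> \<rho>) T, Psi_env \<rho> T) (sem_env (fst \<circ> \<rho>') T, Psi_env \<rho>' T)"
    using Choice.prems by (auto intro!: Choice.IH)
  then show ?case by (simp add: agree_at_def del: o_apply)
next
  case (Cond u S)
  have "agree_at t (sem_env (fst \<circ> \<rho>) S, Psi_env \<rho> S) (sem_env (fst \<circ> \<rho>') S, Psi_env \<rho>' S)"
    using Cond.prems by (auto intro!: Cond.IH)
  then show ?case by (simp add: agree_at_def del: o_apply)
qed (auto simp: agree_at_def)

text \<open>Evaluating \<open>S\<close> at \<open>t\<close> queries the guarded \<open>X\<close>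
  only on shallower terms. Each round of iteration thus uses up at least one level of depth, and
  beyond \<open>depth t\<close> rounds nothing changes any more.\<close>

lemma mu_approx_stable:
  assumes "X \<notin> unguarded S" "depth t < i" "depth t < j"
  shows "agree_at t (mu_approx \<rho> X S i) (mu_approx \<rho> X S j)"
  using assms(2,3)
proof (induction i arbitrary: j t)
  case (Suc i)
  obtain j' where j: "j = Suc j'" using Suc.prems(2) by (cases j) auto
  show ?case unfolding j mu_approx_Suc
  proof (rule Psi_env_local)
    fix Y s assume "depth s < depth t \<or> s = t \<and> Y \<in> unguarded S"
    then show "agree_at s ((\<rho>(X := mu_approx \<rho> X S i)) Y) ((\<rho>(X := mu_approx \<rho> X S j')) Y)"
      using Suc.IH[of s j'] Suc.prems assms(1) by (cases "Y = X") (auto simp: j agree_at_def)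
  qed
qed simp

text \<open>One of the \<open>depth t + 1\<close> rounds that compute the fixed point at
  \<open>t\<close> is the outer \<open>S\<close>; the remaining \<open>depth t\<close> rounds yield
  the fixed point itself on every shallower term, and guardedness confines \<open>X\<close> to
  those.\<close>

lemma Psi_unfold:
  assumes "fv (Mu X S) = {}" "conj_lists S" "X \<notin> unguarded S"
  shows "Psi (Mu X S) t = Psi (fsubst X (Mu X S) S) t"
proof -
  define \<rho> :: "'a env" where "\<rho> = (\<lambda>_. (\<lambda>_. None, \<lambda>_. []))"
  have \<rho>: "fail_agree \<rho>" by (simp add: fail_agree_def \<rho>_def)
  let ?m = "(sem_env (fst \<circ> \<rho>) (Mu X S), Psi_env \<rho> (Mu X S))"
  have m: "agree_at s (mu_approx \<rho> X S (depth t)) ?m" if "depth s < depth t" for s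
  proof -
    \<comment> \<open>\<open>Suc (depth s)\<close> rounds are what the fixed point uses at
      \<open>s\<close>; stability permits \<open>depth t\<close> rounds instead.\<close>
    have "agree_at s (mu_approx \<rho> X S (depth t)) (mu_approx \<rho> X S (Suc (depth s)))"
      using that assms(3) by (intro mu_approx_stable) auto
    moreover have "agree_at s (mu_approx \<rho> X S (Suc (depth s))) ?m"
    proof -
      have "Psi_env \<rho> (Mu X S) s = snd (mu_approx \<rho> X S (Suc (depth s))) s"
        using Mu_eq_mu_approx[OF assms(2) \<rho>] .
      moreover have "sem_env (fst \<circ> \<rho>) (Mu X S) s = None \<longleftrightarrow> Psi_env \<rho> (Mu X S) s = []"
        using assms(2) by (intro sem_None_iff_Psi_Nil \<rho>) simp
      moreover have "fst (mu_approx \<rho> X S (Suc (depth s))) s = None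
          \<longleftrightarrow> snd (mu_approx \<rho> X S (Suc (depth s))) s = []"
        unfolding mu_approx_Suc fst_conv snd_conv
        by (intro sem_None_iff_Psi_Nil fail_agree_mu_approx assms(2) \<rho>)
      ultimately show ?thesis by (simp add: agree_at_def)
    qed
    ultimately show ?thesis by (simp add: agree_at_def)
  qed
  have "Psi_env \<rho> (Mu X S) t = Psi_env (\<rho>(X := mu_approx \<rho> X S (depth t))) S t"
    unfolding Mu_eq_mu_approx[OF assms(2) \<rho>] mu_approx_Suc snd_conv ..
  also have "\<dots> = Psi_env (\<rho>(X := ?m)) S t"
  proof -
    have "agree_at t (sem_env (fst \<circ> \<rho>(X := mu_approx \<rho> X S (depth t))) S, Psi_env (\<rho>(X := mu_approx \<rho> X S (depth t))) S)
      (sem_env (fst \<circ> \<rho>(X := ?m)) S, Psi_env (\<rho>(X := ?m)) S)"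
    proof (rule Psi_env_local)
      fix Y s assume "depth s < depth t \<or> s = t \<and> Y \<in> unguarded S"
      then show "agree_at s ((\<rho>(X := mu_approx \<rho> X S (depth t))) Y) ((\<rho>(X := ?m)) Y)"
        using m[of s] assms(3) by (cases "Y = X") (auto simp: agree_at_def)
    qed
    then show ?thesis by (simp only: agree_at_def snd_conv)
  qed
  also have "\<dots> = Psi_env \<rho> (fsubst X (Mu X S) S) t"
    unfolding Psi_env_fsubst[OF assms(1)] ..
  finally show ?thesis by (simp only: Psi_def \<rho>_def)
qed

section \<open>Position-based strategies as partial maps\<close>

text \<open>This is stronger than well-foundedness: ordering by length fixes a list up to entries of
  equal length, and distinct positions of equal length are parallel. Equality up to \<simeq> thereby
  reduces to equality of the represented maps.\<close>

definition normal :: "'f pstrat \<Rightarrow> bool" where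
  "normal E \<longleftrightarrow> distinct (map fst E) \<and> sorted (map (\<lambda>e. length (fst e)) E)"

lemma normal_Nil [simp]: "normal []"
  by (simp add: normal_def)

lemma normal_arrange: "distinct (map fst E) \<Longrightarrow> normal (arrange E)"
  by (simp add: normal_def arrange_def distinct_map)

lemma map_of_cong_set:
  assumes "distinct (map fst E)" "distinct (map fst F)" "set E = set F"
  shows "map_of E = map_of F"
proof
  fix p show "map_of E p = map_of F p"
    using map_of_eq_Some_iff[OF assms(1), of p] map_of_eq_Some_iff[OF assms(2), of p] assms(3)
    by (cases "map_of E p"; cases "map_of F p") auto
qed

lemma map_of_arrange: "distinct (map fst E) \<Longrightarrow> map_of (arrange E) = map_of E"
  using normal_arrange[of E] by (intro map_of_cong_set) (auto simp: normal_def arrange_def)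

lemma peq_Cons: "E \<simeq> F \<Longrightarrow> x # E \<simeq> x # F"
proof (induction rule: peq.induct)
  case (peq_swap E A e f B)
  then show ?case using peq.peq_swap[of "x # E" "x # A" e f B] by simp
qed (rule peq_refl)

lemma peq_move_right:
  assumes "\<forall>a\<in>set A. parallel (fst e) (fst a)" "E \<simeq> C @ e # A @ B"
  shows "E \<simeq> C @ A @ e # B"
  using assms
proof (induction A arbitrary: C)
  case (Cons a A)
  have "E \<simeq> C @ a # e # A @ B" using Cons.prems by (auto intro: peq_swap[of E C e a])
  then show ?case using Cons.IH[of "C @ [a]"] Cons.prems(1) by simp
qed simp

text \<open>The head of the first list has minimal length, so whatever precedes it in the second
  list has the same length and hence a parallel position; the head is moved across these entries by
  adjacent swaps.\<close>

lemma peq_if_set_eq: "normal E \<Longrightarrow> normal F \<Longrightarrow> set E = set F \<Longrightarrow> E \<simeq> F"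
proof (induction E arbitrary: F)
  case (Cons e E)
  then obtain A B where F: "F = A @ e # B" by (metis list.set_intros(1) split_list)
  have d: "distinct (map fst (e # E))" "distinct (map fst F)" using Cons.prems by (auto simp: normal_def)
  have "E \<simeq> A @ B"
  proof (rule Cons.IH)
    show "normal E" "normal (A @ B)" using Cons.prems(1,2) by (auto simp: normal_def F sorted_append)
    have "set F = insert e (set (A @ B))" "e \<notin> set (A @ B)" "e \<notin> set E"
      using d by (auto simp: F image_iff)
    then show "set E = set (A @ B)" using Cons.prems(3) by auto
  qed
  then have "e # E \<simeq> [] @ e # A @ B" using peq_Cons by simp
  then have "e # E \<simeq> [] @ A @ e # B"
  proof (rule peq_move_right[rotated])
    show "\<forall>a\<in>set A. parallel (fst e) (fst a)"
    proof
      fix a assume a: "a \<in> set A"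
      have "fst e \<notin> fst ` set A" using d(2) by (simp add: F)
      then have "fst a \<noteq> fst e" using a by (metis imageI)
      moreover have "a \<in> set (e # E)" unfolding Cons.prems(3) F using a by simp
      moreover have "length (fst a) \<le> length (fst e)" using Cons.prems(2) a by (auto simp: normal_def F sorted_append)
      ultimately have "length (fst a) = length (fst e)" using Cons.prems(1) by (auto simp: normal_def intro: le_antisym)
      then show "parallel (fst e) (fst a)" using \<open>fst a \<noteq> fst e\<close> by (auto simp: parallel_def prefix_def)
    qed
  qed
  then show ?case by (simp add: F)
qed (auto intro: peq_refl)

lemma peq_if_map_of_eq: "normal E \<Longrightarrow> normal F \<Longrightarrow> map_of E = map_of F \<Longrightarrow> E \<simeq> F"
proof (rule peq_if_set_eq)
  assume *: "normal E" "normal F" "map_of E = map_of F"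
  have "(p, \<tau>) \<in> set E \<longleftrightarrow> (p, \<tau>) \<in> set F" for p \<tau>
    using * map_of_eq_Some_iff[of E p \<tau>] map_of_eq_Some_iff[of F p \<tau>] by (simp add: normal_def)
  then show "set E = set F" by auto
qed

section \<open>The join of partial maps\<close>

definition mjoin :: "('a \<rightharpoonup> 'b list) \<Rightarrow> ('a \<rightharpoonup> 'b list) \<Rightarrow> ('a \<rightharpoonup> 'b list)" where
  "mjoin m m' = (if m = Map.empty \<or> m' = Map.empty then Map.empty else
     (\<lambda>p. case m p of None \<Rightarrow> m' p | Some \<tau> \<Rightarrow> (case m' p of None \<Rightarrow> Some \<tau> | Some \<tau>' \<Rightarrow> Some (\<tau>' @ \<tau>))))"

lemma mjoin_empty [simp]: "mjoin Map.empty m = Map.empty" "mjoin m Map.empty = Map.empty"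
  by (simp_all add: mjoin_def)

lemma map_neq_empty: "m \<noteq> Map.empty \<longleftrightarrow> (\<exists>p x. m p = Some x)"
  by (auto simp: fun_eq_iff)

lemma mjoin_eq_empty_iff [simp]: "mjoin m m' = Map.empty \<longleftrightarrow> m = Map.empty \<or> m' = Map.empty"
proof -
  have "mjoin m m' \<noteq> Map.empty" if m: "m \<noteq> Map.empty" "m' \<noteq> Map.empty"
  proof -
    obtain p \<tau> where "m p = Some \<tau>" using m(1) unfolding map_neq_empty by blast
    then have "mjoin m m' p \<noteq> None" using m by (auto simp: mjoin_def split: option.split)
    then show ?thesis by auto
  qed
  then show ?thesis by auto
qed

lemma map_of_map_key: "map_of (map (\<lambda>(p, \<tau>). (p, f p \<tau>)) E) p = map_option (f p) (map_of E p)"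
  by (induction E) auto

lemma map_of_filter_key: "map_of (filter (\<lambda>(p, \<tau>). P p) E) p = (if P p then map_of E p else None)"
  by (induction E) auto

text \<open>The second part of the list supplies only positions absent from \<open>E\<close>, so all
  keys are distinct and sorting by \<open>arrange\<close> leaves the map unchanged.\<close>

lemma punify:
  assumes "normal E" "normal F"
  shows "normal (E \<sqinter>p F)" "map_of (E \<sqinter>p F) = mjoin (map_of E) (map_of F)"
proof -
  define G where "G = map (\<lambda>(p, \<tau>). (p, case map_of F p of None \<Rightarrow> \<tau> | Some \<tau>' \<Rightarrow> \<tau>' @ \<tau>)) E
      @ filter (\<lambda>(p, \<tau>'). p \<notin> fst ` set E) F"
  have eq: "E \<sqinter>p F = (if E = [] \<or> F = [] then [] else arrange G)" by (simp add: punify_def G_def)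
  have "distinct (map fst (filter P F))" for P
    using assms(2) by (simp add: normal_def distinct_map_filter)
  moreover have "A \<inter> fst ` set (filter (\<lambda>(p, \<tau>'). p \<notin> A) F) = {}" for A
    by auto
  ultimately have d: "distinct (map fst G)"
    using assms(1) by (simp add: normal_def G_def comp_def case_prod_beta)
  show "normal (E \<sqinter>p F)" using d by (simp add: eq normal_arrange)
  have "map_of G p = (case map_of E p of None \<Rightarrow> map_of F p
      | Some \<tau> \<Rightarrow> (case map_of F p of None \<Rightarrow> Some \<tau> | Some \<tau>' \<Rightarrow> Some (\<tau>' @ \<tau>)))" for p
  proof (cases "map_of E p")
    case None
    then have "p \<notin> fst ` set E" by (simp add: map_of_eq_None_iff)
    with None show ?thesis
      unfolding G_def map_of_append map_add_def map_of_map_key map_of_filter_key by (simp split: option.split)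
  next
    case (Some \<tau>)
    then have "p \<in> fst ` set E" by (metis domI dom_map_of_conv_image_fst)
    with Some show ?thesis
      unfolding G_def map_of_append map_add_def map_of_map_key map_of_filter_key by (simp split: option.split)
  qed
  then show "map_of (E \<sqinter>p F) = mjoin (map_of E) (map_of F)"
    using d by (intro ext) (simp add: eq mjoin_def map_of_arrange)
qed

lemma normal_prefix_pos: "normal E \<Longrightarrow> normal (prefix_pos p E)"
proof -
  assume *: "normal E"
  have "map fst (prefix_pos p E) = map ((@) p) (map fst E)"
    by (simp add: prefix_pos_def case_prod_beta)
  moreover have "map (\<lambda>e. length (fst e)) (prefix_pos p E) = map ((+) (length p)) (map (\<lambda>e. length (fst e)) E)"
    by (simp add: prefix_pos_def case_prod_beta)
  ultimately show ?thesis
    using * unfolding normal_def by (simp add: distinct_map inj_on_def sorted_wrt_map del: map_map)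
qed

lemma map_of_prefix_pos:
  "map_of (prefix_pos p E) q = (if prefix p q then map_of E (drop (length p) q) else None)"
  by (induction E) (auto simp: prefix_pos_def prefix_def)

text \<open>A list of entries on a fixed term is represented by the map \<open>c\<close> that takes the position of each
  entry to the map denoted by that entry; since positions have length at most 1, the entry responsible
  for position \<open>q\<close> is the one at \<open>take 1 q\<close>.\<close>

definition brmap :: "(pos \<Rightarrow> (pos \<rightharpoonup> 'b) option) \<Rightarrow> (pos \<rightharpoonup> 'b)" where
  "brmap c = (if \<forall>p m. c p = Some m \<longrightarrow> m \<noteq> Map.empty
     then (\<lambda>q. case c (take 1 q) of None \<Rightarrow> None | Some m \<Rightarrow> m q) else Map.empty)"

text \<open>In contrast to \<open>mjoin\<close> this is not strict: \<open>None\<close> says that a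
  list has no entry at the position, whereas \<open>Some Map.empty\<close> is an entry that
  fails.\<close>

definition cjoin :: "(pos \<Rightarrow> (pos \<rightharpoonup> 'b list) option) \<Rightarrow> (pos \<Rightarrow> (pos \<rightharpoonup> 'b list) option) \<Rightarrow> pos
     \<Rightarrow> (pos \<rightharpoonup> 'b list) option" where
  "cjoin c c' p = (case c p of None \<Rightarrow> c' p
     | Some m \<Rightarrow> (case c' p of None \<Rightarrow> Some m | Some m' \<Rightarrow> Some (mjoin m m')))"

text \<open>The first conjunct keeps out the empty list, whose \<open>brmap\<close> would be empty
  without any failing entry; the second makes the supports of different entries disjoint.\<close>

definition fits :: "(pos \<Rightarrow> (pos \<rightharpoonup> 'b) option) \<Rightarrow> bool" where
  "fits c \<longleftrightarrow> c \<noteq> Map.empty \<and> (\<forall>p m q. c p = Some m \<longrightarrow> m q \<noteq> None \<longrightarrow> take 1 q = p)"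

lemma brmap_eq_empty_iff:
  assumes "fits c"
  shows "brmap c = Map.empty \<longleftrightarrow> (\<exists>p. c p = Some Map.empty)"
proof (cases "\<exists>p. c p = Some Map.empty")
  case False
  obtain p m where p: "c p = Some m" using assms unfolding fits_def map_neq_empty by blast
  then have "m \<noteq> Map.empty" using False by auto
  then obtain q where q: "m q \<noteq> None" unfolding map_neq_empty by blast
  \<comment> \<open>\<open>fits\<close> leads from a position in the support of an entry back to
    that entry, so \<open>brmap\<close> looks up \<open>q\<close> in \<open>m\<close>.\<close>
  then have "take 1 q = p" using p assms unfolding fits_def by blast
  then have "brmap c q \<noteq> None" using False p q by (auto simp: brmap_def)
  then show ?thesis using False by auto
qed (auto simp: brmap_def)

text \<open>A failing entry on either side empties both sides of the equation. If no entry fails,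
  common entries are joins of nonempty maps, and both sides are computed pointwise through the entry
  at \<open>take 1 q\<close>.\<close>

lemma brmap_cjoin:
  assumes "fits c" "fits c'"
  shows "brmap (cjoin c c') = mjoin (brmap c) (brmap c')"
proof (cases "\<exists>p. c p = Some Map.empty \<or> c' p = Some Map.empty")
  case True
  then obtain p where "c p = Some Map.empty \<or> c' p = Some Map.empty" by blast
  then have "cjoin c c' p = Some Map.empty"
    by (cases "c p"; cases "c' p") (auto simp: cjoin_def)
  then have "brmap (cjoin c c') = Map.empty" by (auto simp: brmap_def)
  moreover have "brmap c = Map.empty \<or> brmap c' = Map.empty"
    using True brmap_eq_empty_iff[OF assms(1)] brmap_eq_empty_iff[OF assms(2)] by blast
  ultimately show ?thesis by auto
next
  case False
  have ne: "brmap c \<noteq> Map.empty" "brmap c' \<noteq> Map.empty"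
    using False brmap_eq_empty_iff[OF assms(1)] brmap_eq_empty_iff[OF assms(2)] by blast+
  have "m \<noteq> Map.empty" if "cjoin c c' p = Some m" for p m
    using that False by (cases "c p"; cases "c' p") (auto simp: cjoin_def)
  then have 1: "brmap (cjoin c c') q = (case cjoin c c' (take 1 q) of None \<Rightarrow> None | Some m \<Rightarrow> m q)" for q
    by (simp add: brmap_def)
  have 2: "brmap c q = (case c (take 1 q) of None \<Rightarrow> None | Some m \<Rightarrow> m q)"
    "brmap c' q = (case c' (take 1 q) of None \<Rightarrow> None | Some m \<Rightarrow> m q)" for q
    using False by (auto simp: brmap_def)
  show ?thesis
  proof
    fix q
    have "mjoin m m' q = (case m q of None \<Rightarrow> m' q | Some \<tau> \<Rightarrow> (case m' q of None \<Rightarrow> Some \<tau> | Some \<tau>' \<Rightarrow> Some (\<tau>' @ \<tau>)))"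
      if "c (take 1 q) = Some m" "c' (take 1 q) = Some m'" for m m'
      using that False by (auto simp: mjoin_def)
    then show "brmap (cjoin c c') q = mjoin (brmap c) (brmap c') q"
      using ne unfolding 1 mjoin_def[of "brmap c"] 2 by (auto simp: cjoin_def split: option.split)
  qed
qed

lemma brmap_single:
  assumes "\<And>q. m q \<noteq> None \<Longrightarrow> take 1 q = p"
  shows "brmap [p \<mapsto> m] = m" "fits [p \<mapsto> m]"
proof -
  show "fits [p \<mapsto> m]" using assms by (auto simp: fits_def split: if_splits)
  show "brmap [p \<mapsto> m] = m"
    using assms by (force simp: brmap_def fun_eq_iff)
qed

text \<open>Since \<open>take 1 q\<close> names the entry that \<open>q\<close> comes from, the
  blocks have disjoint keys and a lookup can go straight to the right block.\<close>

lemma concat_entries: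
  assumes "distinct (map fst L)"
    and "\<And>p S. (p, S) \<in> set L \<Longrightarrow> distinct (map fst (f p S)) \<and> (\<forall>q\<in>fst ` set (f p S). take 1 q = p)"
  shows "distinct (map fst (concat (map (\<lambda>(p, S). f p S) L)))
    \<and> (\<forall>q\<in>fst ` set (concat (map (\<lambda>(p, S). f p S) L)). take 1 q \<in> fst ` set L)
    \<and> map_of (concat (map (\<lambda>(p, S). f p S) L)) q
      = (case map_of L (take 1 q) of None \<Rightarrow> None | Some S \<Rightarrow> map_of (f (take 1 q) S) q)"
  using assms
proof (induction L)
  case (Cons e L)
  obtain p S where e: "e = (p, S)" by (cases e)
  let ?G = "concat (map (\<lambda>(p, S). f p S) L)"
  have IH: "distinct (map fst ?G)" "\<forall>q\<in>fst ` set ?G. take 1 q \<in> fst ` set L"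
    "map_of ?G q = (case map_of L (take 1 q) of None \<Rightarrow> None | Some S \<Rightarrow> map_of (f (take 1 q) S) q)"
    using Cons.IH Cons.prems by (auto simp del: set_concat)
  have f: "distinct (map fst (f p S))" "\<forall>q\<in>fst ` set (f p S). take 1 q = p"
    using Cons.prems(2)[of p S] by (auto simp: e)
  have p: "p \<notin> fst ` set L" using Cons.prems(1) by (simp add: e)
  have "distinct (map fst (f p S @ ?G))"
    using IH(1,2) f p by (force simp del: set_concat)
  moreover have "\<forall>q\<in>fst ` set (f p S @ ?G). take 1 q \<in> fst ` set (e # L)"
    using IH(2) f(2) by (auto simp: e simp del: set_concat)
  moreover have "map_of (f p S @ ?G) q
    = (case map_of (e # L) (take 1 q) of None \<Rightarrow> None | Some S \<Rightarrow> map_of (f (take 1 q) S) q)"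
  proof (cases "take 1 q = p")
    case True
    then have "map_of L (take 1 q) = None" using p by (simp add: map_of_eq_None_iff)
    then show ?thesis using True IH(3) by (simp add: e map_add_def split: option.split)
  next
    case False
    then have "map_of (f p S) q = None" using f(2) by (auto simp: map_of_eq_None_iff simp flip: dom_map_of_conv_image_fst)
    then show ?thesis using False IH(3) by (simp add: e map_add_def split: option.split)
  qed
  ultimately show ?case by (simp add: e)
qed simp

section \<open>\<open>\<Psi>\<close> on lists of canonical strategies\<close>

lemma at_pden_Nil [simp]: "at_pden [] e t = e t"
  by (cases t) (simp_all add: at_pden_def prefix_pos_def)

lemma normal_at_pden: "(\<And>t. normal (e t)) \<Longrightarrow> normal (at_pden p e t)"
  by (simp add: at_pden_def normal_prefix_pos)

lemma map_of_at_pden: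
  "map_of (at_pden p e t) q = (if p \<in> poss t \<and> prefix p q then map_of (e (subt_at t p)) (drop (length p) q) else None)"
  by (simp add: at_pden_def map_of_prefix_pos)

text \<open>An entry whose position is missing in \<open>t\<close> becomes
  \<open>Some Map.empty\<close>: it counts as failing and does not disappear from the list.\<close>

definition cmap :: "'f env \<Rightarrow> (pos \<times> 'f strat) list \<Rightarrow> 'f trm \<Rightarrow> pos \<Rightarrow> (pos \<rightharpoonup> 'f tuple) option" where
  "cmap \<rho> L t p = map_option (\<lambda>S. map_of (at_pden p (Psi_env \<rho> S) t)) (map_of L p)"

lemma map_of_eq_empty [simp]: "map_of E = Map.empty \<longleftrightarrow> E = []"
  by (cases E) (auto simp: fun_eq_iff)

text \<open>The formula tests every entry but the one at \<open>[]\<close>. The assumption on that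
  entry makes it succeed and confines it to the root, so that the formula amounts to success of all
  entries and the supports are disjoint.\<close>

lemma Psi_env_Br:
  assumes agree: "fail_agree \<rho>" and cl: "conj_lists (Br L \<phi>)" and d: "distinct (map fst L)"
    and normal: "\<And>p S. (p, S) \<in> set L \<Longrightarrow> normal (at_pden p (Psi_env \<rho> S) t)"
    and eps: "\<And>S. ([], S) \<in> set L \<Longrightarrow> dom (map_of (Psi_env \<rho> S t)) = {[]}"
  shows "normal (Psi_env \<rho> (Br L \<phi>) t)" "map_of (Psi_env \<rho> (Br L \<phi>) t) = brmap (cmap \<rho> L t)"
    "fits (cmap \<rho> L t)"
proof -
  have c: "conj_vars \<phi>" "fvars \<phi> = fst ` set L - {[]}" "\<And>p S. (p, S) \<in> set L \<Longrightarrow> conj_lists S"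
    using cl unfolding conj_lists_Br by auto
  have pos: "p \<in> N_eps" if "p \<in> fst ` set L" for p
    using that conj_vars_N_eps[OF c(1)] c(2) by (auto simp: N_eps_def)
  let ?f = "\<lambda>p S. at_pden p (Psi_env \<rho> S) t"
  let ?E = "concat (map (\<lambda>(p, S). ?f p S) L)"
  \<comment> \<open>A nonempty entry position has length 1 and is the first step of every position
    in its block; the block at \<open>[]\<close> contains only \<open>[]\<close>, and
    \<open>take 1 [] = []\<close>.\<close>
  have tk: "take 1 q = p" if "(p, S) \<in> set L" "q \<in> fst ` set (?f p S)" for p S q
  proof -
    have p: "p = [] \<or> (\<exists>i. p = [i])" using that(1) pos[of p] by (force simp: N_eps_def)
    have q: "map_of (?f p S) q \<noteq> None" using that(2) by (simp add: map_of_eq_None_iff)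
    show ?thesis
    proof (cases "p = []")
      case True
      then have "q \<in> dom (map_of (Psi_env \<rho> S t))" using q by auto
      then show ?thesis using eps[of S] that(1) True by simp
    next
      case False
      then show ?thesis using p q by (auto simp: map_of_at_pden prefix_def split: if_splits)
    qed
  qed
  have df: "distinct (map fst (?f p S)) \<and> (\<forall>q\<in>fst ` set (?f p S). take 1 q = p)" if "(p, S) \<in> set L" for p S
    using normal[OF that] tk[OF that] unfolding normal_def by blast
  note E = concat_entries[of L ?f, OF d df]
  have succ: "models (val_of (map (\<lambda>(p, S). (p, sem_env (fst \<circ> \<rho>) S)) L) t) \<phi>
    \<longleftrightarrow> (\<forall>(p, S)\<in>set L. ?f p S \<noteq> [])"
  proof -
    have "at_den p (sem_env (fst \<circ> \<rho>) S) t = None \<longleftrightarrow> ?f p S = []" if "(p, S) \<in> set L" for p S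
      by (rule at_fail_agree) (rule sem_None_iff_Psi_Nil[OF c(3)[OF that] agree])
    moreover have "?f [] S \<noteq> []" if "([], S) \<in> set L" for S
      using eps[OF that] by auto
    moreover have "(\<forall>p\<in>fst ` set L - {[]}. \<forall>S. (p, S) \<in> set L \<longrightarrow> P p S)
        \<longleftrightarrow> (\<forall>(p, S)\<in>set L. p \<noteq> [] \<longrightarrow> P p S)" for P :: "pos \<Rightarrow> 'a strat \<Rightarrow> bool"
      by (auto simp: rev_image_eqI)
    ultimately show ?thesis
      unfolding models_conj_vars[OF c(1)] c(2) val_of_map by (smt (verit) case_prodI2 case_prodD)
  qed
  have Psi: "Psi_env \<rho> (Br L \<phi>) t = (if \<forall>(p, S)\<in>set L. ?f p S \<noteq> [] then arrange ?E else [])"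
    unfolding Psi_env.simps succ ..
  show "normal (Psi_env \<rho> (Br L \<phi>) t)"
    unfolding Psi using E normal_arrange[of ?E] by simp
  have all: "(\<forall>p m. cmap \<rho> L t p = Some m \<longrightarrow> m \<noteq> Map.empty) \<longleftrightarrow> (\<forall>(p, S)\<in>set L. ?f p S \<noteq> [])"
  proof -
    have iff: "cmap \<rho> L t p = Some m \<longleftrightarrow> (\<exists>S. (p, S) \<in> set L \<and> m = map_of (?f p S))" for p m
      by (auto simp: cmap_def map_of_eq_Some_iff[OF d])
    show ?thesis
    proof
      assume l: "\<forall>p m. cmap \<rho> L t p = Some m \<longrightarrow> m \<noteq> Map.empty"
      have "?f p S \<noteq> []" if "(p, S) \<in> set L" for p S
      proof -
        have "cmap \<rho> L t p = Some (map_of (?f p S))" using iff that by blast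
        then have "map_of (?f p S) \<noteq> Map.empty" using l by blast
        then show ?thesis by simp
      qed
      then show "\<forall>(p, S)\<in>set L. ?f p S \<noteq> []" by blast
    next
      assume r: "\<forall>(p, S)\<in>set L. ?f p S \<noteq> []"
      have "m \<noteq> Map.empty" if m: "cmap \<rho> L t p = Some m" for p m
      proof -
        obtain S where S: "(p, S) \<in> set L" "m = map_of (?f p S)" using m unfolding iff by blast
        then show ?thesis using r by auto
      qed
      then show "\<forall>p m. cmap \<rho> L t p = Some m \<longrightarrow> m \<noteq> Map.empty" by blast
    qed
  qed
  show "map_of (Psi_env \<rho> (Br L \<phi>) t) = brmap (cmap \<rho> L t)"
  proof (cases "\<forall>(p, S)\<in>set L. ?f p S \<noteq> []")
    case True
    have "map_of ?E q = brmap (cmap \<rho> L t) q" for q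
    proof -
      have "brmap (cmap \<rho> L t) q = (case cmap \<rho> L t (take 1 q) of None \<Rightarrow> None | Some m \<Rightarrow> m q)"
        unfolding brmap_def all by (subst if_P[OF True]) (rule refl)
      also have "\<dots> = map_of ?E q"
        using E[of q] by (simp add: cmap_def split: option.split)
      finally show ?thesis ..
    qed
    moreover have "map_of (arrange ?E) = map_of ?E" using E by (intro map_of_arrange) blast
    moreover have "Psi_env \<rho> (Br L \<phi>) t = arrange ?E" unfolding Psi by (subst if_P[OF True]) (rule refl)
    ultimately show ?thesis by (simp only: ext)
  next
    case False
    show ?thesis unfolding Psi brmap_def all by (subst (1 2) if_not_P[OF False]) simp
  qed
  show "fits (cmap \<rho> L t)"
  proof -
    obtain p where "p \<in> fst ` set L" using conj_vars_nonempty[OF c(1)] c(2) by blast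
    then have "cmap \<rho> L t p \<noteq> None" by (simp add: cmap_def map_of_eq_None_iff)
    then have "cmap \<rho> L t \<noteq> Map.empty" by auto
    moreover have "take 1 q = p" if p: "cmap \<rho> L t p = Some m" and m: "m q \<noteq> None" for p m q
    proof -
      obtain S where S: "map_of L p = Some S" "m = map_of (?f p S)" using p by (auto simp: cmap_def)
      then have "(p, S) \<in> set L" "q \<in> fst ` set (?f p S)"
        using m by (auto simp: map_of_SomeD map_of_eq_None_iff)
      then show ?thesis by (rule tk)
    qed
    ultimately show ?thesis unfolding fits_def by blast
  qed
qed

text \<open>The part of \<open>C_can\<close> that is carried through unfoldings. Entries at
  \<open>[]\<close> are required to be insertions, which succeed on every term, because no variable
  of the formula tests them.\<close>

fun regular :: "'f strat \<Rightarrow> bool" where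
  "regular (Cond u S) = regular S"
| "regular (Choice S T) = (regular S \<and> regular T)"
| "regular (Mu X S) = (X \<notin> unguarded S \<and> regular S)"
| "regular (At p S) = regular S"
| "regular (Br L \<phi>) = (distinct (map fst L) \<and> conj_vars \<phi> \<and> fvars \<phi> = fst ` set L - {[]} \<and>
     (\<forall>S. ([], S) \<in> set L \<longrightarrow> is_ins S) \<and> list_all id (map (\<lambda>(p, S). regular S) L))"
| "regular _ = True"

lemma regular_Br:
  "regular (Br L \<phi>) \<longleftrightarrow> distinct (map fst L) \<and> conj_vars \<phi> \<and> fvars \<phi> = fst ` set L - {[]} \<and>
     (\<forall>S. ([], S) \<in> set L \<longrightarrow> is_ins S) \<and> (\<forall>(p, S)\<in>set L. regular S)"
  by (simp add: list_all_iff case_prod_beta)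

lemma regular_conj_lists: "regular S \<Longrightarrow> conj_lists S"
proof (induction S)
  case (Br L \<phi>)
  then show ?case unfolding regular_Br conj_lists_Br by fastforce
qed auto

lemma is_insE: "is_ins S \<Longrightarrow> (\<And>\<tau>. S = AtI [] \<tau> \<Longrightarrow> P) \<Longrightarrow> P"
  by (cases S) auto

text \<open>No position lies before the root in \<open>\<sqsubset>p\<close>, and none is parallel to
  it, so an entry at the root that is not an insertion would have to be the only entry of the
  list.\<close>

lemma wf_entries_eps:
  assumes "wf_entries L" "([], S) \<in> set L" "fst ` set L - {[]} \<noteq> {}"
  shows "is_ins S"
proof (rule ccontr)
  assume n: "\<not> is_ins S"
  obtain A B where L: "L = A @ B" and B: "\<forall>(q, S)\<in>set B. is_ins S" and A: "sorted_wrt parallel (map fst A)"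
    and AB: "\<forall>q\<in>fst ` set B. \<forall>p\<in>fst ` set A. q \<sqsubset>p p"
    using assms(1) unfolding wf_entries_def by blast
  have S: "([], S) \<in> set A" using assms(2) B n by (auto simp: L)
  then have "[] \<in> fst ` set A" by force
  moreover have "\<not> q \<sqsubset>p []" for q by (simp add: sqsub_def parallel_def)
  ultimately have "b \<notin> set B" for b using AB by (metis imageI)
  then have "B = []" by (cases B) auto
  moreover have "fst ` set A \<subseteq> {[]}"
  proof -
    obtain A1 A2 where A12: "A = A1 @ ([], S) # A2" using S by (meson split_list)
    have "A1 = [] \<and> A2 = []" using A unfolding A12
      by (cases A1; cases A2) (auto simp: sorted_wrt_append)
    then show ?thesis by (simp add: A12)
  qed
  ultimately show False using assms(3) by (auto simp: L)
qed

lemma regular_C_can: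
  assumes "S \<in> C_can ar"
  shows "regular S"
proof -
  have *: "regular S" if "\<forall>X T. Mu X T \<in> subs S \<longrightarrow> X \<notin> unguarded T"
    "\<forall>L \<phi>. Br L \<phi> \<in> subs S \<longrightarrow> conj_vars \<phi> \<and> fvars \<phi> = fst ` set L - {[]} \<and> wf_entries L" for S :: "'a strat"
    using that
  proof (induction S)
    case (Br L \<phi>)
    have L: "conj_vars \<phi>" "fvars \<phi> = fst ` set L - {[]}" "wf_entries L" using Br.prems(2) by auto
    have "regular S" if "(p, S) \<in> set L" for p S
    proof (rule Br.IH[of "(p, S)" S])
      have sub: "subs S \<subseteq> subs (Br L \<phi>)" using that by fastforce
      show "\<forall>X T. Mu X T \<in> subs S \<longrightarrow> X \<notin> unguarded T" using Br.prems(1) sub by blast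
      show "\<forall>L \<phi>. Br L \<phi> \<in> subs S \<longrightarrow> conj_vars \<phi> \<and> fvars \<phi> = fst ` set L - {[]} \<and> wf_entries L"
        using Br.prems(2) sub by blast
    qed (use that in auto)
    then show ?case
      using L wf_entries_distinct[OF L(3)] wf_entries_eps[OF L(3)] conj_vars_nonempty[OF L(1)]
      unfolding regular_Br by auto
  next
    case (Choice S T)
    have sub: "subs S \<subseteq> subs (Choice S T)" "subs T \<subseteq> subs (Choice S T)" by auto
    have "regular S" by (rule Choice.IH(1)) (use Choice.prems sub(1) in blast)+
    moreover have "regular T" by (rule Choice.IH(2)) (use Choice.prems sub(2) in blast)+
    ultimately show ?case by simp
  qed auto
  show ?thesis
    using assms by (intro *) (auto simp: C_can_def ce_strategy_def canonical_def)
qed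

lemma normal_foldr: "(\<And>i. normal (f i)) \<Longrightarrow> normal (foldr (\<lambda>i. porelse (f i)) is [])"
proof (induction "is")
  case (Cons i "is")
  then show ?case by (cases "f i") (simp_all, metis)
qed simp

lemma normal_Psi_env:
  assumes "regular S" "fail_agree \<rho>" "\<And>X t. normal (snd (\<rho> X) t)"
  shows "normal (Psi_env \<rho> S t)"
  using assms
proof (induction S arbitrary: \<rho> t)
  case (Choice S T)
  then have "normal (Psi_env \<rho> S t)" "normal (Psi_env \<rho> T t)" by auto
  then show ?case by (cases "Psi_env \<rho> S t") auto
next
  case (CondI u \<tau>)
  then show ?case by (simp add: normal_def)
next
  case (Mu X S)
  have "normal (snd (mu_approx \<rho> X S i) t)" for i t
  proof (induction i arbitrary: t)
    case (Suc i)
    have "fail_agree (\<rho>(X := mu_approx \<rho> X S i))"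
      using Mu.prems by (intro fail_agree_mu_approx regular_conj_lists) auto
    moreover have "normal (snd ((\<rho>(X := mu_approx \<rho> X S i)) Y) t)" for Y t
      using Mu.prems(3) Suc by (cases "Y = X") auto
    ultimately show ?case unfolding mu_approx_Suc snd_conv
      using Mu.prems(1) by (intro Mu.IH) (simp_all del: fun_upd_apply)
  qed simp
  then show ?case unfolding Psi_env_Mu by (intro normal_foldr)
next
  case (At p S)
  then show ?case by (simp add: normal_at_pden)
next
  case (AtI p \<tau>)
  then show ?case by (simp add: normal_at_pden normal_def[of "[_]"])
next
  case (Br L \<phi>)
  have c: "distinct (map fst L)" "\<And>S. ([], S) \<in> set L \<Longrightarrow> is_ins S" "\<And>p S. (p, S) \<in> set L \<Longrightarrow> regular S"
    using Br.prems(1) unfolding regular_Br by auto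
  show ?case
  proof (rule Psi_env_Br(1)[OF Br.prems(2) regular_conj_lists[OF Br.prems(1)] c(1)])
    show "normal (at_pden p (Psi_env \<rho> S) t)" if "(p, S) \<in> set L" for p S
      using that c(3) Br.prems Br.IH[of "(p, S)" S \<rho>] by (intro normal_at_pden) auto
    show "dom (map_of (Psi_env \<rho> S t)) = {[]}" if "([], S) \<in> set L" for S
      using c(2)[OF that] by (elim is_insE) simp
  qed
qed auto

abbreviation env0 :: "'f env" where
  "env0 \<equiv> \<lambda>_. (\<lambda>_. None, \<lambda>_. [])"

lemma fail_agree_env0: "fail_agree env0"
  by (simp add: fail_agree_def)

lemma normal_Psi: "regular S \<Longrightarrow> normal (Psi S t)"
  unfolding Psi_def by (intro normal_Psi_env fail_agree_env0) simp_all

lemma Psi_env_closed: "fv S = {} \<Longrightarrow> Psi_env \<rho> S = Psi S"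
  unfolding Psi_def by (intro Psi_env_cong) simp

lemma Psi_simps:
  "Psi Fail t = []"
  "Psi (Cond u S) t = (if matches u t then Psi S t else [])"
  "Psi (Choice S T) t = porelse (Psi S t) (Psi T t)"
  "Psi (CondI u \<tau>) t = (if matches u t then [([], \<tau>)] else [])"
  "Psi (At p S) t = at_pden p (Psi S) t"
  "Psi (AtI p \<tau>) t = at_pden p (\<lambda>_. [([], \<tau>)]) t"
  by (simp_all add: Psi_def)

lemma Nil_in_poss [simp]: "[] \<in> poss t"
  by (cases t) auto

lemma poss_append: "p @ q \<in> poss t \<longleftrightarrow> p \<in> poss t \<and> q \<in> poss (subt_at t p)"
  by (induction t p rule: subt_at.induct) (auto simp: image_iff)

lemma subt_at_append: "p \<in> poss t \<Longrightarrow> subt_at t (p @ q) = subt_at (subt_at t p) q"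
  by (induction t p rule: subt_at.induct) auto

lemma at_pden_append: "at_pden (p @ q) e t = at_pden p (at_pden q e) t"
  by (auto simp: at_pden_def poss_append subt_at_append prefix_pos_def)

section \<open>Guardedness of unification results\<close>

abbreviation adm :: "'f strat \<Rightarrow> bool" where
  "adm S \<equiv> fv S = {} \<and> regular S"

text \<open>Counts the binders that can be unfolded without descending in the term. Lists count 0:
  in a regular list the entries at \<open>[]\<close> are insertions and all others are
  guarded.\<close>

fun mu_height :: "'f strat \<Rightarrow> nat" where
  "mu_height (Cond u S) = mu_height S"
| "mu_height (Choice S T) = mu_height S + mu_height T"
| "mu_height (Mu X S) = Suc (mu_height S)"
| "mu_height (At p S) = (if p = [] then mu_height S else 0)"
| "mu_height _ = 0"

lemma unguarded_subset_fv: "unguarded S \<subseteq> fv S"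
  by (induction S) (auto split: if_splits, fastforce)

lemma unguarded_fsubst: "fv T = {} \<Longrightarrow> unguarded (fsubst X T S) \<subseteq> unguarded S"
proof (induction S)
  case (FVar Y)
  then show ?case using unguarded_subset_fv[of T] by auto
next
  case (Br L \<phi>)
  show ?case
  proof
    fix Y assume "Y \<in> unguarded (fsubst X T (Br L \<phi>))"
    then obtain S where S: "([], S) \<in> set L" "Y \<in> unguarded (fsubst X T S)"
      by (auto split: if_splits)
    then have "Y \<in> unguarded S" using Br.IH[of "([], S)" S] Br.prems by auto
    then show "Y \<in> unguarded (Br L \<phi>)" using S(1) by (force intro!: bexI[of _ "([], S)"])
  qed
qed auto

lemma is_ins_fsubst: "is_ins S \<Longrightarrow> is_ins (fsubst X T S)"
  by (cases S) auto

lemma fst_set_map_snd: "fst ` set (map (\<lambda>(p, S). (p, f S)) L) = fst ` set L"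
  by (force simp: image_iff)

lemma map_fst_map_snd: "map fst (map (\<lambda>(p, S). (p, f S)) L) = map fst L"
  by (induction L) auto

lemma regular_fsubst: "fv T = {} \<Longrightarrow> regular T \<Longrightarrow> regular S \<Longrightarrow> regular (fsubst X T S)"
proof (induction S)
  case (Mu Y S)
  then show ?case using unguarded_fsubst[of T X S] by auto
next
  case (Br L \<phi>)
  have "regular (fsubst X T S)" if "(p, S) \<in> set L" for p S
    using that Br.prems unfolding regular_Br by (intro Br.IH[of "(p, S)" S]) auto
  moreover have "is_ins (fsubst X T S)" if "([], S) \<in> set L" for S
    using that Br.prems(3) unfolding regular_Br by (simp add: is_ins_fsubst)
  ultimately show ?case
    using Br.prems(3) unfolding fsubst.simps regular_Br fst_set_map_snd map_fst_map_snd by auto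
qed auto

text \<open>The substitution acts only where \<open>mu_height\<close> no longer counts: below a
  nonempty position or inside a list.\<close>

lemma mu_height_fsubst: "X \<notin> unguarded S \<Longrightarrow> mu_height (fsubst X T S) = mu_height S"
  by (induction S) auto

text \<open>Everything needed about unfolding. The height drops because the outer binder is removed
  and its new copies are all guarded.\<close>

lemma Mu_unfold:
  assumes "adm (Mu X S)"
  shows "adm (fsubst X (Mu X S) S)" "mu_height (fsubst X (Mu X S) S) < mu_height (Mu X S)"
    "Psi (Mu X S) = Psi (fsubst X (Mu X S) S)"
proof -
  have *: "fv (Mu X S) = {}" "regular (Mu X S)" "regular S" "X \<notin> unguarded S" using assms by auto
  show "adm (fsubst X (Mu X S) S)"
    using regular_fsubst[OF *(1-3), of X] fv_fsubst[OF *(1), of X S] *(1) by simp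
  show "mu_height (fsubst X (Mu X S) S) < mu_height (Mu X S)"
    using mu_height_fsubst[OF *(4), of "Mu X S"] by simp
  show "Psi (Mu X S) = Psi (fsubst X (Mu X S) S)"
    using Psi_unfold[OF *(1) regular_conj_lists[OF *(3)] *(4)] by auto
qed

definition adm_list :: "(pos \<times> 'f strat) list \<Rightarrow> bool" where
  "adm_list L \<longleftrightarrow> distinct (map fst L) \<and> (\<forall>(p, S)\<in>set L. adm S \<and> (p = [] \<longrightarrow> is_ins S))"

lemma adm_list_Br: "adm (Br L \<phi>) \<Longrightarrow> adm_list L"
  unfolding adm_list_def regular_Br by auto

lemma adm_list_single: "adm S \<Longrightarrow> (i = [] \<Longrightarrow> is_ins S) \<Longrightarrow> adm_list [(i, S)]"
  by (simp add: adm_list_def)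

lemma set_order_entries [simp]: "set (order_entries L) = set L"
  by (auto simp: order_entries_def)

lemma distinct_order_entries: "distinct (map fst L) \<Longrightarrow> distinct (map fst (order_entries L))"
  by (auto simp: order_entries_def distinct_map_filter comp_def distinct_map inj_on_def)

text \<open>The height bound separates the labels of pairs that may still recur without descending
  from those of heavier pairs recorded on the way.\<close>

definition labelled :: "(('f strat \<times> 'f strat) \<times> nat) set \<Rightarrow> nat \<Rightarrow> nat \<Rightarrow> bool" where
  "labelled \<Gamma> n Z \<longleftrightarrow> (\<exists>A B. ((A, B), Z) \<in> \<Gamma> \<and> mu_height A + mu_height B \<le> n)"

lemma labelled_mono: "labelled \<Gamma> m Z \<Longrightarrow> m \<le> n \<Longrightarrow> labelled \<Gamma> n Z"
  unfolding labelled_def by fastforce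

lemma labelled_insert:
  assumes "labelled (insert ((A, B), Z) \<Gamma>) n Z'" "n < mu_height A + mu_height B"
  shows "labelled \<Gamma> n Z'"
  using assms unfolding labelled_def by auto

text \<open>An unguarded label stems from a use of \<open>mu_hyp\<close> reached without passing a
  nonempty position. Along such a path the sum of the heights never increases, and every unfolding
  strictly decreases it, so the label is not that of a pair recorded on the path.
  \<open>Br K FTrue\<close> serves to apply \<open>unguarded\<close> to a list of entries.\<close>

lemma unguarded_unif:
  "unif \<Gamma> S S' R \<Longrightarrow> adm S \<Longrightarrow> adm S' \<Longrightarrow> Z \<in> unguarded R \<Longrightarrow> labelled \<Gamma> (mu_height S + mu_height S') Z"
  "unif_entries \<Gamma> L L' K \<Longrightarrow> adm_list L \<Longrightarrow> adm_list L' \<Longrightarrow> Z \<in> unguarded (Br K FTrue) \<Longrightarrow> labelled \<Gamma> 0 Z"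
proof (induction rule: unif_unif_entries.inducts)
  case (mu_mu Y \<Gamma> X S X' S' R)
  note M = Mu_unfold[OF mu_mu.prems(1)] Mu_unfold[OF mu_mu.prems(2)]
  \<comment> \<open>The recorded pair is strictly heavier than its unfolding, so
    \<open>labelled_insert\<close> excludes its label.\<close>
  have "labelled \<Gamma> (mu_height (fsubst X (Mu X S) S) + mu_height (fsubst X' (Mu X' S') S')) Z"
    using mu_mu M by (intro labelled_insert[OF mu_mu.IH]) auto
  then show ?case by (rule labelled_mono) (use M in simp)
next
  case (mu_l T X S \<Gamma> R)
  note M = Mu_unfold[OF mu_l.prems(1)]
  show ?case by (rule labelled_mono[OF mu_l.IH]) (use M mu_l.prems in simp_all)
next
  case (mu_r T \<Gamma> X S R)
  note M = Mu_unfold[OF mu_r.prems(2)]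
  show ?case by (rule labelled_mono[OF mu_r.IH]) (use M mu_r.prems in simp_all)
next
  case (mu_rec_l T Y \<Gamma> X S R)
  note M = Mu_unfold[OF mu_rec_l.prems(1)]
  have "labelled \<Gamma> (mu_height (fsubst X (Mu X S) S) + mu_height T) Z"
    using mu_rec_l M by (intro labelled_insert[OF mu_rec_l.IH]) auto
  then show ?case by (rule labelled_mono) (use M in simp)
next
  case (mu_rec_r T Y \<Gamma> X S R)
  note M = Mu_unfold[OF mu_rec_r.prems(2)]
  have "labelled \<Gamma> (mu_height T + mu_height (fsubst X (Mu X S) S)) Z"
    using mu_rec_r M by (intro labelled_insert[OF mu_rec_r.IH]) auto
  then show ?case by (rule labelled_mono) (use M in simp)
next
  case (mu_hyp S S' Y \<Gamma>)
  then show ?case by (auto simp: labelled_def)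
next
  case (choice_l \<Gamma> S1 T R1 S2 R2)
  then have "labelled \<Gamma> (mu_height S1 + mu_height T) Z \<or> labelled \<Gamma> (mu_height S2 + mu_height T) Z" by auto
  then show ?case by (elim disjE labelled_mono) simp_all
next
  case (choice_r \<Gamma> T S1 R1 S2 R2)
  then have "labelled \<Gamma> (mu_height T + mu_height S1) Z \<or> labelled \<Gamma> (mu_height T + mu_height S2) Z" by auto
  then show ?case by (elim disjE labelled_mono) simp_all
next
  case (entries K L' L \<Gamma>)
  have ins: "unguarded S = {}" if "([], S) \<in> set L \<union> set L'" for S
    using that entries.prems unfolding adm_list_def by (auto elim!: is_insE)
  \<comment> \<open>Only entries at \<open>[]\<close> matter; those copied from one side are
    insertions, so the label must come from a common entry.\<close>
  obtain R where R: "([], R) \<in> set K" "Z \<in> unguarded R"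
    using entries.prems(3) ins by (auto split: if_splits)
  have "[] \<in> fst ` set K" using R(1) by force
  then have "[] \<in> set (map fst K)" by simp
  then have "[] \<in> fst ` set L" "[] \<in> fst ` set L'" unfolding entries.hyps(1) by auto
  then obtain S S' where S: "([], S) \<in> set L" "([], S') \<in> set L'" by auto
  then have "is_ins S" "is_ins S'" "adm S" "adm S'" using entries.prems unfolding adm_list_def by auto
  then show ?case using entries.IH[OF S R(1)] R(2) by (auto elim!: is_insE)
next
  case (ins_ins i j \<Gamma> \<tau> \<tau>')
  then show ?case by (auto simp: two_entries_def split: if_splits)
next
  case (ins_at i j \<Gamma> \<tau> S)
  then show ?case by (auto simp: two_entries_def split: if_splits)
next
  case (at_ins i j \<Gamma> S \<tau>)
  then show ?case by (auto simp: two_entries_def split: if_splits)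
next
  case (at_at i j \<Gamma> S S')
  then show ?case by (auto simp: two_entries_def split: if_splits)
next
  case (br_br \<Gamma> L L' K \<phi> \<phi>')
  then show ?case using adm_list_Br[of L \<phi>] adm_list_Br[of L' \<phi>'] by simp
next
  case (at_br i \<Gamma> S L' K \<phi>')
  then show ?case using adm_list_Br[of L' \<phi>'] adm_list_single[of S i] by simp
next
  case (br_at i \<Gamma> L S K \<phi>)
  then show ?case using adm_list_Br[of L \<phi>] adm_list_single[of S i] by simp
next
  case (ins_br i \<Gamma> \<tau> L' K \<phi>')
  then show ?case using adm_list_Br[of L' \<phi>'] adm_list_single[of "AtI [] \<tau>" i] by simp
next
  case (br_ins i \<Gamma> L \<tau> K \<phi>)
  then show ?case using adm_list_Br[of L \<phi>] adm_list_single[of "AtI [] \<tau>" i] by simp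
qed (auto split: if_splits)

text \<open>This makes the facts on failure and iterates available for \<open>R\<close>, which may
  contain free labels. Positions of lists are tracked because the combined formula has to mention
  all of them except the root.\<close>

lemma conj_lists_unif:
  "unif \<Gamma> S S' R \<Longrightarrow> adm S \<Longrightarrow> adm S' \<Longrightarrow> conj_lists R"
  "unif_entries \<Gamma> L L' K \<Longrightarrow> adm_list L \<Longrightarrow> adm_list L' \<Longrightarrow>
    fst ` set K = fst ` set L \<union> fst ` set L' \<and> (\<forall>(p, S)\<in>set K. conj_lists S)"
proof (induction rule: unif_unif_entries.inducts)
  case (mu_mu Y \<Gamma> X S X' S' R)
  then show ?case using Mu_unfold[OF mu_mu.prems(1)] Mu_unfold[OF mu_mu.prems(2)] by simp
next
  case (mu_l T X S \<Gamma> R)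
  then show ?case using Mu_unfold[OF mu_l.prems(1)] by simp
next
  case (mu_r T \<Gamma> X S R)
  then show ?case using Mu_unfold[OF mu_r.prems(2)] by simp
next
  case (mu_rec_l T Y \<Gamma> X S R)
  then show ?case using Mu_unfold[OF mu_rec_l.prems(1)] by simp
next
  case (mu_rec_r T Y \<Gamma> X S R)
  then show ?case using Mu_unfold[OF mu_rec_r.prems(2)] by simp
next
  case (entries K L' L \<Gamma>)
  let ?K = "order_entries (K @ filter (\<lambda>(i, S). i \<notin> fst ` set L') L @ filter (\<lambda>(i, S). i \<notin> fst ` set L) L')"
  have K: "fst ` set K = fst ` set L \<inter> fst ` set L'"
    using arg_cong[OF entries.hyps(1), of set] by auto
  have "fst ` set (filter (\<lambda>(i, S). i \<notin> A) M) = fst ` set M - A" for A and M :: "(pos \<times> 'a strat) list"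
    by (force simp: image_iff)
  then have "fst ` set ?K = fst ` set L \<union> fst ` set L'"
    unfolding set_order_entries set_append image_Un K by auto
  moreover have "conj_lists S" if "(p, S) \<in> set L \<union> set L'" for p S
    using that entries.prems unfolding adm_list_def by (auto intro: regular_conj_lists)
  moreover have "conj_lists R" if R: "(p, R) \<in> set K" for p R
  proof -
    have "p \<in> fst ` set L" "p \<in> fst ` set L'" using K R by force+
    then obtain S S' where S: "(p, S) \<in> set L" "(p, S') \<in> set L'" by auto
    then have "adm S" "adm S'" using entries.prems unfolding adm_list_def by auto
    then show ?thesis using entries.IH[OF S R] by simp
  qed
  ultimately show ?case by auto
next
  case (ins_ins i j \<Gamma> \<tau> \<tau>')
  then show ?case by (auto simp: two_entries_def conj_lists_Br simp del: conj_lists.simps(5))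
next
  case (ins_at i j \<Gamma> \<tau> S)
  then show ?case by (auto simp: two_entries_def conj_lists_Br regular_conj_lists simp del: conj_lists.simps(5))
next
  case (at_ins i j \<Gamma> S \<tau>)
  then show ?case by (auto simp: two_entries_def conj_lists_Br regular_conj_lists simp del: conj_lists.simps(5))
next
  case (at_at i j \<Gamma> S S')
  then show ?case by (auto simp: two_entries_def conj_lists_Br regular_conj_lists simp del: conj_lists.simps(5))
next
  case (br_br \<Gamma> L L' K \<phi> \<phi>')
  then show ?case using adm_list_Br[of L \<phi>] adm_list_Br[of L' \<phi>'] unfolding conj_lists_Br regular_Br by auto
next
  case (at_br i \<Gamma> S L' K \<phi>')
  then show ?case using adm_list_Br[of L' \<phi>'] adm_list_single[of S i] unfolding conj_lists_Br regular_Br by auto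
next
  case (br_at i \<Gamma> L S K \<phi>)
  then show ?case using adm_list_Br[of L \<phi>] adm_list_single[of S i] unfolding conj_lists_Br regular_Br by auto
next
  case (ins_br i \<Gamma> \<tau> L' K \<phi>')
  then show ?case using adm_list_Br[of L' \<phi>'] adm_list_single[of "AtI [] \<tau>" i] unfolding conj_lists_Br regular_Br by auto
next
  case (br_ins i \<Gamma> L \<tau> K \<phi>)
  then show ?case using adm_list_Br[of L \<phi>] adm_list_single[of "AtI [] \<tau>" i] unfolding conj_lists_Br regular_Br by auto
qed auto

section \<open>Meets of patterns\<close>

lemma renamed_apart_subst:
  assumes "renamed_apart u u' v" "subst \<sigma> u = t" "subst \<sigma>' u' = t"
  shows "\<exists>\<rho>. subst \<rho> u = t \<and> subst \<rho> v = t"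
proof -
  obtain \<pi> where \<pi>: "inj \<pi>" "v = subst (\<lambda>x. Var (\<pi> x)) u'" "vars u \<inter> vars v = {}"
    using assms(1) unfolding renamed_apart_def by blast
  \<comment> \<open>On \<open>vars u\<close> this is \<sigma>; on the disjoint variables of
    \<open>v\<close> the renaming is undone before \<sigma>' is applied.\<close>
  define \<rho> where "\<rho> x = (if x \<in> vars u then \<sigma> x else \<sigma>' (inv \<pi> x))" for x
  have "subst \<rho> u = t" unfolding assms(2)[symmetric] by (rule subst_cong) (simp add: \<rho>_def)
  moreover have "subst \<rho> v = subst (\<lambda>x. subst \<rho> (Var (\<pi> x))) u'" unfolding \<pi>(2) by (rule subst_subst)
  moreover have "subst (\<lambda>x. subst \<rho> (Var (\<pi> x))) u' = subst \<sigma>' u'"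
  proof (rule subst_cong)
    fix x assume "x \<in> vars u'"
    then have "\<pi> x \<in> vars v" unfolding \<pi>(2) by (auto simp: vars_subst)
    then have "\<pi> x \<notin> vars u" using \<pi>(3) by auto
    then show "subst \<rho> (Var (\<pi> x)) = \<sigma>' x" using \<pi>(1) by (simp add: \<rho>_def)
  qed
  ultimately show ?thesis using assms(3) by metis
qed

lemma renamed_apart_matches: "renamed_apart u u' v \<Longrightarrow> matches v t \<Longrightarrow> matches u' t"
  unfolding renamed_apart_def matches_def by (auto simp: subst_subst)

lemma matches_subst: "matches (subst \<gamma> u) t \<Longrightarrow> matches u t"
  unfolding matches_def by (auto simp: subst_subst)

text \<open>The meet is an instance of \<open>u\<close> and of the renamed \<open>u'\<close>.
  Conversely, a common instance yields a unifier of the renamed pair, which factors through the most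
  general one.\<close>

lemma matches_meet:
  assumes "is_meet u u' w"
  shows "matches w t \<longleftrightarrow> matches u t \<and> matches u' t"
proof -
  obtain v \<gamma> where v: "renamed_apart u u' v" "is_mgu \<gamma> u v" "w = subst \<gamma> u"
    using assms unfolding is_meet_def by blast
  have w: "w = subst \<gamma> v" using v(2,3) by (simp add: is_mgu_def)
  show ?thesis
  proof
    assume "matches w t"
    then show "matches u t \<and> matches u' t"
      using matches_subst[of \<gamma> u t] matches_subst[of \<gamma> v t] renamed_apart_matches[OF v(1)] v(3) w by simp
  next
    assume "matches u t \<and> matches u' t"
    then obtain \<rho> where \<rho>: "subst \<rho> u = t" "subst \<rho> v = t"
      using renamed_apart_subst[OF v(1)] unfolding matches_def by blast
    then obtain \<theta> where "\<forall>x. \<rho> x = subst \<theta> (\<gamma> x)"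
      using v(2) unfolding is_mgu_def by metis
    then have "\<rho> = (\<lambda>x. subst \<theta> (\<gamma> x))" by (intro ext) simp
    then have "subst \<theta> w = t" using \<rho>(1) by (simp add: v(3) subst_subst)
    then show "matches w t" unfolding matches_def by blast
  qed
qed

lemma renamed_apart_exists: "\<exists>v. renamed_apart u u' v"
proof -
  \<comment> \<open>Shifting by a number beyond all variables of \<open>u\<close> makes the renaming
    disjoint; \<open>insert 0\<close> provides a maximum when \<open>u\<close> is ground.\<close>
  define n where "n = Suc (Max (insert 0 (vars u)))"
  have "x < n" if "x \<in> vars u" for x
    using that finite_vars[of u] by (simp add: n_def less_Suc_eq_le)
  then have "vars u \<inter> vars (subst (\<lambda>x. Var (x + n)) u') = {}"
    by (fastforce simp: vars_subst)
  then show ?thesis unfolding renamed_apart_def by (intro exI[of _ "subst (\<lambda>x. Var (x + n)) u'"] exI[of _ "\<lambda>x. x + n"]) auto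
qed

lemma not_unifiable_matches: "\<not> unifiable u u' \<Longrightarrow> \<not> (matches u t \<and> matches u' t)"
  using renamed_apart_exists[of u u'] renamed_apart_subst[of u u']
  unfolding unifiable_def matches_def by metis

text \<open>A variable pattern admits all of \<open>N_eps\<close>, so \<open>u\<close> has a root
  symbol, and a term matched by \<open>u\<close> has as many arguments as \<open>u\<close>.\<close>

lemma not_arg_pos: "i \<in> N_eps \<Longrightarrow> \<not> arg_pos u i \<Longrightarrow> matches u t \<Longrightarrow> i \<notin> poss t"
  by (cases u) (auto simp: N_eps_def matches_def)

section \<open>Correctness of unification\<close>

definition is_join :: "'f pstrat \<Rightarrow> 'f strat \<Rightarrow> 'f strat \<Rightarrow> 'f trm \<Rightarrow> bool" where
  "is_join E A B t \<longleftrightarrow> normal E \<and> map_of E = mjoin (map_of (Psi A t)) (map_of (Psi B t))"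

text \<open>\<open>Z\<close> needs to be correct at \<open>t\<close> itself only if it occurs unguarded, which is what breaks the
  circularity at binders.\<close>

definition hyps_correct :: "'f env \<Rightarrow> (('f strat \<times> 'f strat) \<times> nat) set \<Rightarrow> 'f trm \<Rightarrow> nat set \<Rightarrow> bool" where
  "hyps_correct \<rho> \<Gamma> t U \<longleftrightarrow> fail_agree \<rho> \<and> (\<forall>A B Z s. ((A, B), Z) \<in> \<Gamma> \<longrightarrow>
     depth s < depth t \<or> s = t \<and> Z \<in> U \<longrightarrow> is_join (snd (\<rho> Z) s) A B s)"

lemma hyps_mono: "hyps_correct \<rho> \<Gamma> t U \<Longrightarrow> V \<subseteq> U \<Longrightarrow> hyps_correct \<rho> \<Gamma> t V"
  unfolding hyps_correct_def by blast

lemma hyps_smaller: "hyps_correct \<rho> \<Gamma> t U \<Longrightarrow> depth s < depth t \<Longrightarrow> hyps_correct \<rho> \<Gamma> s V"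
  unfolding hyps_correct_def by (meson less_trans)

lemma is_join_empty: "Psi A t = [] \<or> Psi B t = [] \<Longrightarrow> is_join [] A B t"
  by (auto simp: is_join_def)

lemma is_join_Mu:
  assumes IH: "\<And>\<rho> t. hyps_correct \<rho> (insert ((A, B), Z) \<Gamma>) t (unguarded R) \<Longrightarrow> is_join (Psi_env \<rho> R t) A B t"
    and Z: "Z \<notin> snd ` \<Gamma>" "Z \<notin> unguarded R" and R: "conj_lists R"
    and p: "hyps_correct \<rho> \<Gamma> t (unguarded (Mu Z R))"
  shows "is_join (Psi_env \<rho> (Mu Z R) t) A B t"
proof -
  have agree: "fail_agree \<rho>" using p by (simp add: hyps_correct_def)
  let ?m = "mu_approx \<rho> Z R"
  \<comment> \<open>The restriction to \<open>t\<close> and shallower terms is the range in which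
    the older labels are known to be correct.\<close>
  have "is_join (snd (?m i) s) A B s" if "depth s < i" "depth s < depth t \<or> s = t" for i s
    using that
  proof (induction i arbitrary: s)
    case (Suc i)
    have "hyps_correct (\<rho>(Z := ?m i)) (insert ((A, B), Z) \<Gamma>) s (unguarded R)"
      unfolding hyps_correct_def
    proof (intro conjI allI impI)
      show "fail_agree (\<rho>(Z := ?m i))" by (rule fail_agree_mu_approx[OF R agree])
      fix A' B' Z' r
      assume e: "((A', B'), Z') \<in> insert ((A, B), Z) \<Gamma>"
        and r: "depth r < depth s \<or> r = s \<and> Z' \<in> unguarded R"
      show "is_join (snd ((\<rho>(Z := ?m i)) Z') r) A' B' r"
      proof (cases "Z' = Z")
        case True
        \<comment> \<open>Freshness makes \<open>Z\<close> the label of this pair only.\<close>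
        then have "A' = A" "B' = B" using e Z(1) by force+
        moreover have "depth r < depth s" using r Z(2) True by auto
        ultimately show ?thesis using Suc True by auto
      next
        case False
        then have "((A', B'), Z') \<in> \<Gamma>" using e by auto
        moreover have "depth r < depth t \<or> r = t \<and> Z' \<in> unguarded (Mu Z R)" using r Suc.prems False by auto
        ultimately have "is_join (snd (\<rho> Z') r) A' B' r" using p unfolding hyps_correct_def by blast
        then show ?thesis using False by simp
      qed
    qed
    then show ?case unfolding mu_approx_Suc snd_conv by (rule IH)
  qed simp
  then show ?thesis unfolding Mu_eq_mu_approx[OF R agree] by simp
qed

section \<open>Joins under positions and choices\<close>

lemma is_join_at_pden:
  assumes "p \<in> poss t \<Longrightarrow> is_join (Psi_env \<rho> R (subt_at t p)) A B (subt_at t p)"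
  shows "normal (at_pden p (Psi_env \<rho> R) t)"
    and "map_of (at_pden p (Psi_env \<rho> R) t) = mjoin (map_of (at_pden p (Psi A) t)) (map_of (at_pden p (Psi B) t))"
proof -
  show "normal (at_pden p (Psi_env \<rho> R) t)"
    using assms by (simp add: at_pden_def is_join_def normal_prefix_pos)
  show "map_of (at_pden p (Psi_env \<rho> R) t) = mjoin (map_of (at_pden p (Psi A) t)) (map_of (at_pden p (Psi B) t))"
  proof (cases "p \<in> poss t")
    case True
    let ?s = "subt_at t p"
    have "map_of (Psi_env \<rho> R ?s) q = mjoin (map_of (Psi A ?s)) (map_of (Psi B ?s)) q" for q
      using assms[OF True] by (simp add: is_join_def)
    then show ?thesis using True
      by (intro ext) (auto simp: mjoin_def at_pden_def map_of_prefix_pos split: option.split)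
  qed (simp add: at_pden_def)
qed

lemma is_join_At:
  assumes "p \<in> poss t \<Longrightarrow> is_join (Psi_env \<rho> R (subt_at t p)) A B (subt_at t p)"
  shows "is_join (Psi_env \<rho> (At p R) t) (At p A) (At p B) t"
  using is_join_at_pden[OF assms] by (simp add: is_join_def Psi_simps)

lemma Psi_AtI: "Psi (AtI p \<tau>) t = Psi (At p (AtI [] \<tau>)) t"
  by (simp add: Psi_simps at_pden_def prefix_pos_def)

lemma Psi_At_Cons: "Psi (At [i] (At p S)) t = Psi (At (i # p) S) t"
proof -
  have "Psi (At p S) = at_pden p (Psi S)" by (intro ext) (simp add: Psi_simps)
  then show ?thesis using at_pden_append[of "[i]" p "Psi S" t] by (simp add: Psi_simps)
qed

lemma Psi_AtI_Cons: "Psi (At [i] (AtI p \<tau>)) t = Psi (AtI (i # p) \<tau>) t"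
proof -
  have "Psi (AtI p \<tau>) = Psi (At p (AtI [] \<tau>))" by (intro ext) (rule Psi_AtI)
  then show ?thesis using Psi_At_Cons[of i p "AtI [] \<tau>" t] Psi_AtI[of "i # p" \<tau> t]
    by (simp add: Psi_simps(5))
qed

lemma is_join_cong: "is_join E A B t \<Longrightarrow> Psi A t = Psi A' t \<Longrightarrow> Psi B t = Psi B' t \<Longrightarrow> is_join E A' B' t"
  by (simp add: is_join_def)

lemma is_join_Nil_iff: "is_join E A B t \<Longrightarrow> E = [] \<longleftrightarrow> Psi A t = [] \<or> Psi B t = []"
  using map_of_eq_empty[of E] by (simp add: is_join_def)

lemma porelse_not_Nil: "E \<noteq> [] \<Longrightarrow> porelse E F = E"
  by (cases E) auto

text \<open>If the first join is empty, either \<open>B\<close> fails, and then both joins do, or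
  \<open>A1\<close> fails, and then the choice passes to \<open>A2\<close>.\<close>

lemma is_join_choice_l:
  assumes "is_join E A1 B t" "is_join E' A2 B t"
  shows "is_join (porelse E E') (Choice A1 A2) B t"
proof (cases "E = []")
  case True
  show ?thesis
  proof (cases "Psi B t = []")
    case True
    then show ?thesis using assms[THEN is_join_Nil_iff] by (simp add: is_join_empty)
  next
    case False
    then have "Psi A1 t = []" using \<open>E = []\<close> is_join_Nil_iff[OF assms(1)] by simp
    then show ?thesis using assms(2) \<open>E = []\<close> by (simp add: is_join_def Psi_simps(3))
  qed
next
  case False
  then show ?thesis using assms(1) is_join_Nil_iff[OF assms(1)] by (simp add: is_join_def Psi_simps(3) porelse_not_Nil)
qed

lemma is_join_choice_r:
  assumes "is_join E A B1 t" "is_join E' A B2 t"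
  shows "is_join (porelse E E') A (Choice B1 B2) t"
proof (cases "E = []")
  case True
  show ?thesis
  proof (cases "Psi A t = []")
    case True
    then show ?thesis using assms[THEN is_join_Nil_iff] by (simp add: is_join_empty)
  next
    case False
    then have "Psi B1 t = []" using \<open>E = []\<close> is_join_Nil_iff[OF assms(1)] by simp
    then show ?thesis using assms(2) \<open>E = []\<close> by (simp add: is_join_def Psi_simps(3))
  qed
next
  case False
  then show ?thesis using assms(1) is_join_Nil_iff[OF assms(1)] by (simp add: is_join_def Psi_simps(3) porelse_not_Nil)
qed

section \<open>Joins of lists of entries\<close>

lemma Psi_adm_Br:
  assumes "adm (Br L \<phi>)"
  shows "map_of (Psi (Br L \<phi>) t) = brmap (cmap env0 L t)" "fits (cmap env0 L t)"
proof -
  have c: "distinct (map fst L)" "\<And>S. ([], S) \<in> set L \<Longrightarrow> is_ins S" "\<And>p S. (p, S) \<in> set L \<Longrightarrow> regular S"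
    using assms unfolding regular_Br by auto
  have 1: "normal (at_pden p (Psi_env env0 S) t)" if "(p, S) \<in> set L" for p S
    using normal_Psi[OF c(3)[OF that]] unfolding Psi_def by (rule normal_at_pden)
  have 2: "dom (map_of (Psi_env env0 S t)) = {[]}" if "([], S) \<in> set L" for S
    using c(2)[OF that] by (elim is_insE) simp
  note Br = Psi_env_Br[OF fail_agree_env0 _ c(1) 1 2, of \<phi>]
  show "map_of (Psi (Br L \<phi>) t) = brmap (cmap env0 L t)" "fits (cmap env0 L t)"
    using Br assms regular_conj_lists[of "Br L \<phi>"] unfolding Psi_def by blast+
qed

lemma cmap_single: "cmap \<rho> [(i, S)] t = [i \<mapsto> map_of (at_pden i (Psi_env \<rho> S) t)]"
  by (auto simp: cmap_def fun_eq_iff)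

text \<open>A strategy at one position behaves as a list with one entry, so the clauses for a
  position against a list can share \<open>is_join_Br\<close>.\<close>

lemma Psi_single:
  assumes "i \<in> N_eps" "i = [] \<Longrightarrow> is_ins S"
  shows "map_of (Psi (At i S) t) = brmap (cmap env0 [(i, S)] t)" "fits (cmap env0 [(i, S)] t)"
proof -
  have Psi: "Psi (At i S) t = at_pden i (Psi_env env0 S) t" by (simp add: Psi_def)
  have *: "take 1 q = i" if "map_of (at_pden i (Psi_env env0 S) t) q \<noteq> None" for q
  proof (cases "i = []")
    case True
    then show ?thesis using assms(2) that by (auto elim!: is_insE split: if_splits)
  next
    case False
    then show ?thesis using assms(1) that
      by (auto simp: N_eps_def map_of_at_pden prefix_def split: if_splits)
  qed
  show "map_of (Psi (At i S) t) = brmap (cmap env0 [(i, S)] t)"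
    unfolding cmap_single Psi by (rule brmap_single(1)[OF *, symmetric])
  show "fits (cmap env0 [(i, S)] t)"
    unfolding cmap_single by (rule brmap_single(2)[OF *])
qed

text \<open>The counterpart of \<open>is_join\<close> for bare lists of entries. Besides the
  equation for \<open>cmap\<close> it collects premises of \<open>Psi_env_Br\<close>.\<close>

definition joined :: "'f env \<Rightarrow> (pos \<times> 'f strat) list \<Rightarrow> (pos \<times> 'f strat) list \<Rightarrow> (pos \<times> 'f strat) list \<Rightarrow> 'f trm \<Rightarrow> bool" where
  "joined \<rho> K L L' t \<longleftrightarrow> distinct (map fst K) \<and> cmap \<rho> K t = cjoin (cmap env0 L t) (cmap env0 L' t) \<and>
     (\<forall>(p, S)\<in>set K. normal (at_pden p (Psi_env \<rho> S) t)) \<and>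
     (\<forall>S. ([], S) \<in> set K \<longrightarrow> dom (map_of (Psi_env \<rho> S t)) = {[]})"

lemma is_join_Br:
  assumes "joined \<rho> K L L' t" "fail_agree \<rho>" "conj_lists (Br K \<phi>)"
    and "map_of (Psi A t) = brmap (cmap env0 L t)" "fits (cmap env0 L t)"
    and "map_of (Psi B t) = brmap (cmap env0 L' t)" "fits (cmap env0 L' t)"
  shows "is_join (Psi_env \<rho> (Br K \<phi>) t) A B t"
proof -
  have K: "distinct (map fst K)" "cmap \<rho> K t = cjoin (cmap env0 L t) (cmap env0 L' t)"
    "\<And>p S. (p, S) \<in> set K \<Longrightarrow> normal (at_pden p (Psi_env \<rho> S) t)"
    "\<And>S. ([], S) \<in> set K \<Longrightarrow> dom (map_of (Psi_env \<rho> S t)) = {[]}"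
    using assms(1) unfolding joined_def by blast+
  note Br = Psi_env_Br[OF assms(2,3) K(1,3,4)]
  show ?thesis unfolding is_join_def assms(4,6)
    using Br(1,2) unfolding K(2) brmap_cjoin[OF assms(5,7)] by simp
qed

lemma map_of_order_entries: "distinct (map fst L) \<Longrightarrow> map_of (order_entries L) = map_of L"
  by (intro map_of_cong_set distinct_order_entries) simp_all

lemma cmap_closed: "adm_list L \<Longrightarrow> cmap \<rho> L t p = cmap env0 L t p"
proof -
  assume "adm_list L"
  then have "Psi_env \<rho> S = Psi_env env0 S" if "map_of L p = Some S" for S
    using that Psi_env_closed[of S \<rho>] unfolding adm_list_def Psi_def by (auto dest!: map_of_SomeD)
  then show ?thesis by (auto simp: cmap_def option.map_comp intro!: map_option_cong)
qed

lemma adm_list_entry: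
  assumes "adm_list L" "(p, S) \<in> set L"
  shows "normal (at_pden p (Psi_env \<rho> S) t)" "p = [] \<Longrightarrow> dom (map_of (Psi_env \<rho> S t)) = {[]}"
proof -
  have S: "adm S" "p = [] \<Longrightarrow> is_ins S" using assms unfolding adm_list_def by auto
  show "normal (at_pden p (Psi_env \<rho> S) t)"
    using Psi_env_closed[of S \<rho>] normal_Psi[of S] S(1) by (intro normal_at_pden) simp
  show "dom (map_of (Psi_env \<rho> S t)) = {[]}" if "p = []"
    using S(2)[OF that] by (elim is_insE) simp
qed

lemma joined_two:
  assumes "i \<noteq> j" "adm S" "adm T" "i = [] \<Longrightarrow> is_ins S" "j = [] \<Longrightarrow> is_ins T"
  shows "joined \<rho> (order_entries [(i, S), (j, T)]) [(i, S)] [(j, T)] t"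
proof -
  have adm: "adm_list [(i, S), (j, T)]" "adm_list [(i, S)]" "adm_list [(j, T)]" using assms by (auto simp: adm_list_def)
  have d: "distinct (map fst [(i, S), (j, T)])" using assms(1) by simp
  have "cmap \<rho> (order_entries [(i, S), (j, T)]) t = cmap env0 [(i, S), (j, T)] t"
    using cmap_closed[OF adm(1), of \<rho> t] unfolding cmap_def map_of_order_entries[OF d] by auto
  also have "\<dots> = cjoin (cmap env0 [(i, S)] t) (cmap env0 [(j, T)] t)"
    using assms(1) by (auto simp: cmap_def cjoin_def fun_eq_iff)
  finally show ?thesis
    unfolding joined_def using distinct_order_entries[OF d] adm_list_entry[OF adm(1)] by auto
qed

lemma is_join_two_entries:
  assumes ij: "i \<in> N_eps" "j \<in> N_eps" "i \<noteq> j" "adm S" "adm T" "i = [] \<Longrightarrow> is_ins S" "j = [] \<Longrightarrow> is_ins T"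
    and \<rho>: "fail_agree \<rho>"
  shows "is_join (Psi_env \<rho> (two_entries (i, S) (j, T)) t) (At i S) (At j T) t"
  unfolding two_entries_def
proof (rule is_join_Br[OF joined_two \<rho> _ Psi_single Psi_single])
  show "conj_lists (Br (order_entries [(i, S), (j, T)])
     (if fst (i, S) = [] then FPos (fst (j, T)) else if fst (j, T) = [] then FPos (fst (i, S))
      else FAnd (FPos (fst (i, S))) (FPos (fst (j, T)))))"
    using ij unfolding conj_lists_Br by (auto simp: regular_conj_lists)
qed (use ij in auto)

text \<open>\<open>K\<close> occupies exactly the common positions, where the hypothesis applies;
  the entries copied from one side are closed, hence independent of the environment.\<close>

lemma joined_entries:
  assumes K: "map fst K = filter (\<lambda>i. i \<in> fst ` set L') (map fst L)" and L: "adm_list L" "adm_list L'"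
    and IH: "\<And>i S S' R. (i, S) \<in> set L \<Longrightarrow> (i, S') \<in> set L' \<Longrightarrow> (i, R) \<in> set K \<Longrightarrow> i \<in> poss t \<Longrightarrow>
       is_join (Psi_env \<rho> R (subt_at t i)) S S' (subt_at t i)"
  shows "joined \<rho> (order_entries (K @ filter (\<lambda>(i, S). i \<notin> fst ` set L') L
                                          @ filter (\<lambda>(i, S). i \<notin> fst ` set L) L')) L L' t"
proof -
  let ?K = "K @ filter (\<lambda>(i, S). i \<notin> fst ` set L') L @ filter (\<lambda>(i, S). i \<notin> fst ` set L) L'"
  have d: "distinct (map fst L)" "distinct (map fst L')" using L by (auto simp: adm_list_def)
  have fK: "fst ` set K = fst ` set L \<inter> fst ` set L'"
    using arg_cong[OF K, of set] by auto
  have dK: "distinct (map fst K)" unfolding K using d(1) by simp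
  have flt: "fst ` set (filter (\<lambda>(i, S). i \<notin> A) M) = fst ` set M - A" for A and M :: "(pos \<times> 'a strat) list"
    by (force simp: image_iff)
  have dflt: "distinct (map fst (filter P M))" if "distinct (map fst M)" for P and M :: "(pos \<times> 'a strat) list"
    using that by (simp add: distinct_map_filter)
  have dd: "distinct (map fst ?K)"
    using dK dflt[OF d(1)] dflt[OF d(2)] unfolding map_append distinct_append set_append set_map flt fK by auto
  have common: "normal (at_pden p (Psi_env \<rho> R) t)"
    "map_of (at_pden p (Psi_env \<rho> R) t) = mjoin (map_of (at_pden p (Psi S) t)) (map_of (at_pden p (Psi S') t))"
    if "(p, S) \<in> set L" "(p, S') \<in> set L'" "(p, R) \<in> set K" for p S S' R
    using is_join_at_pden[OF IH[OF that]] by blast+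
  have cm: "cmap \<rho> ?K t p = cjoin (cmap env0 L t) (cmap env0 L' t) p" for p
  proof -
    have mo: "map_of ?K p = (case map_of L p of None \<Rightarrow> map_of L' p
        | Some S \<Rightarrow> (case map_of L' p of None \<Rightarrow> Some S | Some S' \<Rightarrow> map_of K p))"
    proof -
      have N: "map_of K p = None \<longleftrightarrow> map_of L p = None \<or> map_of L' p = None"
        unfolding map_of_eq_None_iff fK by auto
      have i: "p \<in> fst ` set L \<longleftrightarrow> map_of L p \<noteq> None" "p \<in> fst ` set L' \<longleftrightarrow> map_of L' p \<noteq> None"
        by (simp_all add: map_of_eq_None_iff)
      show ?thesis
        unfolding map_of_append map_add_def map_of_filter_key i using N
        by (cases "map_of L p"; cases "map_of L' p"; cases "map_of K p") auto
    qed
    show ?thesis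
    proof (cases "map_of L p")
      case None
      then show ?thesis using cmap_closed[OF L(2), of \<rho> t p] mo by (simp add: cmap_def cjoin_def)
    next
      case S: (Some S)
      show ?thesis
      proof (cases "map_of L' p")
        case None
        then show ?thesis using S cmap_closed[OF L(1), of \<rho> t p] mo by (simp add: cmap_def cjoin_def)
      next
        case S': (Some S')
        have "p \<in> fst ` set K" unfolding fK using S S' by (auto dest!: map_of_SomeD intro: rev_image_eqI)
        then obtain R where R: "map_of K p = Some R" by (metis map_of_eq_None_iff option.exhaust)
        show ?thesis
          using common(2)[of p S S' R] S S' R mo
          by (simp add: cmap_def cjoin_def map_of_SomeD Psi_def)
      qed
    qed
  qed
  have sides: "(\<exists>S S'. (p, S) \<in> set L \<and> (p, S') \<in> set L' \<and> (p, R) \<in> set K) \<or> (p, R) \<in> set L \<or> (p, R) \<in> set L'"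
    if "(p, R) \<in> set ?K" for p R
  proof (cases "(p, R) \<in> set K")
    case True
    then have "p \<in> fst ` set K" by force
    then show ?thesis using True unfolding fK by auto
  qed (use that in auto)
  show ?thesis unfolding joined_def
  proof (intro conjI)
    show "distinct (map fst (order_entries ?K))" by (rule distinct_order_entries[OF dd])
    show "cmap \<rho> (order_entries ?K) t = cjoin (cmap env0 L t) (cmap env0 L' t)"
      using cm unfolding cmap_def map_of_order_entries[OF dd] by (intro ext) 
    show "\<forall>(p, S)\<in>set (order_entries ?K). normal (at_pden p (Psi_env \<rho> S) t)"
      unfolding set_order_entries using sides common(1) adm_list_entry(1)[OF L(1)] adm_list_entry(1)[OF L(2)] by blast
    show "\<forall>S. ([], S) \<in> set (order_entries ?K) \<longrightarrow> dom (map_of (Psi_env \<rho> S t)) = {[]}"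
    proof (intro allI impI)
      fix R assume "([], R) \<in> set (order_entries ?K)"
      then have "([], R) \<in> set ?K" unfolding set_order_entries .
      from sides[OF this] show "dom (map_of (Psi_env \<rho> R t)) = {[]}"
      proof (elim disjE exE conjE)
        \<comment> \<open>At the root both entries are insertions, and joining two insertions again
          gives a map with the single key \<open>[]\<close>.\<close>
        fix S S' assume S: "([], S) \<in> set L" "([], S') \<in> set L'" "([], R) \<in> set K"
        then have "is_ins S" "is_ins S'" using L unfolding adm_list_def by auto
        moreover have "map_of (Psi_env \<rho> R t) = mjoin (map_of (Psi S t)) (map_of (Psi S' t))"
          using common(2)[OF S] by simp
        ultimately show ?thesis
          by (auto elim!: is_insE simp: Psi_simps mjoin_def fun_eq_iff split: if_splits option.splits)
      qed (use adm_list_entry(2) L in blast)+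
    qed
  qed
qed

text \<open>Labels act as induction hypotheses: \<open>mu_hyp\<close> reads off their assumed
  correctness and the binder rules supply it. The environment and the term are arbitrary, since
  binders reinterpret labels and positions move to subterms.\<close>

lemma is_join_unif:
  "unif \<Gamma> S S' R \<Longrightarrow> adm S \<Longrightarrow> adm S' \<Longrightarrow> hyps_correct \<rho> \<Gamma> t (unguarded R) \<Longrightarrow> is_join (Psi_env \<rho> R t) S S' t"
  "unif_entries \<Gamma> L L' K \<Longrightarrow> adm_list L \<Longrightarrow> adm_list L' \<Longrightarrow> hyps_correct \<rho> \<Gamma> t (unguarded (Br K FTrue)) \<Longrightarrow>
    joined \<rho> K L L' t"
proof (induction arbitrary: \<rho> t and \<rho> t rule: unif_unif_entries.inducts)
  case (fail_l \<Gamma> S)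
  then show ?case by (simp add: is_join_empty Psi_simps)
next
  case (fail_r \<Gamma> S)
  then show ?case by (simp add: is_join_empty Psi_simps)
next
  case (ins_ins_same i \<Gamma> \<tau> \<tau>')
  show ?case
    by (auto simp: is_join_def Psi_simps at_pden_def prefix_pos_def normal_def mjoin_def fun_eq_iff)
next
  case (ins_ins i j \<Gamma> \<tau> \<tau>')
  then show ?case
    by (intro is_join_cong[OF is_join_two_entries]) (auto simp: hyps_correct_def Psi_AtI[of i] Psi_AtI[of j])
next
  case (ins_at_same i \<Gamma> \<tau> S R)
  show ?case
  proof (rule is_join_cong[OF is_join_At])
    assume "i \<in> poss t"
    \<comment> \<open>For \<open>i = []\<close> the term and the unguarded labels are unchanged;
      otherwise the subterm is shallower and \<open>hyps_smaller\<close> makes all labels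
      available.\<close>
    then show "is_join (Psi_env \<rho> R (subt_at t i)) (AtI [] \<tau>) S (subt_at t i)"
      using ins_at_same.prems depth_subt_at[of i t]
      by (intro ins_at_same.IH) (cases "i = []"; auto elim: hyps_smaller)+
  qed (simp_all add: Psi_AtI[of i])
next
  case (at_ins_same i \<Gamma> S \<tau> R)
  show ?case
  proof (rule is_join_cong[OF is_join_At])
    assume "i \<in> poss t"
    then show "is_join (Psi_env \<rho> R (subt_at t i)) S (AtI [] \<tau>) (subt_at t i)"
      using at_ins_same.prems depth_subt_at[of i t]
      by (intro at_ins_same.IH) (cases "i = []"; auto elim: hyps_smaller)+
  qed (simp_all add: Psi_AtI[of i])
next
  case (ins_at i j \<Gamma> \<tau> S)
  then show ?case
    by (intro is_join_cong[OF is_join_two_entries]) (auto simp: hyps_correct_def Psi_AtI[of i])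
next
  case (at_ins i j \<Gamma> S \<tau>)
  then show ?case
    by (intro is_join_cong[OF is_join_two_entries]) (auto simp: hyps_correct_def Psi_AtI[of i])
next
  case (at_at_same i \<Gamma> S S' R)
  show ?case
  proof (rule is_join_At)
    assume "i \<in> poss t"
    then show "is_join (Psi_env \<rho> R (subt_at t i)) S S' (subt_at t i)"
      using at_at_same.prems depth_subt_at[of i t]
      by (intro at_at_same.IH) (cases "i = []"; auto elim: hyps_smaller)+
  qed
next
  case (at_at i j \<Gamma> S S')
  then show ?case by (intro is_join_two_entries) (auto simp: hyps_correct_def)
next
  case (eps_l \<Gamma> S T R)
  then have "is_join (Psi_env \<rho> R t) S T t" by simp
  then show ?case by (simp add: is_join_def Psi_simps)
next
  case (eps_r \<Gamma> T S R)
  then have "is_join (Psi_env \<rho> R t) T S t" by simp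
  then show ?case by (simp add: is_join_def Psi_simps)
next
  case (split_at_l p \<Gamma> i S T R)
  show ?case
    by (rule is_join_cong[OF split_at_l.IH])
      (use split_at_l.prems in \<open>simp_all add: Psi_At_Cons\<close>)
next
  case (split_at_r p \<Gamma> T i S R)
  show ?case
    by (rule is_join_cong[OF split_at_r.IH])
      (use split_at_r.prems in \<open>simp_all add: Psi_At_Cons\<close>)
next
  case (split_ins_l p \<Gamma> i \<tau> T R)
  show ?case
    by (rule is_join_cong[OF split_ins_l.IH])
      (use split_ins_l.prems in \<open>simp_all add: Psi_AtI_Cons\<close>)
next
  case (split_ins_r p \<Gamma> T i \<tau> R)
  show ?case
    by (rule is_join_cong[OF split_ins_r.IH])
      (use split_ins_r.prems in \<open>simp_all add: Psi_AtI_Cons\<close>)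
next
  case (condI_l \<Gamma> u \<tau> T R)
  show ?case by (rule is_join_cong[OF condI_l.IH]) (use condI_l.prems in \<open>simp_all add: Psi_simps\<close>)
next
  case (condI_r \<Gamma> T u \<tau> R)
  show ?case by (rule is_join_cong[OF condI_r.IH]) (use condI_r.prems in \<open>simp_all add: Psi_simps\<close>)
next
  case (ins_cond u i \<Gamma> \<tau> S R)
  then have "is_join (Psi_env \<rho> R t) (AtI i \<tau>) S t" by simp
  then show ?case by (simp add: is_join_def Psi_simps(2))
next
  case (cond_ins u i \<Gamma> S \<tau> R)
  then have "is_join (Psi_env \<rho> R t) S (AtI i \<tau>) t" by simp
  then show ?case by (simp add: is_join_def Psi_simps(2))
next
  case (ins_cond_fail i u \<Gamma> \<tau> S)
  then show ?case using not_arg_pos[of i u t]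
    by (cases "matches u t") (simp_all add: is_join_empty Psi_simps at_pden_def)
next
  case (cond_ins_fail i u \<Gamma> S \<tau>)
  then show ?case using not_arg_pos[of i u t]
    by (cases "matches u t") (simp_all add: is_join_empty Psi_simps at_pden_def)
next
  case (cond_cond u u' w \<Gamma> S S' R)
  then have "is_join (Psi_env \<rho> R t) S S' t" by simp
  then show ?case using matches_meet[OF cond_cond.hyps(1), of t] by (simp add: is_join_def Psi_simps(2))
next
  case (cond_cond_fail u u' \<Gamma> S S')
  then show ?case using not_unifiable_matches[of u u' t] by (auto intro!: is_join_empty simp: Psi_simps)
next
  case (cond_at \<Gamma> S i T R u)
  then have "is_join (Psi_env \<rho> R t) S (At i T) t" by simp
  then show ?case by (simp add: is_join_def Psi_simps(2))
next
  case (at_cond \<Gamma> i T S R u)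
  then have "is_join (Psi_env \<rho> R t) (At i T) S t" by simp
  then show ?case by (simp add: is_join_def Psi_simps(2))
next
  case (cond_br \<Gamma> S L \<phi> R u)
  then have "is_join (Psi_env \<rho> R t) S (Br L \<phi>) t" by simp
  then show ?case by (simp add: is_join_def Psi_simps(2))
next
  case (br_cond \<Gamma> L \<phi> S R u)
  then have "is_join (Psi_env \<rho> R t) (Br L \<phi>) S t" by simp
  then show ?case by (simp add: is_join_def Psi_simps(2))
next
  case (br_br \<Gamma> L L' K \<phi> \<phi>')
  have j: "joined \<rho> K L L' t"
    using br_br.prems adm_list_Br[of L \<phi>] adm_list_Br[of L' \<phi>'] by (intro br_br.IH) auto
  \<comment> \<open>The rule itself is applied again, so that \<open>conj_lists_unif\<close> shows
    the formula to fit the joined list.\<close>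
  have c: "conj_lists (Br K (FAnd \<phi> \<phi>'))"
    using br_br by (intro conj_lists_unif(1)[OF unif_unif_entries.br_br])
  show ?case
    by (rule is_join_Br[OF j _ c Psi_adm_Br[OF br_br.prems(1)] Psi_adm_Br[OF br_br.prems(2)]]) (use br_br.prems in \<open>auto simp: hyps_correct_def\<close>)
next
  case (at_br i \<Gamma> S L' K \<phi>')
  have j: "joined \<rho> K [(i, S)] L' t"
    using at_br.prems at_br.hyps adm_list_single[of S i] adm_list_Br[of L' \<phi>'] by (intro at_br.IH) auto
  have c: "conj_lists (Br K (FAnd (FPos i) \<phi>'))"
    using at_br by (intro conj_lists_unif(1)[OF unif_unif_entries.at_br])
  show ?case
    by (rule is_join_Br[OF j _ c Psi_single Psi_adm_Br[OF at_br.prems(2)]]) (use at_br in \<open>auto simp: hyps_correct_def\<close>)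
next
  case (br_at i \<Gamma> L S K \<phi>)
  have j: "joined \<rho> K L [(i, S)] t"
    using br_at.prems br_at.hyps adm_list_single[of S i] adm_list_Br[of L \<phi>] by (intro br_at.IH) auto
  have c: "conj_lists (Br K (FAnd \<phi> (FPos i)))"
    using br_at by (intro conj_lists_unif(1)[OF unif_unif_entries.br_at])
  show ?case
    by (rule is_join_Br[OF j _ c Psi_adm_Br[OF br_at.prems(1)] Psi_single]) (use br_at in \<open>auto simp: hyps_correct_def\<close>)
next
  case (ins_br i \<Gamma> \<tau> L' K \<phi>')
  let ?\<psi> = "if i = [] then \<phi>' else FAnd (FPos i) \<phi>'"
  have j: "joined \<rho> K [(i, AtI [] \<tau>)] L' t"
    using ins_br.prems adm_list_single[of "AtI [] \<tau>" i] adm_list_Br[of L' \<phi>'] by (intro ins_br.IH) auto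
  have c: "conj_lists (Br K ?\<psi>)"
    using ins_br by (intro conj_lists_unif(1)[OF unif_unif_entries.ins_br])
  \<comment> \<open>The insertion is read as \<open>At i (AtI [] \<tau>)\<close>, which
    \<open>Psi_single\<close> treats as a list with one entry.\<close>
  have "is_join (Psi_env \<rho> (Br K ?\<psi>) t) (At i (AtI [] \<tau>)) (Br L' \<phi>') t"
    by (rule is_join_Br[OF j _ c Psi_single Psi_adm_Br[OF ins_br.prems(2)]]) (use ins_br in \<open>auto simp: hyps_correct_def\<close>)
  then show ?case by (rule is_join_cong) (simp_all add: Psi_AtI[of i])
next
  case (br_ins i \<Gamma> L \<tau> K \<phi>)
  let ?\<psi> = "if i = [] then \<phi> else FAnd \<phi> (FPos i)"
  have j: "joined \<rho> K L [(i, AtI [] \<tau>)] t"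
    using br_ins.prems adm_list_single[of "AtI [] \<tau>" i] adm_list_Br[of L \<phi>] by (intro br_ins.IH) auto
  have c: "conj_lists (Br K ?\<psi>)"
    using br_ins by (intro conj_lists_unif(1)[OF unif_unif_entries.br_ins])
  have "is_join (Psi_env \<rho> (Br K ?\<psi>) t) (Br L \<phi>) (At i (AtI [] \<tau>)) t"
    by (rule is_join_Br[OF j _ c Psi_adm_Br[OF br_ins.prems(1)] Psi_single]) (use br_ins in \<open>auto simp: hyps_correct_def\<close>)
  then show ?case by (rule is_join_cong) (simp_all add: Psi_AtI[of i])
next
  case (choice_l \<Gamma> S1 T R1 S2 R2)
  then have "is_join (Psi_env \<rho> R1 t) S1 T t" "is_join (Psi_env \<rho> R2 t) S2 T t"
    by (auto intro!: choice_l.IH elim: hyps_mono)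
  then show ?case using is_join_choice_l by simp
next
  case (choice_r \<Gamma> T S1 R1 S2 R2)
  then have "is_join (Psi_env \<rho> R1 t) T S1 t" "is_join (Psi_env \<rho> R2 t) T S2 t"
    by (auto intro!: choice_r.IH elim: hyps_mono)
  then show ?case using is_join_choice_r by simp
next
  case (mu_hyp S S' Z \<Gamma>)
  then show ?case by (simp add: hyps_correct_def)
next
  case (mu_mu Z \<Gamma> X S X' S' R)
  note M = Mu_unfold[OF mu_mu.prems(1)] and M' = Mu_unfold[OF mu_mu.prems(2)]
  \<comment> \<open>An unguarded \<open>Z\<close> would label a pair no heavier than the unfolded
    one. The new pair is heavier, so \<open>Z\<close> would already occur in \<Gamma>, contrary to
    freshness.\<close>
  have "Z \<notin> unguarded R"
  proof
    assume "Z \<in> unguarded R"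
    then have "labelled (insert ((Mu X S, Mu X' S'), Z) \<Gamma>)
        (mu_height (fsubst X (Mu X S) S) + mu_height (fsubst X' (Mu X' S') S')) Z"
      using mu_mu.hyps M M' by (intro unguarded_unif(1))
    then have "labelled \<Gamma> (mu_height (fsubst X (Mu X S) S) + mu_height (fsubst X' (Mu X' S') S')) Z"
      by (rule labelled_insert) (use M M' in simp)
    then show False using mu_mu.hyps(1) by (force simp: labelled_def)
  qed
  moreover have "is_join (Psi_env \<rho> R t) (Mu X S) (Mu X' S') t"
    if "hyps_correct \<rho> (insert ((Mu X S, Mu X' S'), Z) \<Gamma>) t (unguarded R)" for \<rho> t
    by (rule is_join_cong[OF mu_mu.IH[OF _ _ that]]) (use M M' in simp_all)
  moreover have "conj_lists R" using mu_mu.hyps M M' by (intro conj_lists_unif(1))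
  ultimately show ?case using mu_mu.hyps(1) mu_mu.prems(3) by (intro is_join_Mu)
next
  case (mu_l T X S \<Gamma> R)
  note M = Mu_unfold[OF mu_l.prems(1)]
  show ?case by (rule is_join_cong[OF mu_l.IH]) (use M mu_l.prems in simp_all)
next
  case (mu_r T \<Gamma> X S R)
  note M = Mu_unfold[OF mu_r.prems(2)]
  show ?case by (rule is_join_cong[OF mu_r.IH]) (use M mu_r.prems in simp_all)
next
  case (mu_rec_l T Z \<Gamma> X S R)
  note M = Mu_unfold[OF mu_rec_l.prems(1)]
  have "Z \<notin> unguarded R"
  proof
    assume "Z \<in> unguarded R"
    then have "labelled (insert ((Mu X S, T), Z) \<Gamma>) (mu_height (fsubst X (Mu X S) S) + mu_height T) Z"
      using mu_rec_l.hyps mu_rec_l.prems M by (intro unguarded_unif(1))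
    then have "labelled \<Gamma> (mu_height (fsubst X (Mu X S) S) + mu_height T) Z"
      by (rule labelled_insert) (use M in simp)
    then show False using mu_rec_l.hyps(2) by (force simp: labelled_def)
  qed
  moreover have "is_join (Psi_env \<rho> R t) (Mu X S) T t"
    if "hyps_correct \<rho> (insert ((Mu X S, T), Z) \<Gamma>) t (unguarded R)" for \<rho> t
    by (rule is_join_cong[OF mu_rec_l.IH[OF _ _ that]]) (use M mu_rec_l.prems in simp_all)
  moreover have "conj_lists R" using mu_rec_l.hyps mu_rec_l.prems M by (intro conj_lists_unif(1))
  ultimately show ?case using mu_rec_l.hyps(2) mu_rec_l.prems(3) by (intro is_join_Mu)
next
  case (mu_rec_r T Z \<Gamma> X S R)
  note M = Mu_unfold[OF mu_rec_r.prems(2)]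
  have "Z \<notin> unguarded R"
  proof
    assume "Z \<in> unguarded R"
    then have "labelled (insert ((T, Mu X S), Z) \<Gamma>) (mu_height T + mu_height (fsubst X (Mu X S) S)) Z"
      using mu_rec_r.hyps mu_rec_r.prems M by (intro unguarded_unif(1))
    then have "labelled \<Gamma> (mu_height T + mu_height (fsubst X (Mu X S) S)) Z"
      by (rule labelled_insert) (use M in simp)
    then show False using mu_rec_r.hyps(2) by (force simp: labelled_def)
  qed
  moreover have "is_join (Psi_env \<rho> R t) T (Mu X S) t"
    if "hyps_correct \<rho> (insert ((T, Mu X S), Z) \<Gamma>) t (unguarded R)" for \<rho> t
    by (rule is_join_cong[OF mu_rec_r.IH[OF _ _ that]]) (use M mu_rec_r.prems in simp_all)
  moreover have "conj_lists R" using mu_rec_r.hyps mu_rec_r.prems M by (intro conj_lists_unif(1))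
  ultimately show ?case using mu_rec_r.hyps(2) mu_rec_r.prems(3) by (intro is_join_Mu)
next
  case (entries K L' L \<Gamma>)
  show ?case
  proof (rule joined_entries[OF entries.hyps(1) entries.prems(1,2)])
    fix i S S' R assume e: "(i, S) \<in> set L" "(i, S') \<in> set L'" "(i, R) \<in> set K" and i: "i \<in> poss t"
    have "adm S" "adm S'" using e entries.prems unfolding adm_list_def by auto
    moreover have "hyps_correct \<rho> \<Gamma> (subt_at t i) (unguarded R)"
    proof (cases "i = []")
      case True
      then have "unguarded R \<subseteq> unguarded (Br (order_entries (K @ filter (\<lambda>(i, S). i \<notin> fst ` set L') L
                                          @ filter (\<lambda>(i, S). i \<notin> fst ` set L) L')) FTrue)"
        using e(3) by force
      then show ?thesis using hyps_mono[OF entries.prems(3)] True by simp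
    next
      case False
      then show ?thesis using hyps_smaller[OF entries.prems(3)] depth_subt_at[OF i] by blast
    qed
    ultimately show "is_join (Psi_env \<rho> R (subt_at t i)) S S' (subt_at t i)" using entries.IH[OF e] by blast
  qed
qed

theorem theorem1:
  fixes ar :: "'f \<Rightarrow> nat" and t :: "'f trm" and S S' R :: "'f strat"
  assumes "\<exists>c. ar c = 0"
    and "wf_trm ar t"
    and "S \<in> C_can ar" and "S' \<in> C_can ar"
    and "unif {} S S' R"
  shows "Psi R t \<simeq> Psi S t \<sqinter>p Psi S' t"
proof -
  have adm: "adm S" "adm S'" using assms(3,4) regular_C_can by (auto simp: C_can_def)
  \<comment> \<open>No formal symbol has been recorded yet, so only agreement on failure remains to
    be checked.\<close>
  have "hyps_correct env0 {} t (unguarded R)" using fail_agree_env0 by (simp add: hyps_correct_def)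
  then have "is_join (Psi R t) S S' t"
    unfolding Psi_def by (rule is_join_unif(1)[OF assms(5) adm])
  then show ?thesis
    using adm by (intro peq_if_map_of_eq) (auto simp: is_join_def punify normal_Psi)
qed

end
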